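(* Let $D$ be a convex domain in $\mathbb C^n$. Then the function $$D\ni z\mapsto -\log\lambda^{2n}(I_D(z))$$ is convex on $D$, where $I_D(z)$ is the Azukawa indicatrix of $D$ at $z$.
   Context: $\lambda^{2n}$ is Lebesgue measure on $\mathbb C^n$. For $w\in D$, $G_D(\cdot,w)$ is the pluricomplex Green function with pole at $w$: the supremum of all negative plurisubharmonic functions $u$ on $D$ such that $u(z)\le \log|z-w|+C$ near $w$ for some constant $C$ (it may be identically $-\infty$). The Azukawa pseudometric is $$A_D(w;X):=\exp\Big(\limsup_{\lambda\to 0,\,\lambda\ne0}\big(G_D(w+\lambda X,w)-\log|\lambda|\big)\Big),\quad w\in D,\ X\in\mathbb C^n,$$ and the Azukawa indicatrix at $w$ is $I_D(w):=\{X\in\mathbb C^n: A_D(w;X)<1\}$. Convention: $-\log(+\infty)=-\infty$, and convexity is understood for functions with values in $[-\infty,\infty)$ (the function identically $-\infty$ is regarded as convex). *)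

theory Defs
  imports "HOL-Analysis.Analysis"
begin

definition ennreal_ln :: "ennreal \<Rightarrow> ereal" where
  "ennreal_ln x =
     (if x = 0 then -\<infinity> else if x = top then \<infinity> else ereal (ln (enn2real x)))"

definition ereal_exp :: "ereal \<Rightarrow> ennreal" where
  "ereal_exp x = (case x of ereal r \<Rightarrow> ennreal (exp r) | PInfty \<Rightarrow> top | MInfty \<Rightarrow> 0)"

(* The integral of the positive part minus the integral of the negative part (e2ennreal maps
   negative numbers to 0). It is used only for functions that are bounded above on a space of
   finite measure, so that the first term is finite and the value lies in [-\<infinity>,\<infinity>). *)
definition ereal_integral :: "'a measure \<Rightarrow> ('a \<Rightarrow> ereal) \<Rightarrow> ereal" where
  "ereal_integral M f =
     enn2ereal (\<integral>\<^sup>+ x. e2ennreal (f x) \<partial>M) - enn2ereal (\<integral>\<^sup>+ x. e2ennreal (- f x) \<partial>M)"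

definition usc_on :: "'a::topological_space set \<Rightarrow> ('a \<Rightarrow> ereal) \<Rightarrow> bool" where
  "usc_on S f \<longleftrightarrow> (\<forall>c. openin (top_of_set S) {x \<in> S. f x < c})"

(* The value -\<infinity> is allowed everywhere, in particular on whole components of \<Omega>. *)
definition subharmonic_on :: "complex set \<Rightarrow> (complex \<Rightarrow> ereal) \<Rightarrow> bool" where
  "subharmonic_on \<Omega> u \<longleftrightarrow>
     usc_on \<Omega> u \<and> (\<forall>z\<in>\<Omega>. u z < \<infinity>) \<and>
     (\<forall>a r. r > 0 \<and> cball a r \<subseteq> \<Omega> \<longrightarrow>
        u a \<le> ereal (1 / (2 * pi)) *
          ereal_integral (lebesgue_on {0..2 * pi}) (\<lambda>t. u (a + of_real r * cis t)))"

definition psh_on :: "(complex ^ 'n) set \<Rightarrow> (complex ^ 'n \<Rightarrow> ereal) \<Rightarrow> bool" where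
  "psh_on D u \<longleftrightarrow>
     usc_on D u \<and> (\<forall>z\<in>D. u z < \<infinity>) \<and>
     (\<forall>a X. subharmonic_on {l. a + l *s X \<in> D} (\<lambda>l. u (a + l *s X)))"

(* Only the values of u on the open set D matter. The argument z of green is meant to lie in D. *)
definition green_family :: "(complex ^ 'n) set \<Rightarrow> complex ^ 'n \<Rightarrow> (complex ^ 'n \<Rightarrow> ereal) set" where
  "green_family D w =
     {u. psh_on D u \<and> (\<forall>z\<in>D. u z < 0) \<and>
         (\<exists>C::real. \<forall>\<^sub>F z in nhds w. u z \<le> ennreal_ln (ennreal (norm (z - w))) + ereal C)}"

definition green :: "(complex ^ 'n) set \<Rightarrow> complex ^ 'n \<Rightarrow> complex ^ 'n \<Rightarrow> ereal" where
  "green D z w = (SUP u\<in>green_family D w. u z)"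

definition azukawa :: "(complex ^ 'n) set \<Rightarrow> complex ^ 'n \<Rightarrow> complex ^ 'n \<Rightarrow> ennreal" where
  "azukawa D w X =
     ereal_exp (Limsup (at (0::complex)) (\<lambda>l. green D (w + l *s X) w - ereal (ln (norm l))))"

definition azukawa_indicatrix :: "(complex ^ 'n) set \<Rightarrow> complex ^ 'n \<Rightarrow> (complex ^ 'n) set" where
  "azukawa_indicatrix D w = {X. azukawa D w X < 1}"

(* Convexity of functions with values in [-\<infinity>,\<infinity>); f < \<infinity> is part of the notion. *)
definition ereal_convex_on :: "'a::real_vector set \<Rightarrow> ('a \<Rightarrow> ereal) \<Rightarrow> bool" where
  "ereal_convex_on S f \<longleftrightarrow>
     convex S \<and> (\<forall>x\<in>S. f x < \<infinity>) \<and>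
     (\<forall>x\<in>S. \<forall>y\<in>S. \<forall>t::real. 0 < t \<and> t < 1 \<longrightarrow>
        f ((1 - t) *\<^sub>R x + t *\<^sub>R y) \<le> ereal (1 - t) * f x + ereal t * f y)"

end

theory Submission
  imports
    Defs
    "HOL-Complex_Analysis.Complex_Analysis"
    "HOL-Computational_Algebra.Fundamental_Theorem_Algebra"
    "HOL-Real_Asymp.Real_Asymp"
    "HOL-Analysis.Finite_Function_Topology"
begin

text \<open>
  Write \<open>A\<close> for the Azukawa metric and \<open>I w\<close> for its indicatrix at \<open>w\<close>. By the multiplicative
  form of the Brunn--Minkowski inequality it suffices that
  \<open>(1 - t) *\<^sub>R I w0 + t *\<^sub>R I w1 \<subseteq> I ((1 - t) *\<^sub>R w0 + t *\<^sub>R w1)\<close>. Call \<open>(w, X)\<close>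
  feasible for \<open>M\<close> if some polynomial disc \<open>w + X \<zeta> + a\<^sub>2 \<zeta>\<^sup>2 + \<dots> + a\<^sub>M \<zeta>\<^sup>M\<close> takes values in \<open>D\<close> at the
  roots of unity of order \<open>2 M + 1\<close>, a condition that is convex in \<open>(w, X)\<close>. Smoothing with Fejer's kernel,
  whose first coefficient \<open>c\<close> tends to \<open>1\<close>, turns a feasible pair into a genuine disc in \<open>D\<close> with
  derivative \<open>c X\<close>, so that \<open>A(w; X) \<le> 1 / c\<close>. For an infeasible pair, Hahn--Banach separation and the
  same smoothing yield polynomials \<open>P\<^sub>z(\<zeta>)\<close>, affine in \<open>z\<close>, with \<open>Re (P\<^sub>z(\<zeta>) / \<zeta>) > 0\<close> for \<open>z\<close> in \<open>D\<close> and
  \<open>\<zeta>\<close> on the unit circle; the function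
  \<open>z \<mapsto> ln \<bar>P\<^sub>z(0)\<bar> - mean of ln \<bar>P\<^sub>z\<bar> over the circle\<close> is a competitor for the Green function (it is
  negative by Jensen's inequality), so that \<open>A(w; X) \<ge> c\<close>. This replaces Lempert's theorem.
\<close>

subsection \<open>Circle means\<close>

text \<open>Two obstacles shape the proof. First, \<open>psh_on\<close> tests a function on complex
  lines only, so a competitor for the Green function is not known to be subharmonic along a curved
  disc. The bound along discs therefore comes from doubling the variables: a point near the disc and
  a parameter are maximised jointly, and a quadratic penalty ties them together. Second,
  \<open>D\<close> may be unbounded and extremal discs need not exist, so nothing is optimised:
  strictness of \<open>A < 1\<close> leaves a margin, and both losses from smoothing, a factor
  \<open>M / (M + 1)\<close> each, fit into it for large \<open>M\<close>. The competitor has a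
  geometric meaning. Since \<open>P_z(\<zeta>) / \<zeta>\<close> has positive real part on the
  circle, \<open>P_z\<close> winds once around 0 and has exactly one zero in the unit disc; by
  Jensen's formula the competitor is the logarithm of the modulus of this zero. The zero depends
  holomorphically on \<open>z\<close> and vanishes at \<open>w\<close>, so it stands in for
  Lempert's left inverse. The proof works with the circle means alone and never constructs the
  zero.\<close>

lemma ereal_integral_mono:
  assumes "\<And>x. x \<in> space M \<Longrightarrow> f x \<le> g x"
  shows "ereal_integral M f \<le> ereal_integral M g"
  unfolding ereal_integral_def
  using assms
  by (intro ereal_minus_mono nn_integral_mono)
     (auto simp: less_eq_ennreal.rep_eq[symmetric] intro!: nn_integral_mono e2ennreal_mono)

lemma ereal_integral_ereal:
  assumes "integrable M g"
  shows "ereal_integral M (\<lambda>x. ereal (g x)) = ereal (integral\<^sup>L M g)"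
proof -
  have fin: "(\<integral>\<^sup>+x. ennreal (g x) \<partial>M) \<noteq> top" "(\<integral>\<^sup>+x. ennreal (- g x) \<partial>M) \<noteq> top"
    using assms by (auto elim: integrableE)
  then obtain p n where pn: "p \<ge> 0" "(\<integral>\<^sup>+x. ennreal (g x) \<partial>M) = ennreal p"
      "n \<ge> 0" "(\<integral>\<^sup>+x. ennreal (- g x) \<partial>M) = ennreal n"
    by (metis ennreal_cases)
  show ?thesis
    unfolding ereal_integral_def real_lebesgue_integral_def[OF assms]
    using pn by (simp add: ennreal.rep_eq)
qed

abbreviation circ :: "real measure" where "circ \<equiv> lebesgue_on {0..2*pi}"

lemma circ_integral_continuous:
  fixes g :: "real \<Rightarrow> real"
  assumes "continuous_on {0..2*pi} g"
  shows "integrable circ g" "integral\<^sup>L circ g = integral {0..2*pi} g"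
proof -
  show "integrable circ g"
    using assms by (simp add: continuous_imp_integrable_real)
  then show "integral\<^sup>L circ g = integral {0..2*pi} g"
    by (simp add: lebesgue_integral_eq_integral)
qed

lemma circ_ereal_integral_continuous:
  assumes "continuous_on {0..2*pi} g"
  shows "ereal_integral circ (\<lambda>t. ereal (g t)) = ereal (integral {0..2*pi} g)"
  using circ_integral_continuous[OF assms] ereal_integral_ereal by metis

text \<open>Monotone convergence for functions that may take the value -\<infinity>: positive and
  negative parts are treated separately, the former decreasing and the latter increasing. The lower
  bound \<open>c\<close> keeps the limit of the negative parts finite, so that
  \<open>ereal_integral\<close> is a difference of finite numbers.\<close>

lemma circ_ereal_integral_limit:
  fixes f :: "real \<Rightarrow> ereal" and F :: "nat \<Rightarrow> real \<Rightarrow> real"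
  assumes cont: "\<And>n. continuous_on {0..2*pi} (F n)"
    and dec: "\<And>n t. F (Suc n) t \<le> F n t"
    and lim: "\<And>t. (\<lambda>n. ereal (F n t)) \<longlonglongrightarrow> f t"
    and low: "\<And>n. c \<le> integral {0..2*pi} (F n)"
  shows "ereal c \<le> ereal_integral circ f"
proof -
  have intF: "integrable circ (F n)" for n
    by (rule circ_integral_continuous[OF cont])
  have meas[measurable]: "F n \<in> borel_measurable circ" for n
    using intF by blast
  have decseq_all: "F n t \<le> F m t" if "m \<le> n" for m n t
    using dec by (rule lift_Suc_antimono_le[OF _ that])
  have posl: "(\<lambda>n. e2ennreal (ereal (F n t))) \<longlonglongrightarrow> e2ennreal (f t)" for t
    by (intro tendsto_intros lim)
  have negl: "(\<lambda>n. e2ennreal (- ereal (F n t))) \<longlonglongrightarrow> e2ennreal (- f t)" for t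
    by (intro tendsto_intros lim) 
  have 1: "(\<integral>\<^sup>+t. e2ennreal (f t) \<partial>circ) = (INF n. \<integral>\<^sup>+t. ennreal (F n t) \<partial>circ)"
  proof -
    have "e2ennreal (f t) = (INF n. ennreal (F n t))" for t
      by (rule LIMSEQ_unique[OF posl])
         (simp add: LIMSEQ_INF decseq_def decseq_all ennreal_leI)
    then have "(\<integral>\<^sup>+t. e2ennreal (f t) \<partial>circ) = (\<integral>\<^sup>+t. (INF n. ennreal (F n t)) \<partial>circ)"
      by simp
    also have "\<dots> = (INF n. \<integral>\<^sup>+t. ennreal (F n t) \<partial>circ)"
    proof (rule nn_integral_monotone_convergence_INF_decseq[where i=0])
      show "decseq (\<lambda>n t. ennreal (F n t))"
        by (intro antimonoI le_funI ennreal_leI decseq_all)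
      show "(\<integral>\<^sup>+ t. ennreal (F 0 t) \<partial>circ) < \<infinity>"
        using intF[of 0] by (auto elim!: integrableE simp: less_top)
    qed auto
    finally show ?thesis .
  qed
  have 2: "(\<integral>\<^sup>+t. e2ennreal (- f t) \<partial>circ) = (SUP n. \<integral>\<^sup>+t. ennreal (- F n t) \<partial>circ)"
  proof -
    have "e2ennreal (- f t) = (SUP n. ennreal (- F n t))" for t
      by (rule LIMSEQ_unique[OF negl])
         (simp add: LIMSEQ_SUP incseq_def decseq_all ennreal_leI)
    then have "(\<integral>\<^sup>+t. e2ennreal (- f t) \<partial>circ) = (\<integral>\<^sup>+t. (SUP n. ennreal (- F n t)) \<partial>circ)"
      by simp
    also have "\<dots> = (SUP n. \<integral>\<^sup>+t. ennreal (- F n t) \<partial>circ)"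
      by (rule nn_integral_monotone_convergence_SUP)
         (auto simp: incseq_def le_fun_def decseq_all ennreal_leI)
    finally show ?thesis .
  qed
  define P where "P n = enn2real (\<integral>\<^sup>+t. ennreal (F n t) \<partial>circ)" for n
  define N where "N n = enn2real (\<integral>\<^sup>+t. ennreal (- F n t) \<partial>circ)" for n
  have P: "(\<integral>\<^sup>+t. ennreal (F n t) \<partial>circ) = ennreal (P n)" "P n \<ge> 0" for n
    using intF[of n] unfolding P_def by (auto elim!: integrableE simp: less_top)
  have N: "(\<integral>\<^sup>+t. ennreal (- F n t) \<partial>circ) = ennreal (N n)" "N n \<ge> 0" for n
    using intF[of n] unfolding N_def by (auto elim!: integrableE simp: less_top)
  have PN: "c \<le> P n - N n" for n
    using low[of n] real_lebesgue_integral_def[OF intF[of n]] circ_integral_continuous(2)[OF cont[of n]]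
    by (simp add: P_def N_def)
  have Pdec: "P n \<le> P m" if "m \<le> n" for m n
  proof -
    have "ennreal (P n) \<le> ennreal (P m)"
      unfolding P(1)[symmetric]
      by (intro nn_integral_mono ennreal_leI decseq_all that)
    then show ?thesis by (simp add: P(2))
  qed
  have Ninc: "N m \<le> N n" if "m \<le> n" for m n
  proof -
    have "ennreal (N m) \<le> ennreal (N n)"
      unfolding N(1)[symmetric]
      by (intro nn_integral_mono ennreal_leI) (simp add: decseq_all that)
    then show ?thesis by (simp add: N(2))
  qed
  \<comment> \<open>Comparing at the common index \<open>max m n\<close> decouples the two indices,
    so the limits of \<open>P\<close> and \<open>N\<close> can be taken one after the other.\<close>
  have PN2: "N m \<le> P n - c" for m n
    using PN[of "max m n"] Pdec[of n "max m n"] Ninc[of m "max m n"] by simp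
  have ge0: "0 \<le> P n - c" for n using PN2[of 0 n] N(2)[of 0] by linarith
  obtain p where p: "(INF n. ennreal (P n)) = ennreal p" "p \<ge> 0"
  proof -
    have "(INF n. ennreal (P n)) \<le> ennreal (P 0)" by (rule INF_lower) auto
    then show ?thesis using that by (metis ennreal_cases ennreal_less_top leD)
  qed
  have "N m + c \<le> p" for m
  proof (cases "N m + c \<ge> 0")
    case True
    have "ennreal (N m + c) \<le> (INF n. ennreal (P n))"
      using PN2[of m] by (intro INF_greatest ennreal_leI) (simp add: algebra_simps)
    then show ?thesis using p True by simp
  next
    case False then show ?thesis using p by simp
  qed
  then have "(SUP n. ennreal (N n)) \<le> ennreal (p - c)"
    by (intro SUP_least ennreal_leI) (simp add: algebra_simps)
  moreover have pc: "0 \<le> p - c" using \<open>\<And>m. N m + c \<le> p\<close>[of 0] N(2)[of 0] by linarith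
  ultimately have "enn2ereal (SUP n. ennreal (N n)) \<le> ereal (p - c)"
    by (metis enn2ereal_ennreal less_eq_ennreal.rep_eq)
  then have "ereal p - ereal (p - c) \<le> enn2ereal (INF n. ennreal (P n)) - enn2ereal (SUP n. ennreal (N n))"
    using p by (intro ereal_minus_mono) auto
  then show ?thesis
    unfolding ereal_integral_def 1 2 P(1) N(1) by simp
qed

section \<open>Mean values of holomorphic functions and of logarithms\<close>

lemma circle_mean_holomorphic:
  fixes f :: "complex \<Rightarrow> complex"
  assumes "open S" "f holomorphic_on S" "cball c r \<subseteq> S" "0 < r"
  shows "((\<lambda>t. f (c + of_real r * cis t)) has_integral 2 * pi * f c) {0..2*pi}"
proof -
  have "((\<lambda>u. f u / (u - c)) has_contour_integral 2 * of_real pi * \<i> * f c) (circlepath c r)"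
    using assms by (intro Cauchy_integral_circlepath_simple holomorphic_on_subset[OF assms(2)]) auto
  then have "((\<lambda>t. f (c + r * cis t) / (r * cis t) * r * \<i> * cis t) has_integral
       2 * of_real pi * \<i> * f c) {0..2*pi}"
    unfolding circlepath_def by (subst (asm) has_contour_integral_part_circlepath_iff) auto
  then have "((\<lambda>t. (-\<i>) * (f (c + r * cis t) / (r * cis t) * r * \<i> * cis t)) has_integral
       (-\<i>) * (2 * of_real pi * \<i> * f c)) {0..2*pi}"
    by (rule has_integral_mult_right)
  moreover have "(-\<i>) * (f (c + r * cis t) / (r * cis t) * r * \<i> * cis t) = f (c + r * cis t)" for t
    using assms(4) by (simp add: field_simps)
  ultimately show ?thesis by (simp add: field_simps)
qed

lemma circle_mean_Re:
  fixes f :: "complex \<Rightarrow> complex"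
  assumes "open S" "f holomorphic_on S" "cball c r \<subseteq> S" "0 < r"
  shows "((\<lambda>t. Re (f (c + of_real r * cis t))) has_integral 2 * pi * Re (f c)) {0..2*pi}"
  using has_integral_Re[OF circle_mean_holomorphic[OF assms]] by simp

text \<open>\<open>ln (norm (a + b * z)) - ln (norm a)\<close> is the real part of
  \<open>Ln (1 + b * z / a)\<close>, which is holomorphic near the closed unit disc and vanishes at
  0.\<close>

lemma circle_mean_ln_norm_affine_gt:
  fixes a b :: complex
  assumes "norm b < norm a"
  shows "((\<lambda>t. ln (norm (a + b * cis t))) has_integral 2 * pi * ln (norm a)) {0..2*pi}"
proof -
  have a: "a \<noteq> 0" using assms by auto
  define S where "S = {z. norm (b * z / a) < 1}"
  have "open S" unfolding S_def using a
    by (intro open_Collect_less continuous_intros) auto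
  have pos: "1 + b * z / a \<notin> \<real>\<^sub>\<le>\<^sub>0" if "z \<in> S" for z
  proof -
    have "\<bar>Re (b * z / a)\<bar> < 1" using abs_Re_le_cmod[of "b*z/a"] that by (simp add: S_def)
    then have "0 < Re (1 + b * z / a)" by simp
    then show ?thesis using complex_nonpos_Reals_iff by fastforce
  qed
  have "((\<lambda>t. Re (Ln (1 + b * (0 + of_real 1 * cis t) / a))) has_integral 2 * pi * Re (Ln (1 + b * 0 / a))) {0..2*pi}"
  proof (rule circle_mean_Re[of S])
    show "(\<lambda>z. Ln (1 + b * z / a)) holomorphic_on S"
      using pos a by (intro holomorphic_intros) auto
    show "cball 0 1 \<subseteq> S"
    proof
      fix z :: complex assume "z \<in> cball 0 1"
      then have "norm z \<le> 1" by simp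
      then have "norm b * norm z \<le> norm b" by (simp add: mult_left_le)
      then show "z \<in> S" using assms a by (simp add: S_def norm_mult norm_divide)
    qed
  qed (auto simp: \<open>open S\<close>)
  then have "((\<lambda>t. ln (norm a) + Re (Ln (1 + b * cis t / a))) has_integral 2 * pi * ln (norm a) + 0) {0..2*pi}"
    by (intro has_integral_add) (use has_integral_const_real[of "ln (norm a)" 0 "2*pi"] in auto)
  moreover have "ln (norm a) + Re (Ln (1 + b * cis t / a)) = ln (norm (a + b * cis t))" for t
  proof -
    have "cis t \<in> S" using assms a by (simp add: S_def norm_mult norm_divide)
    from pos[OF this] have nz: "1 + b * cis t / a \<noteq> 0" by auto
    then have "ln (norm a) + Re (Ln (1 + b * cis t / a)) = ln (norm a * norm (1 + b * cis t / a))"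
      using a by (simp add: ln_mult)
    also have "norm a * norm (1 + b * cis t / a) = norm (a + b * cis t)"
      using a by (simp add: norm_mult[symmetric] distrib_left)
    finally show ?thesis .
  qed
  ultimately show ?thesis by simp
qed

text \<open>If \<open>b\<close> dominates, conjugation and multiplication by \<open>cis t\<close>
  turn \<open>a + b * cis t\<close> into \<open>cnj b + cnj a * cis t\<close> without changing the
  modulus, which exchanges the two coefficients.\<close>

lemma circle_mean_ln_norm_affine:
  fixes a b :: complex
  assumes "norm a \<noteq> norm b"
  shows "((\<lambda>t. ln (norm (a + b * cis t))) has_integral 2 * pi * ln (max (norm a) (norm b))) {0..2*pi}"
proof (cases "norm b < norm a")
  case True
  then show ?thesis using circle_mean_ln_norm_affine_gt by (simp add: max_def)
next
  case False
  then have lt: "norm (cnj a) < norm (cnj b)" using assms by simp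
  have "norm (cnj b + cnj a * cis t) = norm (a + b * cis t)" for t
  proof -
    have "cis t * cnj (a + b * cis t) = cnj b + cnj a * cis t"
      by (simp add: cis_cnj algebra_simps cis_mult)
    then show ?thesis by (metis complex_mod_cnj mult.left_neutral norm_cis norm_mult)
  qed
  then show ?thesis using circle_mean_ln_norm_affine_gt[OF lt] False assms by (simp add: max_def)
qed

text \<open>Truncating at \<open>e\<close> keeps the integrand continuous when
  \<open>a + b * cis t\<close> vanishes on the circle. Away from \<open>norm a = norm b\<close> the
  exact mean value gives the bound; the remaining case follows by pushing \<open>a\<close>
  outwards.\<close>

lemma ln_norm_le_circle_mean_trunc:
  fixes a b :: complex
  assumes "a \<noteq> 0" "0 < e"
  shows "2 * pi * ln (norm a) \<le> integral {0..2*pi} (\<lambda>t. ln (max (norm (a + b * cis t)) e))"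
proof -
  have cont: "continuous_on {0..2*pi} (\<lambda>t. ln (max (norm (a + b * cis t)) e))" for a
    using assms by (intro continuous_intros) (auto simp: max_def)
  have int: "(\<lambda>t. ln (max (norm (a + b * cis t)) e)) integrable_on {0..2*pi}" for a
    by (rule integrable_continuous_real[OF cont])
  have main: "2 * pi * ln (norm a) \<le> integral {0..2*pi} (\<lambda>t. ln (max (norm (a + b * cis t)) e))"
    if "norm a \<noteq> norm b" "a \<noteq> 0" for a
  proof -
    have "2 * pi * ln (norm a) \<le> 2 * pi * ln (max (norm a) (norm b))"
      using that by (intro mult_left_mono ln_mono) auto
    also have "\<dots> \<le> integral {0..2*pi} (\<lambda>t. ln (max (norm (a + b * cis t)) e))"
    proof (rule has_integral_le[OF circle_mean_ln_norm_affine[OF that(1)]])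
      show "((\<lambda>t. ln (max (norm (a + b * cis t)) e)) has_integral
        integral {0..2*pi} (\<lambda>t. ln (max (norm (a + b * cis t)) e))) {0..2*pi}"
        using int by (rule integrable_integral)
      fix t
      have "a + b * cis t \<noteq> 0"
      proof
        assume "a + b * cis t = 0"
        then have "a = - (b * cis t)" by (simp add: add_eq_0_iff2)
        then have "norm a = norm b" by (simp add: norm_mult)
        with that show False by simp
      qed
      then show "ln (norm (a + b * cis t)) \<le> ln (max (norm (a + b * cis t)) e)"
        by (intro ln_mono) auto
    qed
    finally show ?thesis .
  qed
  show ?thesis
  proof (cases "norm a = norm b")
    case False then show ?thesis using main assms by simp
  next
    case True
    \<comment> \<open>Replacing \<open>a\<close> by \<open>(1 + s) * a\<close> destroys the equality
      of moduli. As the truncated modulus is at least \<open>e\<close>, it grows at most by the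
      factor \<open>1 + s * norm a / e\<close>, uniformly in \<open>t\<close>; then \<open>s\<close>
      tends to 0.\<close>
    have ineq: "2 * pi * ln (norm a) \<le> integral {0..2*pi} (\<lambda>t. ln (max (norm (a + b * cis t)) e)) + 2 * pi * ln (1 + s * norm a / e)"
      if s: "s > 0" for s :: real
    proof -
      define a' where "a' = of_real (1 + s) * a"
      have na: "norm a' = (1 + s) * norm a" unfolding a'_def norm_mult using s by (simp del: of_real_add)
      have a'0: "a' \<noteq> 0" using na s assms by auto
      have "norm a' \<noteq> norm b" using na True s assms by (auto simp: algebra_simps)
      have "2 * pi * ln (norm a) \<le> 2 * pi * ln (norm a')"
        using s assms a'0 na by (intro mult_left_mono ln_mono) (auto simp: algebra_simps)
      also have "\<dots> \<le> integral {0..2*pi} (\<lambda>t. ln (max (norm (a' + b * cis t)) e))"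
        using main[of a'] \<open>norm a' \<noteq> norm b\<close> a'0 by simp
      also have "\<dots> \<le> integral {0..2*pi} (\<lambda>t. ln (max (norm (a + b * cis t)) e) + ln (1 + s * norm a / e))"
      proof (rule integral_le[OF int])
        show "(\<lambda>t. ln (max (norm (a + b * cis t)) e) + ln (1 + s * norm a / e)) integrable_on {0..2 * pi}"
          by (intro integrable_add int) auto
        fix t
        define m where "m = max (norm (a + b * cis t)) e"
        have m: "m \<ge> e" "m > 0" unfolding m_def using assms by auto
        have "a' + b * cis t = (a + b * cis t) + of_real s * a" unfolding a'_def by (simp add: algebra_simps)
        then have "norm (a' + b * cis t) \<le> norm (a + b * cis t) + s * norm a"
          using norm_triangle_ineq[of "a + b * cis t" "of_real s * a"] s by (simp add: norm_mult add_ac)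
        then have "max (norm (a' + b * cis t)) e \<le> m + s * norm a"
          using mult_nonneg_nonneg[OF less_imp_le[OF s] norm_ge_zero[of a]] unfolding m_def max_def
          by (simp split: if_splits)
        also have "\<dots> \<le> m * (1 + s * norm a / e)"
        proof -
          have "s * norm a * 1 \<le> s * norm a * (m / e)" using s m assms by (intro mult_left_mono) auto
          then show ?thesis by (simp add: algebra_simps)
        qed
        finally have "ln (max (norm (a' + b * cis t)) e) \<le> ln (m * (1 + s * norm a / e))"
          using assms by (intro ln_mono) (auto simp: max_def)
        also have "\<dots> = ln m + ln (1 + s * norm a / e)"
          using m s assms by (intro ln_mult_pos) (auto intro!: add_pos_nonneg)
        finally show "ln (max (norm (a' + b * cis t)) e) \<le> ln (max (norm (a + b * cis t)) e) + ln (1 + s * norm a / e)"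
          by (simp add: m_def)
      qed
      also have "\<dots> = integral {0..2*pi} (\<lambda>t. ln (max (norm (a + b * cis t)) e)) + 2 * pi * ln (1 + s * norm a / e)"
        by (subst integral_add[OF int]) auto
      finally show ?thesis .
    qed
    have "((\<lambda>s. integral {0..2*pi} (\<lambda>t. ln (max (norm (a + b * cis t)) e)) + 2 * pi * ln (1 + s * norm a / e)) \<longlongrightarrow>
       integral {0..2*pi} (\<lambda>t. ln (max (norm (a + b * cis t)) e)) + 2 * pi * ln (1 + 0 * norm a / e)) (at_right 0)"
      using assms by (intro tendsto_intros) auto
    then have "2 * pi * ln (norm a) \<le> integral {0..2*pi} (\<lambda>t. ln (max (norm (a + b * cis t)) e)) + 2 * pi * ln (1 + 0 * norm a / e)"
      by (rule tendsto_lowerbound) (use ineq in \<open>auto intro!: eventually_at_rightI[of 0 1]\<close>)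
    then show ?thesis by simp
  qed
qed

text \<open>Jensen's inequality, by splitting off one root at a time: a factor
  \<open>z - \<alpha>\<close> has logarithmic mean \<open>ln (max (norm \<alpha>) 1)\<close>, while
  its value at 0 contributes only \<open>ln (norm \<alpha>)\<close>.\<close>

lemma ln_norm_poly_0_le_circle_mean:
  assumes "\<And>z. norm z = 1 \<Longrightarrow> poly p z \<noteq> 0" "poly p 0 \<noteq> 0"
  shows "2 * pi * ln (norm (poly p 0)) \<le> integral {0..2*pi} (\<lambda>t. ln (norm (poly p (cis t))))"
  using assms
proof (induction "degree p" arbitrary: p)
  case 0
  then obtain c where "p = [:c:]" by (metis degree_eq_zeroE)
  then show ?case by simp
next
  case (Suc d)
  then have "\<not> Fundamental_Theorem_Algebra.constant (poly p)"
    using constant_degree by (metis Zero_not_Suc)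
  then obtain \<alpha> where \<alpha>: "poly p \<alpha> = 0" using fundamental_theorem_of_algebra by blast
  then obtain q where q: "p = [:-\<alpha>, 1:] * q" using poly_eq_0_iff_dvd by (metis dvdE)
  have "q \<noteq> 0" using Suc.hyps(2) q by auto
  then have "degree p = Suc (degree q)" unfolding q by (subst degree_mult_eq) auto
  then have dq: "d = degree q" using Suc.hyps(2) by simp
  have q1: "poly q z \<noteq> 0" if "norm z = 1" for z using Suc.prems(1)[OF that] q by auto
  have q0: "poly q 0 \<noteq> 0" and \<alpha>0: "\<alpha> \<noteq> 0" using Suc.prems(2) q by auto
  have n\<alpha>: "norm \<alpha> \<noteq> 1" using Suc.prems(1) \<alpha> by auto
  have IH: "2 * pi * ln (norm (poly q 0)) \<le> integral {0..2*pi} (\<lambda>t. ln (norm (poly q (cis t))))"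
    by (rule Suc.hyps(1)[OF dq q1 q0])
  have hi: "((\<lambda>t. ln (norm (- \<alpha> + 1 * cis t))) has_integral 2 * pi * ln (max (norm (-\<alpha>)) (norm (1::complex)))) {0..2*pi}"
    by (rule circle_mean_ln_norm_affine) (use n\<alpha> in auto)
  have "continuous_on {0..2*pi} (\<lambda>t. ln (norm (poly q (cis t))))"
    using q1 by (intro continuous_intros) auto
  then have "((\<lambda>t. ln (norm (poly q (cis t)))) has_integral integral {0..2*pi} (\<lambda>t. ln (norm (poly q (cis t))))) {0..2*pi}"
    by (intro integrable_integral integrable_continuous_real)
  from has_integral_add[OF hi this]
  have "((\<lambda>t. ln (norm (poly p (cis t)))) has_integral
     2 * pi * ln (max (norm (-\<alpha>)) (norm (1::complex))) + integral {0..2*pi} (\<lambda>t. ln (norm (poly q (cis t))))) {0..2*pi}"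
  proof (rule has_integral_eq[rotated])
    fix t
    have "poly q (cis t) \<noteq> 0" "- \<alpha> + cis t \<noteq> 0"
      using q1[of "cis t"] n\<alpha> by (auto simp: add_eq_0_iff)
    moreover have "norm (poly p (cis t)) = norm (- \<alpha> + cis t) * norm (poly q (cis t))"
      unfolding q poly_mult norm_mult by simp
    ultimately show "ln (norm (- \<alpha> + 1 * cis t)) + ln (norm (poly q (cis t))) = ln (norm (poly p (cis t)))"
      by (simp add: ln_mult_pos)
  qed
  then have "integral {0..2*pi} (\<lambda>t. ln (norm (poly p (cis t)))) =
     2 * pi * ln (max (norm \<alpha>) 1) + integral {0..2*pi} (\<lambda>t. ln (norm (poly q (cis t))))"
    by (simp add: integral_unique)
  moreover have "2 * pi * ln (norm \<alpha>) \<le> 2 * pi * ln (max (norm \<alpha>) 1)"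
    using \<alpha>0 by (intro mult_left_mono ln_mono) auto
  moreover have "2 * pi * ln (norm (poly p 0)) = 2 * pi * ln (norm \<alpha>) + 2 * pi * ln (norm (poly q 0))"
    using q0 \<alpha>0 by (simp add: q norm_mult ln_mult_pos distrib_left)
  ultimately show ?case using IH by linarith
qed

subsection \<open>Plurisubharmonic functions along polynomial discs\<close>

lemma norm_vector_smult: "norm (c *s (x :: complex ^ 'n)) = norm c * norm x"
  by (simp add: norm_vec_def norm_mult L2_set_right_distrib)

lemma continuous_on_vector_smult [continuous_intros]:
  fixes g :: "'a::topological_space \<Rightarrow> complex ^ 'n"
  assumes "continuous_on S f" "continuous_on S g"
  shows "continuous_on S (\<lambda>x. f x *s g x)"
  unfolding continuous_on_def
proof
  fix x assume x: "x \<in> S"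
  show "((\<lambda>x. f x *s g x) \<longlongrightarrow> f x *s g x) (at x within S)"
    using assms x unfolding continuous_on_def
    by (intro vec_tendstoI) (auto intro!: tendsto_intros)
qed

lemma continuous_on_poly_vec [continuous_intros]:
  fixes p :: "'n::finite \<Rightarrow> complex poly"
  assumes "continuous_on S f"
  shows "continuous_on S (\<lambda>x. \<chi> i. poly (p i) (f x))"
  using assms by (intro continuous_on_vec_lambda continuous_intros)

lemma usc_attains_max:
  fixes f :: "'a::topological_space \<Rightarrow> ereal"
  assumes "compact S" "S \<noteq> {}" "\<And>x. x \<in> S \<Longrightarrow> f x < \<infinity>"
    and usc: "\<And>c::real. openin (top_of_set S) {x \<in> S. f x < ereal c}"
  shows "\<exists>x\<in>S. \<forall>y\<in>S. f y \<le> f x"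
proof (rule ccontr)
  assume "\<not> ?thesis"
  then have ex: "\<forall>x\<in>S. \<exists>y\<in>S. f x < f y" by force
  have op: "openin (top_of_set S) {x \<in> S. f x < f y}" if "y \<in> S" for y
    using usc assms(3)[OF that] by (cases "f y") auto
  then obtain U where U: "\<And>y. y \<in> S \<Longrightarrow> open (U y) \<and> {x \<in> S. f x < f y} = S \<inter> U y"
    unfolding openin_open by metis
  have "S \<subseteq> (\<Union>y\<in>S. U y)"
  proof
    fix x assume "x \<in> S"
    with ex obtain y where "y \<in> S" "f x < f y" by blast
    with U[of y] \<open>x \<in> S\<close> show "x \<in> (\<Union>y\<in>S. U y)" by blast
  qed
  then obtain T where T: "T \<subseteq> S" "finite T" "S \<subseteq> (\<Union>y\<in>T. U y)"
    using compactE_image[OF assms(1), of S U] U by metis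
  have "T \<noteq> {}" using T assms(2) by auto
  then have "Max (f ` T) \<in> f ` T" using T(2) by (intro Max_in) auto
  then obtain y where y: "y \<in> T" "f y = Max (f ` T)" by auto
  then obtain y' where "y' \<in> T" "y \<in> U y'" using T by blast
  then have "f y < f y'" using U[of y'] T y(1) by blast
  moreover have "f y' \<le> f y" unfolding y(2) using T(2) \<open>y' \<in> T\<close> by (intro Max_ge) auto
  ultimately show False by simp
qed

lemma psh_on_le_line_mean:
  assumes "psh_on D u" "0 < r" "\<And>l. norm l \<le> r \<Longrightarrow> z + l *s X \<in> D"
    and "continuous_on {0..2*pi} B"
    and "\<And>t. u (z + (of_real r * cis t) *s X) \<le> ereal (B t)"
  shows "u z \<le> ereal (integral {0..2*pi} B / (2 * pi))"
proof -
  have "cball 0 r \<subseteq> {l. z + l *s X \<in> D}" using assms(3) by auto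
  then have "u (z + 0 *s X) \<le> ereal (1 / (2 * pi)) *
      ereal_integral circ (\<lambda>t. u (z + (0 + of_real r * cis t) *s X))"
    using assms(1,2) unfolding psh_on_def subharmonic_on_def by blast
  also have "\<dots> \<le> ereal (1 / (2 * pi)) * ereal_integral circ (\<lambda>t. ereal (B t))"
    using assms(5) by (intro ereal_mult_left_mono ereal_integral_mono) auto
  also have "\<dots> = ereal (integral {0..2*pi} B / (2 * pi))"
    by (simp add: circ_ereal_integral_continuous[OF assms(4)])
  finally show ?thesis by simp
qed

lemma poly_expand2:
  obtains a q where "\<And>\<tau>::complex. poly p (\<zeta> + \<tau>) = poly p \<zeta> + \<tau> * a + \<tau>\<^sup>2 * poly q \<tau>"
proof -
  obtain a0 r where r: "pcompose p [:\<zeta>, 1:] = pCons a0 r" by (metis pCons_cases)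
  obtain a q where q: "r = pCons a q" by (metis pCons_cases)
  have *: "poly p (\<zeta> + \<tau>) = a0 + \<tau> * a + \<tau>\<^sup>2 * poly q \<tau>" for \<tau>
  proof -
    have "poly p (\<zeta> + \<tau>) = poly (pcompose p [:\<zeta>, 1:]) \<tau>" by (simp add: poly_pcompose)
    then show ?thesis by (simp add: r q power2_eq_square algebra_simps)
  qed
  from *[of 0] have "a0 = poly p \<zeta>" by simp
  with * show ?thesis using that by blast
qed

text \<open>The linear coefficient \<open>X\<close> is the direction of the complex line along which
  plurisubharmonicity will be used; the remainder stays polynomial and is therefore bounded on
  compact sets.\<close>

lemma poly_vec_expand2:
  fixes p :: "'n::finite \<Rightarrow> complex poly"
  obtains X :: "complex ^ 'n" and q
  where "\<And>\<tau>. (\<chi> i. poly (p i) (\<zeta> + \<tau>)) =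
    (\<chi> i. poly (p i) \<zeta>) + \<tau> *s X + \<tau>\<^sup>2 *s (\<chi> i. poly (q i) \<tau>)"
proof -
  have "\<exists>a q. \<forall>\<tau>. poly (p i) (\<zeta> + \<tau>) = poly (p i) \<zeta> + \<tau> * a + \<tau>\<^sup>2 * poly q \<tau>" for i
    by (metis poly_expand2)
  then obtain a q where "\<And>i \<tau>. poly (p i) (\<zeta> + \<tau>) = poly (p i) \<zeta> + \<tau> * a i + \<tau>\<^sup>2 * poly (q i) \<tau>"
    by metis
  then show ?thesis by (intro that[of "\<chi> i. a i" q]) (auto simp: vec_eq_iff)
qed

lemma inner_complex_vec: "inner x (y :: complex ^ 'n) = Re (\<Sum>i\<in>UNIV. cnj (x $ i) * y $ i)"
  by (simp add: inner_vec_def inner_complex_def)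

text \<open>Moving \<open>z0\<close> and \<open>\<zeta>0\<close> simultaneously, by \<open>\<tau> *s X\<close> and \<open>\<tau>\<close>, changes the penalty
  \<open>(norm (z - \<phi> \<zeta>))\<^sup>2\<close> only by a harmonic function of \<open>\<tau>\<close> and a term of order four, which the
  strictly superharmonic \<open>- \<delta> * (norm \<zeta>)\<^sup>2\<close> outweighs.\<close>
lemma no_penalized_local_max:
  fixes q :: "'n::finite \<Rightarrow> complex poly" and u :: "complex ^ 'n \<Rightarrow> ereal"
  assumes "psh_on D u" and m: "u z0 = ereal m"
    and "\<zeta>0 \<noteq> 0" "0 < \<delta>" "0 < r0" "0 \<le> K"
    and D: "\<And>\<tau>. norm \<tau> < r0 \<Longrightarrow> z0 + \<tau> *s X \<in> D"
    and lmax: "\<And>\<tau>. norm \<tau> < r0 \<Longrightarrow> u (z0 + \<tau> *s X) \<le> ereal (m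
        + (c * ln (norm (\<zeta>0 + \<tau>)) - \<delta> * (norm (\<zeta>0 + \<tau>))\<^sup>2) - (c * ln (norm \<zeta>0) - \<delta> * (norm \<zeta>0)\<^sup>2)
        + K * ((norm (v0 - \<tau>\<^sup>2 *s (\<chi> i. poly (q i) \<tau>)))\<^sup>2 - (norm v0)\<^sup>2))"
  shows False
proof -
  define e where "e \<tau> = (\<chi> i. poly (q i) \<tau>)" for \<tau>
  have conte: "continuous_on S e" for S unfolding e_def by (intro continuous_intros)
  have "compact (e ` cball 0 1)" by (intro compact_continuous_image conte compact_cball)
  then obtain E where E: "\<And>\<tau>. norm \<tau> \<le> 1 \<Longrightarrow> norm (e \<tau>) \<le> E" and "E > 0"
    by (force dest!: compact_imp_bounded simp: bounded_pos)
  \<comment> \<open>The bounds keep \<open>\<tau>\<close> inside the given neighbourhood and where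
    the remainder is at most \<open>E\<close>, keep \<open>\<zeta>0 + \<tau>\<close> away from 0,
    and make the quartic error \<open>K * r^4 * E\<^sup>2\<close> smaller than
    \<open>\<delta> * r\<^sup>2\<close>.\<close>
  define r where "r = min (min 1 (r0 / 2)) (min (norm \<zeta>0 / 2) (sqrt (\<delta> / (2 * (K + 1) * E\<^sup>2))))"
  have r2: "r \<le> sqrt (\<delta> / (2 * (K + 1) * E\<^sup>2))" and "r \<le> norm \<zeta>0 / 2" "r \<le> r0 / 2"
    and r: "0 < r" "r \<le> 1"
    using assms \<open>E > 0\<close> unfolding r_def by auto
  then have r: "0 < r" "r \<le> 1" "r < r0" "r < norm \<zeta>0" using assms by auto
  have "r\<^sup>2 \<le> \<delta> / (2 * (K + 1) * E\<^sup>2)"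
    using r2 r by (metis abs_le_iff abs_of_pos real_sqrt_abs real_sqrt_le_iff)
  then have "r\<^sup>2 * (2 * (K + 1) * E\<^sup>2) \<le> \<delta>"
    using \<open>E > 0\<close> \<open>0 \<le> K\<close> by (subst (asm) pos_le_divide_eq) auto
  moreover have "K * r\<^sup>2 * E\<^sup>2 < r\<^sup>2 * (2 * (K + 1) * E\<^sup>2)"
  proof -
    have "0 < r\<^sup>2 * E\<^sup>2 * (K + 2)" using r \<open>E > 0\<close> \<open>0 \<le> K\<close> by auto
    then show ?thesis by (simp add: algebra_simps)
  qed
  ultimately have small: "K * r\<^sup>2 * E\<^sup>2 < \<delta>" by linarith
  \<comment> \<open>\<open>f\<close> collects the harmonic part of the change of the penalised
    function: it is holomorphic with \<open>f 0 = 0\<close>, so its circle mean drops out and only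
    \<open>- \<delta> * r\<^sup>2\<close> and the quartic term remain.\<close>
  define f where "f \<tau> = of_real c * Ln (1 + \<tau> / \<zeta>0) - 2 * of_real \<delta> * (cnj \<zeta>0 * \<tau>)
      - 2 * of_real K * (\<Sum>i\<in>UNIV. cnj (v0 $ i) * (\<tau>\<^sup>2 * poly (q i) \<tau>))" for \<tau>
  have bnd: "u (z0 + \<tau> *s X) \<le> ereal (m + Re (f \<tau>) - \<delta> * r\<^sup>2 + K * r^4 * E\<^sup>2)" if \<tau>: "norm \<tau> = r" for \<tau>
  proof -
    have 1: "ln (norm (\<zeta>0 + \<tau>)) - ln (norm \<zeta>0) = Re (Ln (1 + \<tau> / \<zeta>0))"
    proof -
      have "norm (\<tau> / \<zeta>0) < 1" using \<tau> r assms(3) by (simp add: norm_divide)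
      then have "1 + \<tau> / \<zeta>0 \<noteq> 0" by (metis add_eq_0_iff norm_minus_cancel norm_one less_irrefl)
      then have "ln (norm \<zeta>0) + Re (Ln (1 + \<tau> / \<zeta>0)) = ln (norm (\<zeta>0 * (1 + \<tau> / \<zeta>0)))"
        using assms(3) by (simp add: norm_mult ln_mult_pos)
      also have "\<zeta>0 * (1 + \<tau> / \<zeta>0) = \<zeta>0 + \<tau>" using assms(3) by (simp add: field_simps)
      finally show ?thesis by simp
    qed
    have 2: "(norm (\<zeta>0 + \<tau>))\<^sup>2 - (norm \<zeta>0)\<^sup>2 = 2 * Re (cnj \<zeta>0 * \<tau>) + r\<^sup>2"
      unfolding \<tau>[symmetric] cmod_power2 by (simp add: power2_eq_square algebra_simps)
    have 3: "(norm (v0 - \<tau>\<^sup>2 *s e \<tau>))\<^sup>2 - (norm v0)\<^sup>2 =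
        - 2 * Re (\<Sum>i\<in>UNIV. cnj (v0 $ i) * (\<tau>\<^sup>2 * poly (q i) \<tau>)) + (norm (\<tau>\<^sup>2 *s e \<tau>))\<^sup>2"
    proof -
      have "inner v0 (\<tau>\<^sup>2 *s e \<tau>) = Re (\<Sum>i\<in>UNIV. cnj (v0 $ i) * (\<tau>\<^sup>2 * poly (q i) \<tau>))"
        by (simp add: inner_complex_vec e_def)
      then show ?thesis
        by (simp add: power2_norm_eq_inner inner_diff_left inner_diff_right inner_commute)
    qed
    have 4: "(norm (\<tau>\<^sup>2 *s e \<tau>))\<^sup>2 \<le> r^4 * E\<^sup>2"
      using E[of \<tau>] r \<tau> by (auto simp: norm_vector_smult norm_power power_mult_distrib power_mult[symmetric]
        intro!: mult_left_mono power_mono)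
    have "u (z0 + \<tau> *s X) \<le> ereal (m + (c * ln (norm (\<zeta>0 + \<tau>)) - \<delta> * (norm (\<zeta>0 + \<tau>))\<^sup>2)
        - (c * ln (norm \<zeta>0) - \<delta> * (norm \<zeta>0)\<^sup>2) + K * ((norm (v0 - \<tau>\<^sup>2 *s e \<tau>))\<^sup>2 - (norm v0)\<^sup>2))"
      using lmax[of \<tau>] \<tau> r by (simp add: e_def)
    also have "\<dots> \<le> ereal (m + c * Re (Ln (1 + \<tau> / \<zeta>0)) - \<delta> * (2 * Re (cnj \<zeta>0 * \<tau>) + r\<^sup>2)
        + K * (- 2 * Re (\<Sum>i\<in>UNIV. cnj (v0 $ i) * (\<tau>\<^sup>2 * poly (q i) \<tau>)) + r^4 * E\<^sup>2))"
      unfolding 3 1[symmetric] 2[symmetric] using 4 mult_left_mono[OF 4 \<open>0 \<le> K\<close>] by (simp add: algebra_simps)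
    also have "\<dots> = ereal (m + Re (f \<tau>) - \<delta> * r\<^sup>2 + K * r^4 * E\<^sup>2)"
      by (simp add: f_def algebra_simps)
    finally show ?thesis .
  qed
  have holf: "f holomorphic_on ball 0 (norm \<zeta>0)"
  proof -
    have "1 + \<tau> / \<zeta>0 \<notin> \<real>\<^sub>\<le>\<^sub>0" if "\<tau> \<in> ball 0 (norm \<zeta>0)" for \<tau>
    proof -
      have "norm (\<tau> / \<zeta>0) < 1" using that assms(3) by (simp add: norm_divide)
      then have "0 < Re (1 + \<tau> / \<zeta>0)" using abs_Re_le_cmod[of "\<tau> / \<zeta>0"] by simp
      then show ?thesis using complex_nonpos_Reals_iff by fastforce
    qed
    then show ?thesis unfolding f_def using assms(3) by (intro holomorphic_intros) auto
  qed
  have mean: "((\<lambda>t. Re (f (0 + of_real r * cis t))) has_integral 2 * pi * Re (f 0)) {0..2*pi}"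
    by (rule circle_mean_Re[OF open_ball holf]) (use r in auto)
  have contf: "continuous_on {0..2*pi} (\<lambda>t. Re (f (of_real r * cis t)))"
    using r by (intro continuous_intros continuous_on_compose2[OF holomorphic_on_imp_continuous_on[OF holf]])
      (auto simp: norm_mult)
  define B where "B t = Re (f (of_real r * cis t)) + (m - \<delta> * r\<^sup>2 + K * r^4 * E\<^sup>2)" for t
  have contB: "continuous_on {0..2*pi} B" unfolding B_def by (intro continuous_intros contf)
  have "u z0 \<le> ereal (integral {0..2*pi} B / (2 * pi))"
  proof (rule psh_on_le_line_mean[OF assms(1) r(1) _ contB])
    show "z0 + l *s X \<in> D" if "norm l \<le> r" for l using D that r by auto
    show "u (z0 + (of_real r * cis t) *s X) \<le> ereal (B t)" for t
      using bnd[of "of_real r * cis t"] r by (simp add: B_def norm_mult algebra_simps)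
  qed
  moreover have "integral {0..2*pi} B = 2 * pi * (m - \<delta> * r\<^sup>2 + K * r^4 * E\<^sup>2)"
  proof -
    have "(B has_integral 2 * pi * Re (f 0) + (2*pi - 0) *\<^sub>R (m - \<delta> * r\<^sup>2 + K * r^4 * E\<^sup>2)) {0..2*pi}"
      unfolding B_def using mean has_integral_const_real[of "m - \<delta> * r\<^sup>2 + K * r^4 * E\<^sup>2" 0 "2*pi"]
      by (intro has_integral_add) auto
    then show ?thesis by (simp add: integral_unique f_def)
  qed
  ultimately have "m \<le> m - \<delta> * r\<^sup>2 + K * r^4 * E\<^sup>2" using m by simp
  then have "\<delta> * r\<^sup>2 \<le> (K * r\<^sup>2 * E\<^sup>2) * r\<^sup>2" by (simp add: power2_eq_square power4_eq_xxxx algebra_simps)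
  then have "\<delta> \<le> K * r\<^sup>2 * E\<^sup>2" using r by (simp add: mult_le_cancel_right)
  with small show False by simp
qed

section \<open>Competitors for the Green function along polynomial discs\<close>

lemma ennreal_ln_le_ereal_ln:
  assumes "0 \<le> x" "x \<le> y" "0 < y"
  shows "ennreal_ln (ennreal x) \<le> ereal (ln y)"
  using assms by (auto simp: ennreal_ln_def)

lemma ennreal_ln_ennreal: "0 < x \<Longrightarrow> ennreal_ln (ennreal x) = ereal (ln x)"
  by (simp add: ennreal_ln_def)

lemma usc_on_compose_minus:
  fixes u :: "'b::topological_space \<Rightarrow> ereal" and g :: "'a::topological_space \<Rightarrow> 'b"
  assumes "usc_on D u" "continuous_on S g" "g ` S \<subseteq> D" "continuous_on S (R :: 'a \<Rightarrow> real)"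
  shows "openin (top_of_set S) {x \<in> S. u (g x) - ereal (R x) < ereal c}"
proof -
  have eq: "{x \<in> S. u (g x) - ereal (R x) < ereal c} =
     (\<Union>s. {x \<in> S. u (g x) < ereal s} \<inter> {x \<in> S. s < c + R x})" (is "?L = ?R")
  proof
    show "?L \<subseteq> ?R"
    proof
      fix x assume x: "x \<in> ?L"
      then have "u (g x) < ereal (c + R x)" by (cases "u (g x)") (auto simp: algebra_simps)
      then obtain s where "u (g x) < ereal s" "ereal s < ereal (c + R x)"
        using ereal_dense2 by blast
      then show "x \<in> ?R" using x by auto
    qed
    show "?R \<subseteq> ?L"
    proof
      fix x assume "x \<in> ?R"
      then obtain s where "x \<in> S" "u (g x) < ereal s" "s < c + R x" by auto
      then show "x \<in> ?L" by (cases "u (g x)") auto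
    qed
  qed
  have "openin (top_of_set S) ({x \<in> S. u (g x) < ereal s} \<inter> {x \<in> S. s < c + R x})" for s
  proof (rule openin_Int)
    have "openin (top_of_set D) {z \<in> D. u z < ereal s}" using assms(1) by (simp add: usc_on_def)
    then have "openin (top_of_set S) (S \<inter> g -` {z \<in> D. u z < ereal s})"
      using assms by (intro continuous_openin_preimage[of _ _ D]) auto
    moreover have "S \<inter> g -` {z \<in> D. u z < ereal s} = {x \<in> S. u (g x) < ereal s}" using assms(3) by auto
    ultimately show "openin (top_of_set S) {x \<in> S. u (g x) < ereal s}" by simp
    have "openin (top_of_set S) (S \<inter> (\<lambda>x. c + R x) -` {s<..})"
      using assms by (intro continuous_openin_preimage_gen continuous_intros) auto
    moreover have "S \<inter> (\<lambda>x. c + R x) -` {s<..} = {x \<in> S. s < c + R x}" by auto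
    ultimately show "openin (top_of_set S) {x \<in> S. s < c + R x}" by simp
  qed
  then show ?thesis unfolding eq by (intro openin_Union) auto
qed

text \<open>A Schwarz lemma for \<open>u\<close> along a disc. If it failed at \<open>\<nu>\<close>,
  the function \<open>u (\<phi> \<zeta> + v) - Q \<zeta> - K * (norm v)\<^sup>2\<close> would exceed
  \<open>\<delta>\<close> at \<open>(0, \<nu>)\<close> but stay at most \<open>\<delta>\<close> on
  the boundary pieces \<open>norm \<zeta> = 1\<close>, \<open>norm \<zeta> = \<rho>\<close> and
  \<open>norm v = d\<close>. Its maximum would then be interior, which
  \<open>no_penalized_local_max\<close> excludes.\<close>

lemma green_family_le_on_poly_disc:
  fixes p :: "'n::finite \<Rightarrow> complex poly"
  defines "\<phi> \<equiv> \<lambda>\<zeta>. \<chi> i. poly (p i) \<zeta>"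
  assumes "open D" "\<phi> ` cball 0 1 \<subseteq> D" "\<phi> 0 = w" "u \<in> green_family D w"
    and lam: "0 < norm \<nu>" "norm \<nu> < 1"
  shows "u (\<phi> \<nu>) \<le> ereal (ln (norm \<nu>))"
proof (rule ccontr)
  assume neg: "\<not> ?thesis"
  have psh: "psh_on D u" and usc: "usc_on D u" and ult: "\<And>z. z \<in> D \<Longrightarrow> u z < 0"
    using assms(5) by (auto simp: green_family_def psh_on_def)
  obtain C where "\<forall>\<^sub>F z in nhds w. u z \<le> ennreal_ln (ennreal (norm (z - w))) + ereal C"
    using assms(5) by (auto simp: green_family_def)
  then obtain s0 where "s0 > 0" and pole0: "\<And>z. dist z w < s0 \<Longrightarrow> u z \<le> ennreal_ln (ennreal (norm (z - w))) + ereal C"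
    unfolding eventually_nhds_metric by blast
  have cont\<phi>: "continuous_on S \<phi>" for S unfolding \<phi>_def by (intro continuous_intros)
  have \<phi>D: "\<phi> \<zeta> \<in> D" if "norm \<zeta> \<le> 1" for \<zeta> using assms(3) that by auto
  obtain m0 where m0: "u (\<phi> \<nu>) = ereal m0"
    using neg ult[OF \<phi>D[of \<nu>]] lam by (cases "u (\<phi> \<nu>)") auto
  define l where "l = - ln (norm \<nu>)"
  have "l > 0" using lam by (simp add: l_def)
  define gap where "gap = m0 + l"
  have "gap > 0" using neg by (simp add: m0 gap_def l_def)
  \<comment> \<open>The surplus \<open>gap\<close> is spent in quarters: \<open>\<delta>\<close>
    makes \<open>- Q\<close> strictly subharmonic and is the threshold at
    \<open>norm \<zeta> = 1\<close>, while \<open>\<eta>\<close> weakens the logarithm in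
    \<open>Q\<close> so that the pole of \<open>u\<close> wins as \<open>norm \<zeta>\<close> tends
    to 0.\<close>
  define \<delta> where "\<delta> = gap / 4"
  define \<eta> where "\<eta> = min (1/2) (gap / (4 * l))"
  have \<eta>: "0 < \<eta>" "\<eta> < 1" "\<eta> * l \<le> gap / 4"
  proof -
    have "\<eta> \<le> gap / (4 * l)" by (simp add: \<eta>_def)
    then have "\<eta> * l \<le> gap / (4 * l) * l" using \<open>l > 0\<close> by (intro mult_right_mono) auto
    then show "\<eta> * l \<le> gap / 4" using \<open>l > 0\<close> by simp
  qed (use \<open>gap > 0\<close> \<open>l > 0\<close> in \<open>auto simp: \<eta>_def\<close>)
  have "\<delta> > 0" using \<open>gap > 0\<close> by (simp add: \<delta>_def)
  define Q where "Q \<zeta> = (1 - \<eta>) * ln (norm \<zeta>) - \<delta> * (norm \<zeta>)\<^sup>2" for \<zeta> :: complex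
  have big: "\<delta> < m0 - Q \<nu>"
  proof -
    have "m0 - Q \<nu> = gap - \<eta> * l + \<delta> * (norm \<nu>)\<^sup>2" by (simp add: Q_def gap_def l_def algebra_simps)
    moreover have "0 \<le> \<delta> * (norm \<nu>)\<^sup>2" using \<open>\<delta> > 0\<close> by simp
    ultimately show ?thesis using \<eta>(3) \<open>gap > 0\<close> unfolding \<delta>_def by linarith
  qed
  obtain L where L: "L \<ge> 0" "\<And>\<zeta>. norm \<zeta> \<le> 1 \<Longrightarrow> norm (\<phi> \<zeta> - w) \<le> L * norm \<zeta>"
  proof -
    obtain X q where Xq: "\<And>\<tau>. \<phi> (0 + \<tau>) = \<phi> 0 + \<tau> *s X + \<tau>\<^sup>2 *s (\<chi> i. poly (q i) \<tau>)"
      unfolding \<phi>_def using poly_vec_expand2[of p 0] by metis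
    have "compact ((\<lambda>\<tau>. X + \<tau> *s (\<chi> i. poly (q i) \<tau>)) ` cball 0 1)"
      by (intro compact_continuous_image compact_cball continuous_intros)
    then obtain L where L: "L > 0" "\<And>\<tau>. norm \<tau> \<le> 1 \<Longrightarrow> norm (X + \<tau> *s (\<chi> i. poly (q i) \<tau>)) \<le> L"
      by (force dest!: compact_imp_bounded simp: bounded_pos)
    have "norm (\<phi> \<zeta> - w) \<le> L * norm \<zeta>" if "norm \<zeta> \<le> 1" for \<zeta>
    proof -
      have eq: "\<phi> \<zeta> - w = \<zeta> *s (X + \<zeta> *s (\<chi> i. poly (q i) \<zeta>))"
        using Xq[of \<zeta>] by (simp add: assms(4) vector_add_ldistrib power2_eq_square vec_eq_iff algebra_simps)
      show ?thesis unfolding eq norm_vector_smult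
        using mult_right_mono[OF L(2)[OF that] norm_ge_zero[of \<zeta>]] by (simp only: mult.commute)
    qed
    then show ?thesis using that[of L] L(1) by simp
  qed
  have ev1: "\<forall>\<^sub>F \<rho> in at_right (0::real). \<eta> * ln \<rho> + (ln (L + 1) + C + \<delta>) < \<delta>"
  proof -
    have "filterlim (\<lambda>\<rho>. \<eta> * ln \<rho>) at_bot (at_right (0::real))"
      by (rule filterlim_tendsto_pos_mult_at_bot[OF tendsto_const \<eta>(1) ln_at_0])
    then have "\<forall>\<^sub>F \<rho> in at_right (0::real). \<eta> * ln \<rho> < - (ln (L + 1) + C)"
      by (simp add: filterlim_at_bot_dense)
    then show ?thesis by eventually_elim simp
  qed
  \<comment> \<open>The factor \<open>L + 1\<close> accounts for
    \<open>norm (\<phi> \<zeta> - w) \<le> L * norm \<zeta>\<close> and for a displacement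
    \<open>v\<close> of norm at most \<open>\<rho>\<close>; such points stay in the ball where the
    pole estimate holds.\<close>
  have ev2: "\<forall>\<^sub>F \<rho> in at_right (0::real). 0 < \<rho> \<and> \<rho> < norm \<nu> \<and> \<rho> < s0 / (L + 1)"
    using lam \<open>s0 > 0\<close> L(1)
    by (intro eventually_conj eventually_at_right_less eventually_at_right_real[THEN eventually_mono]
        eventually_at_rightI[of 0 "norm \<nu>"] eventually_at_rightI[of 0 "s0 / (L+1)"]) auto
  obtain \<rho> where \<rho>: "0 < \<rho>" "\<rho> < norm \<nu>" "\<rho> * (L + 1) < s0" "\<eta> * ln \<rho> + (ln (L + 1) + C + \<delta>) < \<delta>"
  proof -
    have "\<exists>\<rho>. \<eta> * ln \<rho> + (ln (L + 1) + C + \<delta>) < \<delta> \<and> 0 < \<rho> \<and> \<rho> < norm \<nu> \<and> \<rho> < s0 / (L + 1)"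
      using eventually_happens'[OF _ eventually_conj[OF ev1 ev2]] by auto
    then show ?thesis using that L(1) by (auto simp: pos_less_divide_eq)
  qed
  have "compact (\<phi> ` cball 0 1)" by (intro compact_continuous_image cont\<phi> compact_cball)
  from compact_subset_open_imp_ball_epsilon_subset[OF this assms(2,3)]
  obtain d0 where d0: "d0 > 0" "(\<Union>x\<in>\<phi> ` cball 0 1. ball x d0) \<subseteq> D" by blast
  define d where "d = min \<rho> (d0 / 2)"
  have d: "0 < d" "d \<le> \<rho>" "d < d0" using d0 \<rho> by (auto simp: d_def)
  have inD: "\<phi> \<zeta> + v \<in> D" if "norm \<zeta> \<le> 1" "norm v < d0" for \<zeta> v
    using d0(2) that by (force simp: dist_norm)
  \<comment> \<open>With this \<open>K\<close> the penalty equals \<open>- ln \<rho>\<close> at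
    \<open>norm v = d\<close>, enough to absorb the largest value of
    \<open>- (1 - \<eta>) * ln (norm \<zeta>)\<close> on the annulus.\<close>
  define K where "K = - ln \<rho> / d\<^sup>2"
  have "\<rho> < 1" using \<rho> lam by simp
  have "ln \<rho> \<le> 0" using \<rho> \<open>\<rho> < 1\<close> by simp
  then have "K \<ge> 0" by (simp add: K_def divide_nonpos_nonneg)
  define S where "S = cball (0 :: complex ^ 'n) d \<times> (cball (0::complex) 1 - ball 0 \<rho>)"
  have "compact S" unfolding S_def by (intro compact_Times compact_cball compact_diff open_ball)
  have S0: "(0, \<nu>) \<in> S" using \<rho> lam d by (auto simp: S_def)
  define g where "g x = \<phi> (snd x) + fst x" for x
  define R where "R x = Q (snd x) + K * (norm (fst x))\<^sup>2" for x :: "(complex ^ 'n) \<times> complex"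
  define \<Theta> where "\<Theta> x = u (g x) - ereal (R x)" for x
  have gD: "g x \<in> D" if "x \<in> S" for x using inD that d by (auto simp: g_def S_def)
  have "\<exists>x\<in>S. \<forall>y\<in>S. \<Theta> y \<le> \<Theta> x"
  proof (rule usc_attains_max[OF \<open>compact S\<close>])
    show "S \<noteq> {}" using S0 by auto
    show "\<Theta> x < \<infinity>" if "x \<in> S" for x
      using ult[OF gD[OF that]] by (cases "u (g x)") (auto simp: \<Theta>_def)
    fix c :: real
    have nz: "snd x \<noteq> 0" if "x \<in> S" for x using that \<rho> by (auto simp: S_def)
    show "openin (top_of_set S) {x \<in> S. \<Theta> x < ereal c}"
      unfolding \<Theta>_def
    proof (rule usc_on_compose_minus[OF usc])
      show "continuous_on S g" unfolding g_def
        by (intro continuous_intros continuous_on_compose2[OF cont\<phi>[of UNIV]]) auto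
      show "g ` S \<subseteq> D" using gD by auto
      show "continuous_on S R" unfolding R_def Q_def using nz by (intro continuous_intros) auto
    qed
  qed
  then obtain v0 \<zeta>0 where v\<zeta>: "(v0, \<zeta>0) \<in> S" and mx: "\<And>y. y \<in> S \<Longrightarrow> \<Theta> y \<le> \<Theta> (v0, \<zeta>0)" by force
  have n\<zeta>: "\<rho> \<le> norm \<zeta>0" "norm \<zeta>0 \<le> 1" and nv: "norm v0 \<le> d" using v\<zeta> by (auto simp: S_def)
  have big2: "ereal \<delta> < \<Theta> (v0, \<zeta>0)"
  proof -
    have "ereal \<delta> < \<Theta> (0, \<nu>)" using big m0 by (simp add: \<Theta>_def g_def R_def)
    also have "\<dots> \<le> \<Theta> (v0, \<zeta>0)" by (rule mx[OF S0])
    finally show ?thesis .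
  qed
  define z0 where "z0 = \<phi> \<zeta>0 + v0"
  have z0D: "z0 \<in> D" using inD[of \<zeta>0 v0] n\<zeta> nv d by (simp add: z0_def)
  obtain m where m: "u z0 = ereal m" "m < 0"
    using big2 ult[OF z0D] by (cases "u z0") (auto simp: \<Theta>_def g_def z0_def)
  have bigm: "\<delta> < m - Q \<zeta>0 - K * (norm v0)\<^sup>2"
    using big2 m by (simp add: \<Theta>_def g_def z0_def R_def algebra_simps)
  have Kv: "0 \<le> K * (norm v0)\<^sup>2" using \<open>K \<ge> 0\<close> by simp
  have lnz: "ln \<rho> \<le> ln (norm \<zeta>0)" using n\<zeta> \<rho> by (intro ln_mono) auto
  have dz: "\<delta> * (norm \<zeta>0)\<^sup>2 \<le> \<delta>" using n\<zeta> \<open>\<delta> > 0\<close> by (simp add: abs_square_le_1 mult_left_le)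
  have b1: "norm \<zeta>0 < 1"
  proof (rule ccontr)
    assume "\<not> norm \<zeta>0 < 1"
    then have "norm \<zeta>0 = 1" using n\<zeta> by simp
    then show False using bigm m Kv by (simp add: Q_def)
  qed
  have b2: "\<rho> < norm \<zeta>0"
  proof (rule ccontr)
    assume "\<not> \<rho> < norm \<zeta>0"
    then have eq: "norm \<zeta>0 = \<rho>" using n\<zeta> by simp
    have nw: "norm (z0 - w) \<le> \<rho> * (L + 1)"
    proof -
      have "norm (z0 - w) \<le> norm (\<phi> \<zeta>0 - w) + norm v0"
        unfolding z0_def using norm_triangle_ineq[of "\<phi> \<zeta>0 - w" v0] by (simp add: algebra_simps)
      also have "\<dots> \<le> L * \<rho> + \<rho>" using L(2)[of \<zeta>0] n\<zeta> eq nv d by (intro add_mono) auto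
      finally show ?thesis by (simp add: algebra_simps)
    qed
    have "ereal m \<le> ennreal_ln (ennreal (norm (z0 - w))) + ereal C"
      using pole0[of z0] nw \<rho> m by (simp add: dist_norm)
    also have "\<dots> \<le> ereal (ln (\<rho> * (L + 1))) + ereal C"
      using nw \<rho> L(1) by (intro add_mono ennreal_ln_le_ereal_ln) (auto intro!: mult_pos_pos add_nonneg_pos)
    finally have "m \<le> ln \<rho> + ln (L + 1) + C" using \<rho> L(1) by (simp add: ln_mult_pos)
    then show False using bigm Kv dz \<rho>(4) unfolding Q_def eq by (simp add: algebra_simps)
  qed
  have b3: "norm v0 < d"
  proof (rule ccontr)
    assume "\<not> norm v0 < d"
    then have "norm v0 = d" using nv by simp
    then have "K * (norm v0)\<^sup>2 = - ln \<rho>" using d by (simp add: K_def)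
    moreover have "(1 - \<eta>) * ln \<rho> \<le> (1 - \<eta>) * ln (norm \<zeta>0)" using lnz \<eta> by (intro mult_left_mono) auto
    moreover have "\<eta> * ln \<rho> \<le> 0" using \<open>\<rho> < 1\<close> \<rho> \<eta> by (simp add: mult_nonneg_nonpos)
    ultimately show False using bigm m dz unfolding Q_def by (simp add: algebra_simps)
  qed
  obtain X q where Xq: "\<And>\<tau>. \<phi> (\<zeta>0 + \<tau>) = \<phi> \<zeta>0 + \<tau> *s X + \<tau>\<^sup>2 *s (\<chi> i. poly (q i) \<tau>)"
    unfolding \<phi>_def using poly_vec_expand2[of p \<zeta>0] by metis
  \<comment> \<open>The displacement compensates the curvature of the disc:
    \<open>\<phi> (\<zeta>0 + \<tau>) + v \<tau>\<close> moves along a complex line, where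
    \<open>psh_on\<close> gives a mean value inequality.\<close>
  define v where "v \<tau> = v0 - \<tau>\<^sup>2 *s (\<chi> i. poly (q i) \<tau>)" for \<tau>
  have "((\<lambda>\<tau>. norm (v \<tau>)) \<longlongrightarrow> norm (v 0)) (nhds 0)"
    using continuous_on_tendsto_compose[of UNIV "\<lambda>\<tau>. norm (v \<tau>)" "\<lambda>x. x" 0 "nhds 0"]
    unfolding v_def by (simp add: continuous_intros filterlim_ident)
  then have "\<forall>\<^sub>F \<tau> in nhds 0. norm (v \<tau>) < d"
    using b3 by (intro order_tendstoD(2)) (auto simp: v_def)
  moreover have lim2: "((\<lambda>\<tau>. norm (\<zeta>0 + \<tau>)) \<longlongrightarrow> norm (\<zeta>0 + 0)) (nhds 0)"
    by (intro tendsto_intros filterlim_ident)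
  have "\<forall>\<^sub>F \<tau> in nhds 0. norm (\<zeta>0 + \<tau>) < 1" "\<forall>\<^sub>F \<tau> in nhds 0. \<rho> < norm (\<zeta>0 + \<tau>)"
    using order_tendstoD[OF lim2] b1 b2 by auto
  ultimately have "\<forall>\<^sub>F \<tau> in nhds 0. norm (v \<tau>) < d \<and> norm (\<zeta>0 + \<tau>) < 1 \<and> \<rho> < norm (\<zeta>0 + \<tau>)"
    by eventually_elim auto
  then obtain r0 where r0: "r0 > 0"
    "\<And>\<tau>. norm \<tau> < r0 \<Longrightarrow> norm (v \<tau>) < d \<and> norm (\<zeta>0 + \<tau>) < 1 \<and> \<rho> < norm (\<zeta>0 + \<tau>)"
    unfolding eventually_nhds_metric by (auto simp: dist_norm)
  have zeq: "\<phi> (\<zeta>0 + \<tau>) + v \<tau> = z0 + \<tau> *s X" for \<tau>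
    unfolding Xq v_def z0_def by simp
  show False
  proof (rule no_penalized_local_max[OF psh m(1) _ \<open>\<delta> > 0\<close> r0(1) \<open>K \<ge> 0\<close>, of \<zeta>0 X "1 - \<eta>" v0 q])
    show "\<zeta>0 \<noteq> 0" using b2 \<rho> by auto
    fix \<tau> :: complex assume \<tau>: "norm \<tau> < r0"
    note r = r0(2)[OF \<tau>]
    show "z0 + \<tau> *s X \<in> D" using inD[of "\<zeta>0 + \<tau>" "v \<tau>"] r d by (simp add: zeq)
    have "(v \<tau>, \<zeta>0 + \<tau>) \<in> S" using r by (auto simp: S_def)
    from mx[OF this] have "u (z0 + \<tau> *s X) - ereal (Q (\<zeta>0 + \<tau>) + K * (norm (v \<tau>))\<^sup>2)
       \<le> ereal (m - (Q \<zeta>0 + K * (norm v0)\<^sup>2))"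
      using m by (simp add: \<Theta>_def g_def R_def zeq z0_def)
    then show "u (z0 + \<tau> *s X) \<le> ereal (m
        + ((1 - \<eta>) * ln (norm (\<zeta>0 + \<tau>)) - \<delta> * (norm (\<zeta>0 + \<tau>))\<^sup>2) - ((1 - \<eta>) * ln (norm \<zeta>0) - \<delta> * (norm \<zeta>0)\<^sup>2)
        + K * ((norm (v0 - \<tau>\<^sup>2 *s (\<chi> i. poly (q i) \<tau>)))\<^sup>2 - (norm v0)\<^sup>2))"
      unfolding Q_def v_def
      by (cases "u (z0 + \<tau> *s X)") (auto simp: algebra_simps)
  qed
qed

lemma ereal_exp_mono: "x \<le> y \<Longrightarrow> ereal_exp x \<le> ereal_exp y"
  by (cases x; cases y) (auto simp: ereal_exp_def ennreal_leI)

text \<open>The metric tests points \<open>w + l *s X\<close> of a line, which a curved disc may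
  miss. For each small \<open>\<mu>\<close> the disc is therefore perturbed so as to pass through
  \<open>w + \<mu> *s b\<close>; the perturbation has size of order \<open>norm \<mu>\<close> and
  keeps the disc in \<open>D\<close>.\<close>

lemma azukawa_le_poly_disc:
  fixes p :: "'n::finite \<Rightarrow> complex poly"
  defines "\<phi> \<equiv> \<lambda>\<zeta>. \<chi> i. poly (p i) \<zeta>"
  assumes "open D" "\<phi> ` cball 0 1 \<subseteq> D" "\<phi> 0 = w" "0 < s"
    and der: "(\<chi> i. coeff (p i) 1) = s *\<^sub>R X"
  shows "azukawa D w X \<le> ennreal (1 / s)"
proof -
  define b :: "complex ^ 'n" where "b = (\<chi> i. coeff (p i) 1)"
  have cont\<phi>: "continuous_on S \<phi>" for S unfolding \<phi>_def by (intro continuous_intros)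
  have "\<exists>q. \<forall>\<tau>. poly (p i) \<tau> = w $ i + \<tau> * b $ i + \<tau>\<^sup>2 * poly q \<tau>" for i
  proof -
    obtain a0 r where r: "p i = pCons a0 r" by (metis pCons_cases)
    obtain a q where q: "r = pCons a q" by (metis pCons_cases)
    have "a0 = w $ i" using assms(4) r by (auto simp: \<phi>_def)
    moreover have "a = b $ i" by (simp add: b_def r q)
    ultimately show ?thesis by (intro exI[of _ q]) (simp add: r q power2_eq_square algebra_simps)
  qed
  then obtain q where q: "\<And>i \<tau>. poly (p i) \<tau> = w $ i + \<tau> * b $ i + \<tau>\<^sup>2 * poly (q i) \<tau>" by metis
  have "compact ((\<lambda>\<tau>. \<chi> i. poly (q i) \<tau>) ` cball (0::complex) 1)"
    by (intro compact_continuous_image compact_cball continuous_intros)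
  then obtain B where B: "B > 0" "\<And>\<tau>::complex. norm \<tau> \<le> 1 \<Longrightarrow> norm (\<chi> i. poly (q i) \<tau>) \<le> B"
    by (force dest!: compact_imp_bounded simp: bounded_pos)
  have "compact (\<phi> ` cball 0 1)" by (intro compact_continuous_image cont\<phi> compact_cball)
  from compact_subset_open_imp_ball_epsilon_subset[OF this assms(2,3)]
  obtain d0 where d0: "d0 > 0" "(\<Union>x\<in>\<phi> ` cball 0 1. ball x d0) \<subseteq> D" by blast
  have near: "green D (w + \<mu> *s b) w \<le> ereal (ln (norm \<mu>))"
    if \<mu>: "0 < norm \<mu>" "norm \<mu> < 1" "norm \<mu> < d0 / B" for \<mu>
    unfolding green_def
  proof (rule SUP_least)
    fix u assume u: "u \<in> green_family D w"
    \<comment> \<open>The added multiple of \<open>\<zeta>\<close> cancels the remainder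
      \<open>\<mu>\<^sup>2 * poly (q i) \<mu>\<close> at \<open>\<zeta> = \<mu>\<close> and fixes
      the centre of the disc.\<close>
    define p' where "p' i = p i + monom (- \<mu> * poly (q i) \<mu>) 1" for i
    have p': "(\<chi> i. poly (p' i) \<zeta>) = \<phi> \<zeta> - (\<zeta> * \<mu>) *s (\<chi> i. poly (q i) \<mu>)" for \<zeta>
      by (simp add: p'_def \<phi>_def vec_eq_iff poly_monom algebra_simps)
    have "u (\<chi> i. poly (p' i) \<mu>) \<le> ereal (ln (norm \<mu>))"
    proof (rule green_family_le_on_poly_disc[OF assms(2) _ _ u \<mu>(1,2)])
      show "(\<chi> i. poly (p' i) 0) = w" unfolding p' by (simp add: assms(4))
      show "(\<lambda>\<zeta>. \<chi> i. poly (p' i) \<zeta>) ` cball 0 1 \<subseteq> D"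
      proof safe
        fix \<zeta> :: complex assume \<zeta>: "\<zeta> \<in> cball 0 1"
        have "norm ((\<zeta> * \<mu>) *s (\<chi> i. poly (q i) \<mu>)) \<le> (1 * norm \<mu>) * B"
          unfolding norm_vector_smult norm_mult using \<zeta> B \<mu> by (intro mult_mono) auto
        also have "\<dots> < d0" using \<mu>(3) B(1) by (simp add: field_simps)
        finally have "(\<chi> i. poly (p' i) \<zeta>) \<in> ball (\<phi> \<zeta>) d0" unfolding p' by (simp add: dist_norm)
        then show "(\<chi> i. poly (p' i) \<zeta>) \<in> D" using d0(2) \<zeta> by blast
      qed
    qed
    moreover have "(\<chi> i. poly (p' i) \<mu>) = w + \<mu> *s b"
      by (simp add: p'_def q vec_eq_iff poly_monom algebra_simps power2_eq_square)
    ultimately show "u (w + \<mu> *s b) \<le> ereal (ln (norm \<mu>))" by simp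
  qed
  have "Limsup (at 0) (\<lambda>l. green D (w + l *s X) w - ereal (ln (norm l))) \<le> ereal (- ln s)"
  proof (rule Limsup_bounded)
    have "\<forall>\<^sub>F l in at 0. l \<noteq> 0 \<and> norm l < s \<and> norm l < s * (d0 / B)"
      unfolding eventually_at using \<open>s > 0\<close> d0(1) B(1)
      by (intro exI[of _ "min s (s * (d0 / B))"]) auto
    then show "\<forall>\<^sub>F l in at 0. green D (w + l *s X) w - ereal (ln (norm l)) \<le> ereal (- ln s)"
    proof eventually_elim
      case (elim l)
      define \<mu> where "\<mu> = l / of_real s"
      have n: "norm \<mu> = norm l / s" using \<open>s > 0\<close> by (simp add: \<mu>_def norm_divide)
      have "coeff (p i) (Suc 0) = of_real s * X $ i" for i
        using arg_cong[OF der, of "\<lambda>v. v $ i"] by (simp add: scaleR_conv_of_real[where 'a = complex])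
      then have "\<mu> *s b = l *s X"
        using \<open>s > 0\<close> by (simp add: b_def \<mu>_def vec_eq_iff)
      moreover have "green D (w + \<mu> *s b) w \<le> ereal (ln (norm \<mu>))"
        using elim \<open>s > 0\<close> by (intro near) (auto simp: n pos_divide_less_eq mult.commute)
      moreover have "ln (norm \<mu>) = ln (norm l) - ln s" using elim \<open>s > 0\<close> unfolding n by (simp add: ln_div)
      ultimately show ?case
        by (cases "green D (w + l *s X) w") auto
    qed
  qed
  then have "azukawa D w X \<le> ereal_exp (ereal (- ln s))"
    unfolding azukawa_def by (rule ereal_exp_mono)
  also have "\<dots> = ennreal (1 / s)"
    using \<open>s > 0\<close> by (simp add: ereal_exp_def exp_minus inverse_eq_divide)
  finally show ?thesis .
qed

subsection \<open>Fejer's kernel and discretised discs\<close>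

definition fejer :: "nat \<Rightarrow> nat \<Rightarrow> real" where
  "fejer M m = 1 - real m / (real M + 1)"

text \<open>Induction on \<open>M\<close>: with \<open>s\<close> the sum up to \<open>M\<close>, the
  cross term \<open>cnj s * z ^ Suc M\<close> is the sum of \<open>z ^ m\<close> for
  \<open>m\<close> from 1 to \<open>M + 1\<close>, which raises every weight
  \<open>M + 1 - m\<close> by one.\<close>

lemma fejer_kernel_eq:
  assumes "norm z = 1"
  shows "(real M + 1) * (1 + 2 * (\<Sum>m=1..M. fejer M m * Re (z ^ m))) = (norm (\<Sum>m\<le>M. z ^ m))\<^sup>2"
proof -
  have zc: "cnj z * z = 1" using assms by (simp add: complex_norm_square[symmetric] mult.commute)
  have "(real M + 1) + 2 * (\<Sum>m=1..M. (real M + 1 - real m) * Re (z ^ m)) = (norm (\<Sum>m\<le>M. z ^ m))\<^sup>2"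
  proof (induction M)
    case 0
    then show ?case by simp
  next
    case (Suc M)
    define s where "s = (\<Sum>m\<le>M. z ^ m)"
    have "cnj s * z ^ Suc M = (\<Sum>m\<le>M. cnj (z ^ m) * z ^ Suc M)"
      by (simp add: s_def sum_distrib_right)
    also have "\<dots> = (\<Sum>m\<le>M. z ^ (Suc M - m))"
    proof (rule sum.cong)
      fix m assume "m \<in> {..M}"
      then have "z ^ Suc M = z ^ m * z ^ (Suc M - m)" by (simp flip: power_add)
      then have "cnj (z ^ m) * z ^ Suc M = (cnj z * z) ^ m * z ^ (Suc M - m)"
        by (simp add: power_mult_distrib mult.assoc)
      then show "cnj (z ^ m) * z ^ Suc M = z ^ (Suc M - m)" by (simp add: zc)
    qed simp
    also have "\<dots> = (\<Sum>m=1..Suc M. z ^ m)"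
      by (rule sum.reindex_bij_witness[of _ "\<lambda>m. Suc M - m" "\<lambda>m. Suc M - m"]) auto
    finally have cs: "cnj s * z ^ Suc M = (\<Sum>m=1..Suc M. z ^ m)" .
    have "(norm (s + z ^ Suc M))\<^sup>2 = (norm s)\<^sup>2 + 1 + 2 * Re (cnj s * z ^ Suc M)"
    proof -
      have "(norm (z ^ Suc M))\<^sup>2 = 1" unfolding norm_power assms by simp
      then show ?thesis unfolding cmod_power2 by (simp add: power2_eq_square algebra_simps del: power_Suc)
    qed
    then have "(norm (\<Sum>m\<le>Suc M. z ^ m))\<^sup>2 = (norm s)\<^sup>2 + 1 + 2 * (\<Sum>m=1..Suc M. Re (z ^ m))"
      unfolding cs by (simp add: s_def Re_sum)
    also have "(norm s)\<^sup>2 = (real M + 1) + 2 * (\<Sum>m=1..M. (real M + 1 - real m) * Re (z ^ m))"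
      unfolding s_def Suc.IH[symmetric] ..
    also have "\<dots> + 1 + 2 * (\<Sum>m=1..Suc M. Re (z ^ m)) =
       (real (Suc M) + 1) + 2 * ((\<Sum>m=1..Suc M. (real M + 1 - real m) * Re (z ^ m)) + (\<Sum>m=1..Suc M. Re (z ^ m)))"
      by simp
    also have "\<dots> = (real (Suc M) + 1) + 2 * (\<Sum>m=1..Suc M. (real (Suc M) + 1 - real m) * Re (z ^ m))"
      unfolding sum.distrib[symmetric] by (simp add: algebra_simps)
    finally show ?case ..
  qed
  moreover have "(real M + 1) * (1 + 2 * (\<Sum>m=1..M. fejer M m * Re (z ^ m))) =
     (real M + 1) + 2 * (\<Sum>m=1..M. (real M + 1 - real m) * Re (z ^ m))"
  proof -
    have "(real M + 1) * fejer M m = real M + 1 - real m" for m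
      by (simp add: fejer_def field_simps)
    then have "(real M + 1) * (fejer M m * Re (z ^ m)) = (real M + 1 - real m) * Re (z ^ m)" for m
      by (metis mult.assoc)
    then have "(real M + 1) * (\<Sum>m=1..M. fejer M m * Re (z ^ m)) = (\<Sum>m=1..M. (real M + 1 - real m) * Re (z ^ m))"
      unfolding sum_distrib_left by (intro sum.cong refl)
    then show ?thesis by (simp only: distrib_left mult.left_commute[of _ 2] mult_1_right)
  qed
  ultimately show ?thesis by simp
qed

text \<open>The kernel is the real part of a polynomial, so the square on the circle gives
  nonnegativity inside by the maximum principle. Interior points matter because a smoothed disc must
  lie in \<open>D\<close> over the whole closed unit disc.\<close>

lemma fejer_kernel_nonneg:
  assumes "norm z \<le> 1"
  shows "0 \<le> 1 + 2 * (\<Sum>m=1..M. fejer M m * Re (z ^ m))"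
proof -
  define F where "F z = - (1 + 2 * (\<Sum>m=1..M. of_real (fejer M m) * z ^ m))" for z :: complex
  have ReF: "Re (F z) = - (1 + 2 * (\<Sum>m=1..M. fejer M m * Re (z ^ m)))" for z
    by (simp add: F_def)
  have "Re (F z) \<le> 0"
  proof (rule maximum_real_frontier[of F "cball 0 1"])
    show "F holomorphic_on interior (cball 0 1)" unfolding F_def by (intro holomorphic_intros)
    show "continuous_on (closure (cball 0 1)) F" unfolding F_def by (intro continuous_intros)
    fix x :: complex assume "x \<in> frontier (cball 0 1)"
    then have "norm x = 1" by (simp add: sphere_def dist_norm)
    from fejer_kernel_eq[OF this, of M]
    have "0 \<le> (real M + 1) * (1 + 2 * (\<Sum>m=1..M. fejer M m * Re (x ^ m)))" by simp
    then show "Re (F x) \<le> 0" unfolding ReF by (simp add: zero_le_mult_iff)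
  qed (use assms in auto)
  then show ?thesis by (simp add: ReF)
qed

section \<open>Discrete Fourier analysis at roots of unity\<close>

definition unity_root :: "nat \<Rightarrow> nat \<Rightarrow> complex" where
  "unity_root N j = cis (2 * pi * real j / real N)"

lemma norm_unity_root [simp]: "norm (unity_root N j) = 1"
  by (simp add: unity_root_def)

lemma sum_cis_eq_0:
  assumes "\<bar>n\<bar> < int N" "n \<noteq> 0"
  shows "(\<Sum>j<N. cis (2 * pi * real j * of_int n / real N)) = 0"
proof -
  define x where "x = cis (2 * pi * of_int n / real N)"
  have N: "N > 0" using assms by auto
  have pw: "x ^ j = cis (2 * pi * real j * of_int n / real N)" for j
    unfolding x_def Complex.DeMoivre by (simp add: algebra_simps)
  have "x ^ N = 1"
    unfolding pw using N cis_multiple_2pi[of "of_int n"] by (simp add: mult.assoc)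
  moreover have "x \<noteq> 1"
  proof
    assume "x = 1"
    then have "cos (2 * pi * of_int n / real N) = 1" by (simp add: x_def complex_eq_iff)
    then obtain k :: int where "2 * pi * of_int n / real N = of_int k * 2 * pi"
      by (auto simp: cos_one_2pi_int)
    then have "real_of_int n = of_int (k * int N)" using N by (simp add: field_simps)
    then have "n = k * int N" by (simp only: of_int_eq_iff)
    moreover from this assms have "k \<noteq> 0" by auto
    then have "int N \<le> \<bar>k\<bar> * int N" using mult_right_mono[of 1 "\<bar>k\<bar>" "int N"] by simp
    ultimately show False using assms(1) by (simp add: abs_mult)
  qed
  ultimately have "(\<Sum>j<N. x ^ j) = 0" by (simp add: geometric_sum)
  then show ?thesis by (simp add: pw)
qed

lemma sum_unity_root_power:
  assumes "0 < k" "k < N"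
  shows "(\<Sum>j<N. unity_root N j ^ k) = 0"
proof -
  have "unity_root N j ^ k = cis (2 * pi * real j * of_int (int k) / real N)" for j
    unfolding unity_root_def Complex.DeMoivre by (simp add: algebra_simps)
  then show ?thesis using sum_cis_eq_0[of "int k" N] assms by simp
qed

lemma sum_unity_root_cnj:
  assumes "k < N" "m < N"
  shows "(\<Sum>j<N. unity_root N j ^ k * cnj (unity_root N j) ^ m) = (if k = m then of_nat N else 0)"
proof -
  have "unity_root N j ^ k * cnj (unity_root N j) ^ m = cis (2 * pi * real j * of_int (int k - int m) / real N)" for j
    unfolding unity_root_def cis_cnj Complex.DeMoivre cis_mult by (simp add: algebra_simps diff_divide_distrib)
  then show ?thesis using sum_cis_eq_0[of "int k - int m" N] assms by auto
qed

lemma fejer_0 [simp]: "fejer M 0 = 1"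
  by (simp add: fejer_def)

definition fejer_kernel :: "nat \<Rightarrow> complex \<Rightarrow> real" where
  "fejer_kernel M z = 1 + 2 * (\<Sum>m=1..M. fejer M m * Re (z ^ m))"

lemma fejer_kernel_expand:
  "of_real (fejer_kernel M z) = 1 + (\<Sum>m=1..M. of_real (fejer M m) * (z ^ m + cnj z ^ m))"
proof -
  have tw: "of_real (2 * Re x) = x + cnj x" for x by (simp add: complex_eq_iff)
  have "of_real (fejer_kernel M z) = 1 + (\<Sum>m=1..M. of_real (fejer M m) * (of_real (2 * Re (z ^ m)) :: complex))"
    by (simp add: fejer_kernel_def sum_distrib_left mult.left_commute)
  then show ?thesis unfolding tw by simp
qed

text \<open>Each frequency is damped by its Fejer weight, without aliasing: the sums
  \<open>m + k\<close> lie strictly between 0 and \<open>N\<close>, so the antiholomorphic half of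
  the kernel vanishes and the result is a polynomial in \<open>\<zeta>\<close>. This is the origin
  of the order \<open>2 * M + 1\<close>.\<close>

lemma fejer_kernel_smoothing:
  assumes "k \<le> M" "2 * M < N"
  shows "(\<Sum>j<N. of_real (fejer_kernel M (\<zeta> * cnj (unity_root N j))) * unity_root N j ^ k)
    = of_nat N * (of_real (fejer M k) * \<zeta> ^ k)"
proof -
  let ?Z = "unity_root N"
  have ker: "of_real (fejer_kernel M (\<zeta> * cnj (?Z j))) = 1 + (\<Sum>m=1..M. of_real (fejer M m) *
      (\<zeta> ^ m * cnj (?Z j) ^ m + cnj \<zeta> ^ m * ?Z j ^ m))" for j
    by (simp add: fejer_kernel_expand power_mult_distrib)
  have "(\<Sum>j<N. of_real (fejer_kernel M (\<zeta> * cnj (?Z j))) * ?Z j ^ k)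
     = (\<Sum>j<N. ?Z j ^ k) + (\<Sum>j<N. \<Sum>m=1..M. of_real (fejer M m) *
         (\<zeta> ^ m * (?Z j ^ k * cnj (?Z j) ^ m) + cnj \<zeta> ^ m * ?Z j ^ (m + k)))"
    unfolding ker distrib_right[of 1] mult_1_left sum.distrib sum_distrib_right
    by (intro arg_cong2[where f = "(+)"] sum.cong refl) (simp add: power_add algebra_simps)
  also have "(\<Sum>j<N. \<Sum>m=1..M. of_real (fejer M m) *
         (\<zeta> ^ m * (?Z j ^ k * cnj (?Z j) ^ m) + cnj \<zeta> ^ m * ?Z j ^ (m + k)))
     = (\<Sum>m=1..M. of_real (fejer M m) * (\<zeta> ^ m * (\<Sum>j<N. ?Z j ^ k * cnj (?Z j) ^ m)
         + cnj \<zeta> ^ m * (\<Sum>j<N. ?Z j ^ (m + k))))"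
    by (subst sum.swap) (simp add: sum_distrib_left sum.distrib distrib_left)
  also have "\<dots> = (\<Sum>m=1..M. if k = m then of_real (fejer M m) * (\<zeta> ^ m * of_nat N) else 0)"
  proof (rule sum.cong)
    fix m assume m: "m \<in> {1..M}"
    have "(\<Sum>j<N. ?Z j ^ (m + k)) = 0" using m assms by (intro sum_unity_root_power) auto
    moreover have "(\<Sum>j<N. ?Z j ^ k * cnj (?Z j) ^ m) = (if k = m then of_nat N else 0)"
      using m assms by (intro sum_unity_root_cnj) auto
    ultimately show "of_real (fejer M m) * (\<zeta> ^ m * (\<Sum>j<N. ?Z j ^ k * cnj (?Z j) ^ m)
         + cnj \<zeta> ^ m * (\<Sum>j<N. ?Z j ^ (m + k))) = (if k = m then of_real (fejer M m) * (\<zeta> ^ m * of_nat N) else 0)"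
      by simp
  qed simp
  also have "(\<Sum>j<N. ?Z j ^ k) = (if k = 0 then of_nat N else 0)"
    using sum_unity_root_power[of k N] assms by auto
  finally show ?thesis using assms by (cases "k = 0") (auto simp: sum.delta algebra_simps)
qed

section \<open>Feasible pairs and the upper bound for the Azukawa metric\<close>

text \<open>Sampling replaces the circle by finitely many points: the constraint set becomes a
  finite power of \<open>D\<close>, and a separating functional becomes a finite family of vectors
  instead of a vector measure.\<close>

definition feasible :: "(complex ^ 'n) set \<Rightarrow> nat \<Rightarrow> complex ^ 'n \<Rightarrow> complex ^ 'n \<Rightarrow> bool" where
  "feasible D M w X \<longleftrightarrow> (\<exists>a. \<forall>j<2*M+1. w + unity_root (2*M+1) j *s X +
      (\<Sum>k=2..M. unity_root (2*M+1) j ^ k *s a k) \<in> D)"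

lemma sum_atMost_split2:
  assumes "1 \<le> (M::nat)"
  shows "(\<Sum>k\<le>M. f k) = f 0 + f 1 + (\<Sum>k=2..M. f k :: 'a::comm_monoid_add)"
proof -
  have "{..M} = insert 0 (insert 1 {2..M})" using assms by auto
  then show ?thesis by (simp add: add.assoc)
qed

text \<open>The weights \<open>G \<zeta> j\<close> are nonnegative and add up to 1, so the smoothed
  polynomial takes its values in the convex hull of the samples. Smoothing multiplies the derivative
  by \<open>fejer M 1\<close>, which is the loss in the bound.\<close>

lemma feasible_imp_azukawa_le:
  fixes D :: "(complex ^ 'n) set"
  assumes "open D" "convex D" "1 \<le> M" "0 < s" "feasible D M w (s *\<^sub>R X)"
  shows "azukawa D w X \<le> ennreal (1 / (s * fejer M 1))"
proof -
  define N where "N = 2 * M + 1"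
  have N: "N > 0" "2 * M < N" by (auto simp: N_def)
  let ?Z = "unity_root N"
  obtain a where a: "\<And>j. j < N \<Longrightarrow> w + ?Z j *s (s *\<^sub>R X) + (\<Sum>k=2..M. ?Z j ^ k *s a k) \<in> D"
    using assms(5) unfolding feasible_def N_def by blast
  define b where "b k = (if k = 0 then w else if k = 1 then s *\<^sub>R X else a k)" for k :: nat
  define x where "x j = (\<Sum>k\<le>M. ?Z j ^ k *s b k)" for j
  have x: "x j \<in> D" if "j < N" for j
    using a[OF that] unfolding x_def sum_atMost_split2[OF assms(3)] by (simp add: b_def)
  define p where "p i = (\<Sum>k\<le>M. monom (of_real (fejer M k) * b k $ i) k)" for i
  have py: "poly (p i) \<zeta> = (\<Sum>k\<le>M. of_real (fejer M k) * \<zeta> ^ k * b k $ i)" for i \<zeta>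
    by (simp add: p_def poly_sum poly_monom algebra_simps)
  define G where "G \<zeta> j = fejer_kernel M (\<zeta> * cnj (?Z j)) / real N" for \<zeta> j
  have smooth: "(\<Sum>j<N. of_real (G \<zeta> j) * ?Z j ^ k) = of_real (fejer M k) * \<zeta> ^ k" if "k \<le> M" for k \<zeta>
  proof -
    have "(\<Sum>j<N. of_real (G \<zeta> j) * ?Z j ^ k) = (\<Sum>j<N. of_real (fejer_kernel M (\<zeta> * cnj (?Z j))) * ?Z j ^ k) / of_nat N"
      by (simp add: G_def sum_divide_distrib)
    also have "\<dots> = of_real (fejer M k) * \<zeta> ^ k"
      unfolding fejer_kernel_smoothing[OF that N(2)] using N by simp
    finally show ?thesis .
  qed
  have rep: "(\<chi> i. poly (p i) \<zeta>) = (\<Sum>j<N. G \<zeta> j *\<^sub>R x j)" for \<zeta>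
  proof -
    have "(\<Sum>j<N. G \<zeta> j *\<^sub>R x j) $ i = poly (p i) \<zeta>" for i
    proof -
      have "(\<Sum>j<N. G \<zeta> j *\<^sub>R x j) $ i = (\<Sum>j<N. \<Sum>k\<le>M. of_real (G \<zeta> j) * ?Z j ^ k * b k $ i)"
        by (simp add: x_def sum_component scaleR_conv_of_real[where 'a = complex] sum_distrib_left mult.assoc)
      also have "\<dots> = (\<Sum>k\<le>M. (\<Sum>j<N. of_real (G \<zeta> j) * ?Z j ^ k) * b k $ i)"
        by (subst sum.swap) (simp add: sum_distrib_right)
      also have "\<dots> = poly (p i) \<zeta>" by (simp add: py smooth)
      finally show ?thesis .
    qed
    then show ?thesis by (simp add: vec_eq_iff)
  qed
  have one: "(\<Sum>j<N. G \<zeta> j) = 1" for \<zeta>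
  proof -
    have "complex_of_real (\<Sum>j<N. G \<zeta> j) = 1" using smooth[of 0 \<zeta>] by simp
    then show ?thesis by (simp only: of_real_eq_1_iff)
  qed
  have cf: "coeff (p i) k = of_real (fejer M k) * b k $ i" if "k \<le> M" for i k
    using that by (simp add: p_def coeff_sum sum.delta)
  have "azukawa D w X \<le> ennreal (1 / (s * fejer M 1))"
  proof (rule azukawa_le_poly_disc[OF assms(1)])
    show "(\<chi> i. poly (p i) 0) = w"
      using cf[of 0] by (simp add: poly_0_coeff_0 b_def vec_eq_iff)
    show "0 < s * fejer M 1" using assms(3,4) by (simp add: fejer_def)
    show "(\<chi> i. coeff (p i) 1) = (s * fejer M 1) *\<^sub>R X"
      using cf[of 1] assms(3) by (simp add: b_def vec_eq_iff scaleR_conv_of_real[where 'a = complex])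
    show "(\<lambda>\<zeta>. \<chi> i. poly (p i) \<zeta>) ` cball 0 1 \<subseteq> D"
    proof safe
      fix \<zeta> :: complex assume "\<zeta> \<in> cball 0 1"
      then have "0 \<le> G \<zeta> j" for j
        unfolding G_def fejer_kernel_def
        by (intro divide_nonneg_nonneg fejer_kernel_nonneg) (auto simp: norm_mult)
      then show "(\<chi> i. poly (p i) \<zeta>) \<in> D"
        unfolding rep using x one by (intro convex_sum assms(2)) auto
    qed
  qed
  then show ?thesis .
qed

subsection \<open>Separation from a subspace\<close>

lemma maximal_disjoint_subspace:
  fixes C L :: "'a::real_vector set"
  assumes "subspace L" "L \<inter> C = {}"
  obtains H where "subspace H" "L \<subseteq> H" "H \<inter> C = {}"
    "\<And>H'. subspace H' \<Longrightarrow> H \<subseteq> H' \<Longrightarrow> H' \<inter> C = {} \<Longrightarrow> H' = H"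
proof -
  define \<A> where "\<A> = {H. subspace H \<and> L \<subseteq> H \<and> H \<inter> C = {}}"
  have "\<exists>M\<in>\<A>. \<forall>X\<in>\<A>. M \<subseteq> X \<longrightarrow> X = M"
  proof (rule subset_Zorn_nonempty)
    show "\<A> \<noteq> {}" using assms by (auto simp: \<A>_def)
    fix \<C> assume \<C>: "\<C> \<noteq> {}" "subset.chain \<A> \<C>"
    have sub: "subspace H" "L \<subseteq> H" "H \<inter> C = {}" if "H \<in> \<C>" for H
      using that \<C> by (auto simp: \<A>_def subset.chain_def)
    have "subspace (\<Union>\<C>)"
    proof (rule subspaceI)
      show "0 \<in> \<Union>\<C>" using \<C>(1) sub subspace_0 by blast
      show "c *\<^sub>R x \<in> \<Union>\<C>" if "x \<in> \<Union>\<C>" for c x using that sub subspace_scale by blast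
      fix x y assume "x \<in> \<Union>\<C>" "y \<in> \<Union>\<C>"
      then obtain H1 H2 where H: "H1 \<in> \<C>" "H2 \<in> \<C>" "x \<in> H1" "y \<in> H2" by blast
      then have "H1 \<subseteq> H2 \<or> H2 \<subseteq> H1" using \<C>(2) by (auto simp: subset.chain_def)
      then show "x + y \<in> \<Union>\<C>" using H sub(1) subspace_add by (meson UnionI subsetD)
    qed
    moreover have "L \<subseteq> \<Union>\<C>" using \<C>(1) sub(2) by blast
    moreover have "\<Union>\<C> \<inter> C = {}" using sub(3) by blast
    ultimately show "\<Union>\<C> \<in> \<A>" by (simp add: \<A>_def)
  qed
  then obtain H where "H \<in> \<A>" and max: "\<And>X. X \<in> \<A> \<Longrightarrow> H \<subseteq> X \<Longrightarrow> X = H" by blast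
  then show ?thesis by (intro that[of H]) (auto simp: \<A>_def)
qed

text \<open>A subspace maximal among those disjoint from \<open>C\<close> is a hyperplane.\<close>
lemma separate_algebraically_open_convex:
  fixes C L :: "'a::real_vector set"
  assumes "subspace L" "L \<inter> C = {}" "convex C" "C \<noteq> {}"
    and op: "\<And>x y. x \<in> C \<Longrightarrow> \<exists>e>0. \<forall>s. \<bar>s\<bar> < e \<longrightarrow> x + s *\<^sub>R y \<in> C"
  obtains f :: "'a \<Rightarrow> real" where "linear f" "\<And>x. x \<in> L \<Longrightarrow> f x = 0" "\<And>x. x \<in> C \<Longrightarrow> 0 < f x"
proof -
  obtain H where H: "subspace H" "L \<subseteq> H" "H \<inter> C = {}"
    and max: "\<And>H'. subspace H' \<Longrightarrow> H \<subseteq> H' \<Longrightarrow> H' \<inter> C = {} \<Longrightarrow> H' = H"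
    using maximal_disjoint_subspace[OF assms(1,2)] by blast
  \<comment> \<open>\<open>P\<close> is the convex cone of positive multiples of \<open>C\<close>,
    thickened by \<open>H\<close>. It inherits the algebraic openness of \<open>C\<close> and misses
    \<open>H\<close>; the aim is that \<open>H\<close>, \<open>P\<close> and \<open>- P\<close>
    cover the space.\<close>
  define P where "P = {h + t *\<^sub>R c |h t c. h \<in> H \<and> 0 < t \<and> c \<in> C}"
  have PI: "h + t *\<^sub>R c \<in> P" if "h \<in> H" "0 < t" "c \<in> C" for h t c using that by (auto simp: P_def)
  have CP: "c \<in> P" if "c \<in> C" for c using PI[of 0 1 c] that H(1) by (simp add: subspace_0)
  have Padd: "x + y \<in> P" if xy: "x \<in> P" "y \<in> P" for x y
  proof -
    obtain h t c h' t' c' where 1: "x = h + t *\<^sub>R c" "h \<in> H" "0 < t" "c \<in> C"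
      "y = h' + t' *\<^sub>R c'" "h' \<in> H" "0 < t'" "c' \<in> C" using xy by (auto simp: P_def)
    define c'' where "c'' = (t / (t + t')) *\<^sub>R c + (t' / (t + t')) *\<^sub>R c'"
    have "t / (t + t') + t' / (t + t') = 1" using 1 by (simp flip: add_divide_distrib)
    then have "c'' \<in> C" unfolding c''_def using 1 by (intro convexD[OF assms(3)]) auto
    moreover have "(t + t') *\<^sub>R c'' = t *\<^sub>R c + t' *\<^sub>R c'"
      using 1 by (simp add: c''_def scaleR_add_right)
    then have eq: "x + y = (h + h') + (t + t') *\<^sub>R c''" using 1 by simp
    ultimately show ?thesis unfolding eq using 1 H(1) by (intro PI) (auto simp: subspace_add)
  qed
  have Pscale: "t *\<^sub>R x \<in> P" if xt: "x \<in> P" "0 < t" for t x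
  proof -
    obtain h s c where 1: "x = h + s *\<^sub>R c" "h \<in> H" "0 < s" "c \<in> C" using xt(1) by (auto simp: P_def)
    have "t *\<^sub>R x = t *\<^sub>R h + (t * s) *\<^sub>R c" using 1 by (simp add: scaleR_add_right)
    then show ?thesis using PI[of "t *\<^sub>R h" "t * s" c] 1 xt H(1) by (simp add: subspace_scale)
  qed
  have PH: "x \<notin> H" if xP: "x \<in> P" for x
  proof
    assume "x \<in> H"
    obtain h s c where 1: "x = h + s *\<^sub>R c" "h \<in> H" "0 < s" "c \<in> C" using xP by (auto simp: P_def)
    then have "c = (1 / s) *\<^sub>R (x - h)" by simp
    then have "c \<in> H" using H(1) 1 \<open>x \<in> H\<close> by (metis subspace_diff subspace_scale)
    then show False using H(3) 1 by blast
  qed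
  have Popen: "\<exists>e>0. \<forall>s. \<bar>s\<bar> < e \<longrightarrow> x + s *\<^sub>R y \<in> P" if x: "x \<in> P" for x y
  proof -
    obtain h t c where 1: "x = h + t *\<^sub>R c" "h \<in> H" "0 < t" "c \<in> C" using x by (auto simp: P_def)
    obtain e where e: "e > 0" "\<And>s. \<bar>s\<bar> < e \<Longrightarrow> c + s *\<^sub>R y \<in> C" using op[OF 1(4)] by blast
    have "x + s *\<^sub>R y \<in> P" if "\<bar>s\<bar> < e * t" for s
    proof -
      have "c + (s / t) *\<^sub>R y \<in> C" using that 1 by (intro e) (simp add: pos_divide_less_eq)
      then have "h + t *\<^sub>R (c + (s / t) *\<^sub>R y) \<in> P" using 1 by (intro PI)
      then show ?thesis using 1 by (simp add: scaleR_add_right add.assoc)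
    qed
    then show ?thesis using e 1 by (intro exI[of _ "e * t"]) auto
  qed
  \<comment> \<open>Maximality of \<open>H\<close>: adjoining the line through \<open>x\<close>
    produces a point of \<open>C\<close>, and the sign of the coefficient of \<open>x\<close> in it
    decides between \<open>x\<close> and \<open>- x\<close>.\<close>
  have total: "x \<in> P \<or> - x \<in> P" if "x \<notin> H" for x
  proof -
    define H' where "H' = {h + s *\<^sub>R x |h s. h \<in> H}"
    have "subspace H'"
    proof (rule subspaceI)
      show "0 \<in> H'" using H(1) subspace_0 by (force simp: H'_def intro: exI[of _ 0])
      show "u + v \<in> H'" if uv: "u \<in> H'" "v \<in> H'" for u v
      proof -
        obtain h s h' s' where "u = h + s *\<^sub>R x" "h \<in> H" "v = h' + s' *\<^sub>R x" "h' \<in> H"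
          using uv by (auto simp: H'_def)
        then have "u + v = (h + h') + (s + s') *\<^sub>R x" "h + h' \<in> H"
          using H(1) by (auto simp: scaleR_add_left subspace_add)
        then show ?thesis unfolding H'_def by blast
      qed
      show "c *\<^sub>R u \<in> H'" if u: "u \<in> H'" for c u
      proof -
        obtain h s where "u = h + s *\<^sub>R x" "h \<in> H" using u by (auto simp: H'_def)
        then have "c *\<^sub>R u = c *\<^sub>R h + (c * s) *\<^sub>R x" "c *\<^sub>R h \<in> H"
          using H(1) by (auto simp: scaleR_add_right subspace_scale)
        then show ?thesis unfolding H'_def by blast
      qed
    qed
    moreover have "H \<subseteq> H'"
    proof
      fix h assume "h \<in> H"
      then show "h \<in> H'" unfolding H'_def by (intro CollectI exI[of _ h] exI[of _ 0]) auto
    qed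
    moreover have "x \<in> H'" unfolding H'_def
      using H(1) by (intro CollectI exI[of _ 0] exI[of _ 1]) (auto simp: subspace_0)
    ultimately have "H' \<inter> C \<noteq> {}" using max that by blast
    then obtain h s where hs: "h \<in> H" "h + s *\<^sub>R x \<in> C" by (auto simp: H'_def)
    consider "s > 0" | "s < 0" | "s = 0" by linarith
    then show ?thesis
    proof cases
      case 1
      have "x = - ((1/s) *\<^sub>R h) + (1/s) *\<^sub>R (h + s *\<^sub>R x)" using 1 by (simp add: scaleR_add_right)
      moreover have "- ((1/s) *\<^sub>R h) + (1/s) *\<^sub>R (h + s *\<^sub>R x) \<in> P"
        using hs 1 H(1) by (intro PI) (auto simp: subspace_scale subspace_neg)
      ultimately show ?thesis by simp
    next
      case 2
      have "- x = - ((1/(-s)) *\<^sub>R h) + (1/(-s)) *\<^sub>R (h + s *\<^sub>R x)" using 2 by (simp add: scaleR_add_right)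
      moreover have "- ((1/(-s)) *\<^sub>R h) + (1/(-s)) *\<^sub>R (h + s *\<^sub>R x) \<in> P"
        using hs 2 H(1) by (intro PI) (auto simp: subspace_scale subspace_neg)
      ultimately show ?thesis by simp
    next
      case 3
      then show ?thesis using hs H(3) by auto
    qed
  qed
  obtain c0 where c0: "c0 \<in> C" using assms(4) by blast
  \<comment> \<open>If the line through \<open>x\<close> in direction \<open>c0\<close> missed
    \<open>H\<close>, it would split into two disjoint nonempty open pieces \<open>A\<close> and
    \<open>B\<close>, against connectedness of the real line.\<close>
  have ex: "\<exists>s. x - s *\<^sub>R c0 \<in> H" for x
  proof (rule ccontr)
    assume no: "\<not> ?thesis"
    define A where "A = {s. x - s *\<^sub>R c0 \<in> P}"
    define B where "B = {s. s *\<^sub>R c0 - x \<in> P}"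
    have "open A"
      unfolding open_dist
    proof
      fix s assume "s \<in> A"
      then obtain e where "e > 0" "\<And>t. \<bar>t\<bar> < e \<Longrightarrow> (x - s *\<^sub>R c0) + t *\<^sub>R c0 \<in> P"
        using Popen[of "x - s *\<^sub>R c0" c0] unfolding A_def by blast
      moreover have "(x - s *\<^sub>R c0) + (s - t) *\<^sub>R c0 = x - t *\<^sub>R c0" for t by (simp add: scaleR_diff_left)
      ultimately have "t \<in> A" if "dist t s < e" for t
        using that unfolding A_def dist_real_def by (metis abs_minus_commute mem_Collect_eq)
      then show "\<exists>e>0. \<forall>y. dist y s < e \<longrightarrow> y \<in> A" using \<open>e > 0\<close> by blast
    qed
    moreover have "open B"
      unfolding open_dist
    proof
      fix s assume "s \<in> B"
      then obtain e where "e > 0" "\<And>t. \<bar>t\<bar> < e \<Longrightarrow> (s *\<^sub>R c0 - x) + t *\<^sub>R c0 \<in> P"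
        using Popen[of "s *\<^sub>R c0 - x" c0] unfolding B_def by blast
      moreover have "(s *\<^sub>R c0 - x) + (t - s) *\<^sub>R c0 = t *\<^sub>R c0 - x" for t by (simp add: scaleR_diff_left)
      ultimately have "t \<in> B" if "dist t s < e" for t
        using that unfolding B_def dist_real_def by (metis mem_Collect_eq)
      then show "\<exists>e>0. \<forall>y. dist y s < e \<longrightarrow> y \<in> B" using \<open>e > 0\<close> by blast
    qed
    moreover have "A \<inter> B = {}"
    proof -
      have False if "s \<in> A" "s \<in> B" for s
        using Padd[of "x - s *\<^sub>R c0" "s *\<^sub>R c0 - x"] PH[of 0] that H(1) by (auto simp: A_def B_def subspace_0)
      then show ?thesis by blast
    qed
    moreover have "A \<union> B = UNIV"
      using no total[of "x - _ *\<^sub>R c0"] by (auto simp: A_def B_def)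
    \<comment> \<open>Openness of \<open>P\<close> at \<open>c0\<close> in direction
      \<open>x\<close> allows a step of length \<open>e / 2\<close> both ways; scaling by
      \<open>2 / e\<close> normalises the coefficient of \<open>x\<close>.\<close>
    moreover have "A \<noteq> {}" "B \<noteq> {}"
    proof -
      obtain e where e: "e > 0" "\<And>s. \<bar>s\<bar> < e \<Longrightarrow> c0 + s *\<^sub>R x \<in> P"
        using Popen[OF CP[OF c0], of x] by blast
      have "(2/e) *\<^sub>R (c0 + (e/2) *\<^sub>R x) \<in> P" "(2/e) *\<^sub>R (c0 + (- e/2) *\<^sub>R x) \<in> P"
        using e(1) by (intro Pscale e(2); simp)+
      moreover have "(2/e) *\<^sub>R (c0 + (e/2) *\<^sub>R x) = x - (- 2/e) *\<^sub>R c0"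
        "(2/e) *\<^sub>R (c0 + (- e/2) *\<^sub>R x) = (2/e) *\<^sub>R c0 - x"
        using e(1) by (simp_all add: scaleR_add_right scaleR_diff_right)
      ultimately have "- 2/e \<in> A" "2/e \<in> B" by (auto simp: A_def B_def)
      then show "A \<noteq> {}" "B \<noteq> {}" by auto
    qed
    ultimately show False
      using connectedD[OF connected_UNIV, of A B] by auto
  qed
  \<comment> \<open>\<open>f x\<close> is the coordinate along \<open>c0\<close> modulo
    \<open>H\<close>; it is unique because no nonzero multiple of \<open>c0\<close> lies in
    \<open>H\<close>.\<close>
  define f where "f x = (SOME s. x - s *\<^sub>R c0 \<in> H)" for x
  have f: "x - f x *\<^sub>R c0 \<in> H" for x unfolding f_def by (rule someI_ex[OF ex])
  have c0H: "s = 0" if "s *\<^sub>R c0 \<in> H" for s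
  proof (rule ccontr)
    assume "s \<noteq> 0"
    then have "c0 = (1/s) *\<^sub>R (s *\<^sub>R c0)" by simp
    then have "c0 \<in> H" using that H(1) by (metis subspace_scale)
    then show False using c0 H(3) by blast
  qed
  have fu: "f x = s" if "x - s *\<^sub>R c0 \<in> H" for x s
  proof -
    have "(x - s *\<^sub>R c0) - (x - f x *\<^sub>R c0) \<in> H" using that f H(1) by (metis subspace_diff)
    then have "(f x - s) *\<^sub>R c0 \<in> H" by (simp add: scaleR_diff_left)
    then show ?thesis using c0H by fastforce
  qed
  have "linear f"
  proof (rule linearI)
    fix x y
    have "(x - f x *\<^sub>R c0) + (y - f y *\<^sub>R c0) \<in> H" using f H(1) subspace_add by blast
    then show "f (x + y) = f x + f y" by (intro fu) (simp add: scaleR_add_left algebra_simps)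
  next
    fix r x
    have "r *\<^sub>R (x - f x *\<^sub>R c0) \<in> H" using f H(1) subspace_scale by blast
    then show "f (r *\<^sub>R x) = r *\<^sub>R f x" by (intro fu) (simp add: scaleR_diff_right)
  qed
  moreover have "f x = 0" if "x \<in> L" for x using that H(2) by (intro fu) auto
  moreover have "0 < f x" if "x \<in> C" for x
  proof (rule ccontr)
    assume "\<not> 0 < f x"
    then consider "f x = 0" | "0 < - f x" by linarith
    then have "x - f x *\<^sub>R c0 \<in> P"
    proof cases
      case 1 then show ?thesis using CP[OF that] by simp
    next
      case 2
      have "x + (- f x) *\<^sub>R c0 \<in> P" by (intro Padd CP that Pscale c0 2)
      then show ?thesis by simp
    qed
    then show False using PH f by blast
  qed
  ultimately show ?thesis using that by blast
qed

lemma lookup_scaleR: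
  "Poly_Mapping.lookup (c *\<^sub>R x) i = c *\<^sub>R Poly_Mapping.lookup (x :: ('a, 'b::real_vector) poly_mapping) i"
proof -
  have "finite {i. c *\<^sub>R Poly_Mapping.lookup x i \<noteq> 0}"
    by (rule finite_subset[OF _ finite_keys[of x]]) (auto simp: in_keys_iff)
  then show ?thesis by (simp add: scaleR_poly_mapping_def Abs_poly_mapping_inverse)
qed

text \<open>Separation in a power of \<open>D\<close>, realised in the space of finitely supported
  sequences. \<open>C\<close> and \<open>L\<close> constrain the coordinates below \<open>N\<close>
  and leave the others free; the vectors \<open>y j\<close> are read off from the functional on
  sequences with a single nonzero entry.\<close>

lemma separate_product_from_subspace:
  fixes D :: "'a::euclidean_space set" and c :: "nat \<Rightarrow> 'a" and W :: "(nat \<Rightarrow> 'a) set"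
  assumes "open D" "convex D" "D \<noteq> {}"
    and W0: "(\<lambda>_. 0) \<in> W" and Wadd: "\<And>x y. x \<in> W \<Longrightarrow> y \<in> W \<Longrightarrow> (\<lambda>j. x j + y j) \<in> W"
    and Wscale: "\<And>x r. x \<in> W \<Longrightarrow> (\<lambda>j. r *\<^sub>R x j) \<in> W"
    and disj: "\<And>x. x \<in> W \<Longrightarrow> \<exists>j<N. c j + x j \<notin> D"
  obtains y :: "nat \<Rightarrow> 'a" where
    "\<And>z. (\<And>j. j < N \<Longrightarrow> z j \<in> D) \<Longrightarrow> (\<Sum>j<N. inner (z j - c j) (y j)) < 0"
    "\<And>x. x \<in> W \<Longrightarrow> (\<Sum>j<N. inner (x j) (y j)) = 0"
proof -
  let ?E = "\<lambda>x :: nat \<Rightarrow> 'a. (\<Sum>j<N. Poly_Mapping.single j (x j))"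
  have lk: "Poly_Mapping.lookup (?E x) j = x j" if "j < N" for x j
  proof -
    have "Poly_Mapping.lookup (?E x) j = (\<Sum>i<N. if i = j then x i else 0)"
      unfolding lookup_sum by (intro sum.cong) (auto simp: lookup_single when_def)
    then show ?thesis using that by (simp add: sum.delta)
  qed
  define C where "C = {x. \<forall>j<N. c j + Poly_Mapping.lookup x j \<in> D}"
  define L where "L = {x. \<exists>v\<in>W. \<forall>j<N. Poly_Mapping.lookup x j = v j}"
  have "subspace L"
  proof (rule subspaceI)
    show "0 \<in> L" using W0 by (auto simp: L_def)
    show "x + y \<in> L" if xy: "x \<in> L" "y \<in> L" for x y
    proof -
      obtain v v' where "v \<in> W" "\<forall>j<N. Poly_Mapping.lookup x j = v j" "v' \<in> W"
        "\<forall>j<N. Poly_Mapping.lookup y j = v' j" using xy by (auto simp: L_def)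
      then show ?thesis using Wadd[of v v'] by (auto simp: L_def lookup_add)
    qed
    show "r *\<^sub>R x \<in> L" if x: "x \<in> L" for r x
    proof -
      obtain v where "v \<in> W" "\<forall>j<N. Poly_Mapping.lookup x j = v j" using x by (auto simp: L_def)
      then show ?thesis using Wscale[of v r] by (auto simp: L_def lookup_scaleR)
    qed
  qed
  moreover have "L \<inter> C = {}" using disj by (fastforce simp: L_def C_def)
  moreover have "convex C"
  proof (rule convexI)
    fix x y :: "(nat, 'a) poly_mapping" and u v :: real
    assume xy: "x \<in> C" "y \<in> C" and uv: "0 \<le> u" "0 \<le> v" "u + v = 1"
    have "c j + Poly_Mapping.lookup (u *\<^sub>R x + v *\<^sub>R y) j \<in> D" if "j < N" for j
    proof -
      have "c j = u *\<^sub>R c j + v *\<^sub>R c j" using uv by (simp flip: scaleR_add_left)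
      then have "c j + Poly_Mapping.lookup (u *\<^sub>R x + v *\<^sub>R y) j =
         u *\<^sub>R (c j + Poly_Mapping.lookup x j) + v *\<^sub>R (c j + Poly_Mapping.lookup y j)"
        by (simp add: lookup_add lookup_scaleR scaleR_add_right algebra_simps)
      also have "\<dots> \<in> D" using xy uv that by (intro convexD[OF assms(2)]) (auto simp: C_def)
      finally show ?thesis .
    qed
    then show "u *\<^sub>R x + v *\<^sub>R y \<in> C" by (simp add: C_def)
  qed
  moreover have "C \<noteq> {}"
  proof -
    obtain d where "d \<in> D" using assms(3) by blast
    then have "?E (\<lambda>j. d - c j) \<in> C" by (simp add: C_def lk)
    then show ?thesis by blast
  qed
  moreover have "\<exists>e>0. \<forall>s. \<bar>s\<bar> < e \<longrightarrow> x + s *\<^sub>R y \<in> C" if x: "x \<in> C" for x y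
  proof -
    have "\<exists>e>0. \<forall>s. \<bar>s\<bar> < e \<longrightarrow> c j + Poly_Mapping.lookup (x + s *\<^sub>R y) j \<in> D" if "j < N" for j
    proof -
      have "((\<lambda>s. c j + (Poly_Mapping.lookup x j + s *\<^sub>R Poly_Mapping.lookup y j)) \<longlongrightarrow>
          c j + (Poly_Mapping.lookup x j + 0 *\<^sub>R Poly_Mapping.lookup y j)) (nhds 0)"
        by (intro tendsto_intros filterlim_ident)
      then have "\<forall>\<^sub>F s in nhds 0. c j + (Poly_Mapping.lookup x j + s *\<^sub>R Poly_Mapping.lookup y j) \<in> D"
        using x that by (intro topological_tendstoD assms(1)) (auto simp: C_def)
      then show ?thesis
        unfolding eventually_nhds_metric by (auto simp: dist_real_def lookup_add lookup_scaleR)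
    qed
    then obtain e where e: "\<And>j. j < N \<Longrightarrow> e j > 0 \<and> (\<forall>s. \<bar>s\<bar> < e j \<longrightarrow> c j + Poly_Mapping.lookup (x + s *\<^sub>R y) j \<in> D)"
      by metis
    have "Min (insert 1 (e ` {..<N})) > 0" using e by auto
    moreover have "x + s *\<^sub>R y \<in> C" if "\<bar>s\<bar> < Min (insert 1 (e ` {..<N}))" for s
      using that e by (auto simp: C_def)
    ultimately show ?thesis by blast
  qed
  ultimately obtain f :: "((nat, 'a) poly_mapping) \<Rightarrow> real" where f: "linear f"
    "\<And>x. x \<in> L \<Longrightarrow> f x = 0" "\<And>x. x \<in> C \<Longrightarrow> 0 < f x"
    using separate_algebraically_open_convex[of L C] by metis
  \<comment> \<open>The minus sign makes the pairing negative on displacements into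
    \<open>D\<close>, so that \<open>y\<close> bounds \<open>D\<close> from above.\<close>
  define y where "y j = - (\<Sum>b\<in>Basis. f (Poly_Mapping.single j b) *\<^sub>R b)" for j
  have single: "f (Poly_Mapping.single j v) = - inner v (y j)" for j v
  proof -
    have "linear (\<lambda>v. f (Poly_Mapping.single j v))"
    proof (rule linearI)
      show "f (Poly_Mapping.single j (a + b)) = f (Poly_Mapping.single j a) + f (Poly_Mapping.single j b)" for a b
        by (simp add: single_add linear_add[OF f(1)])
      have sc: "Poly_Mapping.single j (r *\<^sub>R b) = r *\<^sub>R Poly_Mapping.single j b" for r b
        by (rule poly_mapping_eqI) (simp add: lookup_scaleR lookup_single when_def)
      show "f (Poly_Mapping.single j (r *\<^sub>R b)) = r *\<^sub>R f (Poly_Mapping.single j b)" for r b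
        unfolding sc by (rule linear_scale[OF f(1)])
    qed
    from linear_sum[OF this, of "\<lambda>b. inner v b *\<^sub>R b" Basis] linear_scale[OF this]
    have "f (Poly_Mapping.single j (\<Sum>b\<in>Basis. inner v b *\<^sub>R b)) = (\<Sum>b\<in>Basis. inner v b * f (Poly_Mapping.single j b))"
      by simp
    then show ?thesis by (simp add: euclidean_representation y_def inner_sum_right mult.commute)
  qed
  have fE: "f (?E x) = - (\<Sum>j<N. inner (x j) (y j))" for x
    by (simp add: linear_sum[OF f(1)] single sum_negf)
  show ?thesis
  proof (rule that[of y])
    fix z assume "\<And>j. j < N \<Longrightarrow> z j \<in> D"
    then have "?E (\<lambda>j. z j - c j) \<in> C" by (simp add: C_def lk)
    from f(3)[OF this] show "(\<Sum>j<N. inner (z j - c j) (y j)) < 0" unfolding fE by simp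
  next
    fix x assume "x \<in> W"
    then have "?E x \<in> L" by (auto simp: L_def lk)
    from f(2)[OF this] show "(\<Sum>j<N. inner (x j) (y j)) = 0" unfolding fE by simp
  qed
qed

subsection \<open>Lower bounds for the Azukawa metric\<close>

text \<open>The pairing is bilinear, not Hermitian, so that \<open>dot (z - w) y\<close> is
  holomorphic in \<open>z\<close>.\<close>

definition dot :: "complex ^ 'n \<Rightarrow> complex ^ 'n \<Rightarrow> complex" where
  "dot v y = (\<Sum>i\<in>UNIV. v $ i * y $ i)"

lemma dot_add: "dot (a + b) y = dot a y + dot b y"
  and dot_diff: "dot (a - b) y = dot a y - dot b y"
  and dot_smult: "dot (c *s a) y = c * dot a y"
  and dot_scaleR: "dot (r *\<^sub>R a) y = of_real r * dot a y"
  and dot_zero [simp]: "dot 0 y = 0"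
  and dot_smult_right: "dot a (c *s y) = c * dot a y"
  by (simp_all add: dot_def algebra_simps sum.distrib sum_subtractf sum_distrib_left
      scaleR_conv_of_real[where 'a = complex])

lemma dot_sum_right: "dot a (\<Sum>j\<in>J. y j) = (\<Sum>j\<in>J. dot a (y j))"
  unfolding dot_def sum_component sum_distrib_left by (rule sum.swap)

lemma norm_dot_le: "norm (dot v y) \<le> norm v * (\<Sum>i\<in>UNIV. norm (y $ i))"
proof -
  have "norm (dot v y) \<le> (\<Sum>i\<in>UNIV. norm (v $ i) * norm (y $ i))"
    unfolding dot_def by (rule order_trans[OF norm_sum]) (simp add: norm_mult)
  also have "\<dots> \<le> (\<Sum>i\<in>UNIV. norm v * norm (y $ i))"
    by (intro sum_mono mult_right_mono Finite_Cartesian_Product.norm_nth_le) auto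
  finally show ?thesis by (simp add: sum_distrib_left)
qed

lemma continuous_on_dot [continuous_intros]:
  "continuous_on S f \<Longrightarrow> continuous_on S (\<lambda>x. dot (f x) y)"
  unfolding dot_def by (intro continuous_intros)

section \<open>Logarithms of affine functions as plurisubharmonic functions\<close>

lemma ennreal_ln_less_iff:
  "0 \<le> x \<Longrightarrow> ennreal_ln (ennreal x) < ereal c \<longleftrightarrow> x < exp c"
  by (cases "x = 0") (auto simp: ennreal_ln_def ln_less_cancel_iff[of x "exp c", simplified])

lemma ennreal_ln_less_infty: "ennreal_ln (ennreal x) < \<infinity>"
  by (auto simp: ennreal_ln_def)

lemma usc_on_ennreal_ln:
  assumes "continuous_on D (g :: 'a::topological_space \<Rightarrow> real)" "\<And>z. 0 \<le> g z"
  shows "usc_on D (\<lambda>z. ennreal_ln (ennreal (g z)))"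
  unfolding usc_on_def
proof
  fix c :: ereal
  show "openin (top_of_set D) {z \<in> D. ennreal_ln (ennreal (g z)) < c}"
  proof (cases c)
    case (real r)
    have "openin (top_of_set D) (D \<inter> g -` {..<exp r})"
      using assms by (intro continuous_openin_preimage_gen) auto
    moreover have "D \<inter> g -` {..<exp r} = {z \<in> D. ennreal_ln (ennreal (g z)) < c}"
      using ennreal_ln_less_iff[OF assms(2)] by (auto simp: real)
    ultimately show ?thesis by simp
  next
    case PInf
    then show ?thesis using ennreal_ln_less_infty by (simp add: less_top)
  next
    case MInf
    then show ?thesis by simp
  qed
qed

lemma ereal_ln_max_tendsto:
  assumes "0 \<le> (x::real)"
  shows "(\<lambda>n. ereal (ln (max x (1 / real (Suc n))) + h)) \<longlonglongrightarrow> ennreal_ln (ennreal (x * exp h))"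
proof (cases "x = 0")
  case True
  have "filterlim (\<lambda>n. ln (1 / real (Suc n)) + h) at_bot sequentially"
    by real_asymp
  then have "(\<lambda>n. ereal (ln (1 / real (Suc n)) + h)) \<longlonglongrightarrow> - \<infinity>"
    by (simp add: tendsto_MInfty filterlim_at_bot_dense)
  then show ?thesis using True by (simp add: ennreal_ln_def max_def)
next
  case False
  then have x: "x > 0" using assms by simp
  have "(\<lambda>n. 1 / real (Suc n)) \<longlonglongrightarrow> 0" by real_asymp
  then have "(\<lambda>n. ln (max x (1 / real (Suc n))) + h) \<longlonglongrightarrow> ln (max x 0) + h"
    using x by (intro tendsto_intros) auto
  then show ?thesis using x by (simp add: ennreal_ln_ennreal ln_mult_pos)
qed

text \<open>On a circle in a line the function is \<open>ln (norm (A + B * cis t)) + h t\<close>.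
  Its mean is estimated for the truncations at \<open>1 / real (Suc n)\<close> and then passed to
  the limit, which also covers circles through a zero of the affine factor.\<close>

lemma psh_on_ln_norm_dot_minus_pluriharmonic:
  fixes D :: "(complex ^ 'n) set"
  assumes "open D" and contH: "continuous_on D H"
    and harm: "\<And>a X c r. 0 < r \<Longrightarrow> (\<And>l. l \<in> cball c r \<Longrightarrow> a + l *s X \<in> D) \<Longrightarrow>
      ((\<lambda>t. H (a + (c + of_real r * cis t) *s X)) has_integral 2 * pi * H (a + c *s X)) {0..2*pi}"
  shows "psh_on D (\<lambda>z. ennreal_ln (ennreal (norm (dot (z - w) \<eta>) * exp (- H z))))"
    (is "psh_on D ?u")
proof -
  have uscu: "usc_on D ?u"
    by (intro usc_on_ennreal_ln continuous_intros contH) auto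
  have "subharmonic_on {l. a + l *s X \<in> D} (\<lambda>l. ?u (a + l *s X))" for a X
    unfolding subharmonic_on_def
  proof (intro conjI ballI allI impI)
    have cl: "continuous_on S (\<lambda>l. a + l *s X)" for S by (intro continuous_intros)
    show "usc_on {l. a + l *s X \<in> D} (\<lambda>l. ?u (a + l *s X))"
      by (intro usc_on_ennreal_ln continuous_intros continuous_on_compose2[OF contH cl]) auto
    show "?u (a + z *s X) < \<infinity>" for z by (rule ennreal_ln_less_infty)
    fix c r assume "0 < r \<and> cball c r \<subseteq> {l. a + l *s X \<in> D}"
    then have r: "0 < r" and sub: "\<And>l. l \<in> cball c r \<Longrightarrow> a + l *s X \<in> D" by auto
    define A where "A = dot (a + c *s X - w) \<eta>"
    define B where "B = of_real r * dot X \<eta>"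
    define h where "h t = - H (a + (c + of_real r * cis t) *s X)" for t
    have AB: "dot (a + (c + of_real r * cis t) *s X - w) \<eta> = A + B * cis t" for t
      by (simp add: A_def B_def dot_add dot_diff dot_smult algebra_simps)
    have inD: "a + (c + of_real r * cis t) *s X \<in> D" for t
      using r by (intro sub) (auto simp: dist_norm norm_mult)
    have conth: "continuous_on {0..2*pi} h"
      unfolding h_def by (rule continuous_on_minus, rule continuous_on_compose2[OF contH])
        (auto intro!: continuous_intros inD[simplified])
    have inth: "(h has_integral - (2 * pi * H (a + c *s X))) {0..2*pi}"
      unfolding h_def using harm[OF r sub] by (rule has_integral_neg)
    show "?u (a + c *s X) \<le> ereal (1 / (2 * pi)) *
        ereal_integral circ (\<lambda>t. ?u (a + (c + of_real r * cis t) *s X))"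
    proof (cases "A = 0")
      case True
      then show ?thesis by (simp add: A_def ennreal_ln_def)
    next
      case False
      have contln: "continuous_on {0..2*pi} (\<lambda>t. ln (max (norm (A + B * cis t)) (1 / real (Suc n))))" for n
        by (intro continuous_intros) (auto simp: max_def)
      have "ereal (2 * pi * (ln (norm A) - H (a + c *s X))) \<le>
          ereal_integral circ (\<lambda>t. ?u (a + (c + of_real r * cis t) *s X))"
      proof (rule circ_ereal_integral_limit[where F = "\<lambda>n t. ln (max (norm (A + B * cis t)) (1 / real (Suc n))) + h t"])
        show "continuous_on {0..2 * pi} (\<lambda>t. ln (max (norm (A + B * cis t)) (1 / real (Suc n))) + h t)" for n
          by (intro continuous_intros conth contln)
        show "ln (max (norm (A + B * cis t)) (1 / real (Suc (Suc n)))) + h t \<le>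
           ln (max (norm (A + B * cis t)) (1 / real (Suc n))) + h t" for n t
          by (intro add_right_mono ln_mono max.mono) (auto simp: field_simps max_def)
        show "(\<lambda>n. ereal (ln (max (norm (A + B * cis t)) (1 / real (Suc n))) + h t)) \<longlonglongrightarrow>
            ?u (a + (c + of_real r * cis t) *s X)" for t
          using ereal_ln_max_tendsto[of "norm (A + B * cis t)" "h t"]
          by (simp only: AB h_def norm_ge_zero)
        show "2 * pi * (ln (norm A) - H (a + c *s X)) \<le>
           integral {0..2 * pi} (\<lambda>t. ln (max (norm (A + B * cis t)) (1 / real (Suc n))) + h t)" for n
        proof -
          have "integral {0..2 * pi} (\<lambda>t. ln (max (norm (A + B * cis t)) (1 / real (Suc n))) + h t) =
              integral {0..2 * pi} (\<lambda>t. ln (max (norm (A + B * cis t)) (1 / real (Suc n)))) - 2 * pi * H (a + c *s X)"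
            unfolding integral_add[OF integrable_continuous_real[OF contln] has_integral_integrable[OF inth]]
              integral_unique[OF inth] by simp
          moreover have "2 * pi * ln (norm A) \<le> integral {0..2 * pi} (\<lambda>t. ln (max (norm (A + B * cis t)) (1 / real (Suc n))))"
            by (rule ln_norm_le_circle_mean_trunc[OF False]) auto
          ultimately show ?thesis by (simp add: right_diff_distrib)
        qed
      qed
      then have "ereal (1 / (2 * pi)) * ereal (2 * pi * (ln (norm A) - H (a + c *s X))) \<le>
          ereal (1 / (2 * pi)) * ereal_integral circ (\<lambda>t. ?u (a + (c + of_real r * cis t) *s X))"
        by (intro ereal_mult_left_mono) auto
      moreover have "?u (a + c *s X) = ereal (ln (norm A) - H (a + c *s X))"
        using False by (simp add: A_def[symmetric] ennreal_ln_ennreal ln_mult_pos)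
      ultimately show ?thesis by simp
    qed
  qed
  then show ?thesis
    unfolding psh_on_def using uscu ennreal_ln_less_infty by blast
qed

text \<open>At \<open>z = w\<close> the polynomial reduces to
  \<open>\<zeta> * poly S \<zeta>\<close>, so the competitor \<open>ln (norm (P z 0)) - H z\<close>
  has its pole at \<open>w\<close>. Its limit in direction \<open>X\<close> is explicit: the slope
  is \<open>dot X (\<eta> 0)\<close>, and \<open>H w\<close> is the logarithmic mean of
  \<open>S\<close>, equal to \<open>ln (norm (poly S 0))\<close> because \<open>S\<close> has no
  zero in the closed disc.\<close>

lemma azukawa_ge_certificate:
  fixes D :: "(complex ^ 'n) set" and w :: "complex ^ 'n" and K :: nat and S :: "complex poly" and \<eta> :: "nat \<Rightarrow> complex ^ 'n"
  defines "P \<equiv> \<lambda>z \<zeta>. \<zeta> * poly S \<zeta> - (\<Sum>m\<le>K. dot (z - w) (\<eta> m) * \<zeta> ^ m)"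
  assumes "open D" "w \<in> D" "0 < \<delta>"
    and pos: "\<And>z \<zeta>. z \<in> D \<Longrightarrow> norm \<zeta> = 1 \<Longrightarrow> \<delta> \<le> Re (P z \<zeta> * cnj \<zeta>)"
    and X: "dot X (\<eta> 0) \<noteq> 0"
  shows "ennreal (norm (dot X (\<eta> 0)) / norm (poly S 0)) \<le> azukawa D w X"
proof -
  have nz: "P z \<zeta> \<noteq> 0" if "z \<in> D" "norm \<zeta> = 1" for z \<zeta>
    using pos[OF that] \<open>0 < \<delta>\<close> by auto
  define \<Phi> where "\<Phi> z t = ln (norm (P z (cis t)))" for z t
  define H where "H z = integral {0..2*pi} (\<Phi> z) / (2 * pi)" for z
  have cont2: "continuous_on T (\<lambda>x. \<Phi> (f x) (g x))"
    if "continuous_on T f" "continuous_on T g" "f ` T \<subseteq> D" for T :: "'b::topological_space set" and f g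
    unfolding \<Phi>_def P_def using that nz[unfolded P_def]
    by (intro continuous_intros) (auto simp: image_subset_iff)
  have contH: "continuous_on D H"
    unfolding H_def
    using integral_continuous_on_param[of D 0 "2*pi" \<Phi>] cont2[of "D \<times> {0..2*pi}" fst snd]
    by (intro continuous_intros) (auto simp: split_beta' continuous_intros)
  have harm: "((\<lambda>t. H (a + (c + of_real r * cis t) *s Y)) has_integral 2 * pi * H (a + c *s Y)) {0..2*pi}"
    if r: "0 < r" and sub: "\<And>l. l \<in> cball c r \<Longrightarrow> a + l *s Y \<in> D" for a Y c r
  proof -
    define \<Omega> where "\<Omega> = {l. a + l *s Y \<in> D}"
    have "open \<Omega>" unfolding \<Omega>_def
      using continuous_on_open_vimage[of UNIV "\<lambda>l. a + l *s Y"] assms(2)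
      by (auto simp: continuous_intros vimage_def)
    have inD: "a + (c + of_real r * cis t) *s Y \<in> D" for t
      using r by (intro sub) (auto simp: dist_norm norm_mult)
    have inner: "((\<lambda>t. \<Phi> (a + (c + of_real r * cis t) *s Y) s) has_integral 2 * pi * \<Phi> (a + c *s Y) s) {0..2*pi}" for s
    proof -
      \<comment> \<open>The factor \<open>cnj (cis s)\<close> moves the values into the right
        half-plane, where the principal logarithm is holomorphic, and leaves the modulus
        unchanged.\<close>
      define f where "f l = Ln (P (a + l *s Y) (cis s) * cnj (cis s))" for l
      have fpos: "P (a + l *s Y) (cis s) * cnj (cis s) \<notin> \<real>\<^sub>\<le>\<^sub>0" if "l \<in> \<Omega>" for l
        using pos[of "a + l *s Y" "cis s"] that \<open>0 < \<delta>\<close> by (auto simp: \<Omega>_def complex_nonpos_Reals_iff)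
      have lin: "dot (a + l *s Y - w) y = dot (a - w) y + l * dot Y y" for l y
        by (simp add: dot_add dot_diff dot_smult)
      have "f holomorphic_on \<Omega>"
        unfolding f_def using fpos unfolding P_def lin by (intro holomorphic_intros) auto
      from circle_mean_Re[OF \<open>open \<Omega>\<close> this _ r, of c]
      have "((\<lambda>t. Re (f (c + of_real r * cis t))) has_integral 2 * pi * Re (f c)) {0..2*pi}"
        using sub by (auto simp: \<Omega>_def subset_iff)
      moreover have "Re (f l) = \<Phi> (a + l *s Y) s" if "l \<in> \<Omega>" for l
        using nz[of "a + l *s Y" "cis s"] that by (simp add: f_def \<Phi>_def \<Omega>_def norm_mult)
      moreover have "c + of_real r * cis t \<in> \<Omega>" "c \<in> \<Omega>" for t
        using inD sub[of c] r by (auto simp: \<Omega>_def)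
      ultimately show ?thesis by simp
    qed
    \<comment> \<open>Exchanging the two circle integrals carries the mean value property from
      \<open>\<Phi>\<close> at each fixed parameter \<open>s\<close> over to the average
      \<open>H\<close>.\<close>
    have cont: "continuous_on (cbox (0, 0) (2*pi, 2*pi)) (\<lambda>(t, s). \<Phi> (a + (c + of_real r * cis t) *s Y) s)"
      unfolding split_beta' by (rule cont2) (auto intro!: continuous_intros inD[simplified])
    have "integral {0..2*pi} (\<lambda>t. integral {0..2*pi} (\<Phi> (a + (c + of_real r * cis t) *s Y))) =
        integral {0..2*pi} (\<lambda>s. integral {0..2*pi} (\<lambda>t. \<Phi> (a + (c + of_real r * cis t) *s Y) s))"
      using integral_swap_continuous[OF cont] by (simp add: cbox_interval)
    also have "\<dots> = 2 * pi * integral {0..2*pi} (\<Phi> (a + c *s Y))"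
      unfolding integral_unique[OF inner] by simp
    finally have val: "integral {0..2*pi} (\<lambda>t. H (a + (c + of_real r * cis t) *s Y)) = 2 * pi * H (a + c *s Y)"
      by (simp add: H_def)
    have "continuous_on {0..2*pi} (\<lambda>t. H (a + (c + of_real r * cis t) *s Y))"
      by (rule continuous_on_compose2[OF contH]) (auto intro!: continuous_intros inD[simplified])
    then show ?thesis using val by (metis integrable_continuous_real integrable_integral)
  qed
  \<comment> \<open>The constant coefficient of \<open>P z\<close> is
    \<open>- dot (z - w) (\<eta> 0)\<close>; bounding it by the logarithmic mean makes the
    competitor nonpositive.\<close>
  have jensen: "norm (dot (z - w) (\<eta> 0)) \<le> exp (H z)" if z: "z \<in> D" for z
  proof (cases "dot (z - w) (\<eta> 0) = 0")
    case False
    define p where "p = pCons 0 S - (\<Sum>m\<le>K. monom (dot (z - w) (\<eta> m)) m)"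
    have p: "poly p \<zeta> = P z \<zeta>" for \<zeta>
      by (simp add: p_def P_def poly_sum poly_monom)
    have "(\<Sum>m\<le>K. dot (z - w) (\<eta> m) * 0 ^ m) = dot (z - w) (\<eta> 0)"
      by (subst sum.remove[of _ 0]) (auto simp: power_0_left)
    then have p0: "poly p 0 = - dot (z - w) (\<eta> 0)" unfolding p P_def by simp
    have "2 * pi * ln (norm (- dot (z - w) (\<eta> 0))) \<le> integral {0..2*pi} (\<lambda>t. ln (norm (poly p (cis t))))"
      unfolding p0[symmetric] by (rule ln_norm_poly_0_le_circle_mean) (use nz[OF z] False p0 in \<open>auto simp: p\<close>)
    then have "ln (norm (dot (z - w) (\<eta> 0))) \<le> H z"
      unfolding p by (simp add: H_def \<Phi>_def[abs_def] field_simps)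
    then show ?thesis using False by (metis exp_le_cancel_iff exp_ln zero_less_norm_iff)
  qed auto
  have ReS: "\<delta> \<le> Re (poly S \<zeta>)" if "norm \<zeta> = 1" for \<zeta>
  proof -
    have "P w \<zeta> * cnj \<zeta> = poly S \<zeta> * (\<zeta> * cnj \<zeta>)" by (simp add: P_def algebra_simps)
    also have "\<zeta> * cnj \<zeta> = 1" using that by (simp add: complex_norm_square[symmetric])
    finally show ?thesis using pos[OF assms(3) that] by simp
  qed
  \<comment> \<open>The maximum principle carries positivity from the circle into the disc, so
    \<open>S\<close> is free of zeros there and Jensen's inequality becomes an equality for
    \<open>P w\<close>.\<close>
  have ReS': "\<delta> \<le> Re (poly S \<zeta>)" if "norm \<zeta> \<le> 1" for \<zeta>
  proof -
    have "Re (- poly S \<zeta>) \<le> - \<delta>"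
      by (rule maximum_real_frontier[of _ "cball 0 1"])
        (use that ReS in \<open>auto intro!: holomorphic_intros continuous_intros simp: sphere_def dist_norm\<close>)
    then show ?thesis by simp
  qed
  have Hw: "H w = ln (norm (poly S 0))"
  proof -
    define T where "T = {\<zeta>. 0 < Re (poly S \<zeta>)}"
    have "open T" unfolding T_def by (intro open_Collect_less continuous_intros)
    have "(\<lambda>\<zeta>. Ln (poly S \<zeta>)) holomorphic_on T"
      by (intro holomorphic_intros) (auto simp: T_def complex_nonpos_Reals_iff)
    moreover have "cball 0 1 \<subseteq> T" using ReS' \<open>0 < \<delta>\<close> by (force simp: T_def)
    ultimately have "((\<lambda>t. Re (Ln (poly S (0 + of_real 1 * cis t)))) has_integral 2 * pi * Re (Ln (poly S 0))) {0..2*pi}"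
      by (intro circle_mean_Re[OF \<open>open T\<close>]) auto
    moreover have "poly S \<zeta> \<noteq> 0" if "norm \<zeta> \<le> 1" for \<zeta> using ReS'[OF that] \<open>0 < \<delta>\<close> by auto
    ultimately have "((\<lambda>t. ln (norm (poly S (cis t)))) has_integral 2 * pi * ln (norm (poly S 0))) {0..2*pi}"
      by simp
    moreover have "\<Phi> w = (\<lambda>t. ln (norm (poly S (cis t))))"
      by (simp add: \<Phi>_def P_def norm_mult fun_eq_iff)
    ultimately show ?thesis by (simp add: H_def integral_unique)
  qed
  have S0: "poly S 0 \<noteq> 0" using ReS'[of 0] \<open>0 < \<delta>\<close> by auto
  \<comment> \<open>Jensen gives only a nonpositive function. Subtracting \<open>e\<close> makes it
    strictly negative, as the family requires; \<open>e\<close> tends to 0 at the end.\<close>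
  have main: "ennreal (exp (ln (norm (dot X (\<eta> 0))) - H w - e)) \<le> azukawa D w X" if e: "0 < e" for e
  proof -
    define u where "u z = ennreal_ln (ennreal (norm (dot (z - w) (\<eta> 0)) * exp (- (H z + e))))" for z
    have "psh_on D u"
      unfolding u_def
    proof (rule psh_on_ln_norm_dot_minus_pluriharmonic[OF assms(2)])
      show "continuous_on D (\<lambda>z. H z + e)" by (intro continuous_intros contH)
      fix a Y :: "complex ^ 'n" and c r
      assume "0 < r" "\<And>l. l \<in> cball c r \<Longrightarrow> a + l *s Y \<in> D"
      from has_integral_add[OF harm[OF this] has_integral_const_real[of e 0 "2*pi"]]
      show "((\<lambda>t. H (a + (c + of_real r * cis t) *s Y) + e) has_integral 2 * pi * (H (a + c *s Y) + e)) {0..2*pi}"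
        by (simp add: distrib_left)
    qed
    moreover have "u z < 0" if "z \<in> D" for z
    proof -
      have "norm (dot (z - w) (\<eta> 0)) * exp (- (H z + e)) \<le> exp (H z) * exp (- (H z + e))"
        by (intro mult_right_mono jensen that) auto
      also have "\<dots> < 1" using e by (simp flip: exp_add)
      finally show ?thesis unfolding u_def zero_ereal_def by (subst ennreal_ln_less_iff) auto
    qed
    moreover have "\<exists>C::real. \<forall>\<^sub>F z in nhds w. u z \<le> ennreal_ln (ennreal (norm (z - w))) + ereal C"
    proof -
      define B where "B = (\<Sum>i\<in>UNIV. norm (\<eta> 0 $ i)) + 1"
      have "B > 0" unfolding B_def by (intro add_nonneg_pos sum_nonneg) auto
      have "isCont H w" using contH assms(2,3) by (simp add: continuous_on_eq_continuous_at)
      then have "(H \<longlongrightarrow> H w) (nhds w)" by (simp add: isCont_def tendsto_nhds_iff)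
      then have "\<forall>\<^sub>F z in nhds w. H w - 1 < H z" by (intro order_tendstoD) auto
      then have "\<forall>\<^sub>F z in nhds w. u z \<le> ennreal_ln (ennreal (norm (z - w))) + ereal (ln B - (H w - 1 + e))"
      proof eventually_elim
        case (elim z)
        show ?case
        proof (cases "z = w")
          case False
          have "norm (dot (z - w) (\<eta> 0)) \<le> norm (z - w) * B"
            using norm_dot_le[of "z - w" "\<eta> 0"] by (simp add: B_def distrib_left add_increasing2)
          then have "norm (dot (z - w) (\<eta> 0)) * exp (- (H z + e)) \<le> (norm (z - w) * B) * exp (- (H w - 1 + e))"
            using elim \<open>B > 0\<close> by (intro mult_mono) auto
          then have "u z \<le> ereal (ln ((norm (z - w) * B) * exp (- (H w - 1 + e))))"
            unfolding u_def using False \<open>B > 0\<close> by (intro ennreal_ln_le_ereal_ln) auto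
          also have "\<dots> = ennreal_ln (ennreal (norm (z - w))) + ereal (ln B - (H w - 1 + e))"
            using False \<open>B > 0\<close> by (simp add: ennreal_ln_ennreal ln_mult_pos)
          finally show ?thesis .
        qed (simp add: u_def ennreal_ln_def)
      qed
      then show ?thesis by blast
    qed
    ultimately have ufam: "u \<in> green_family D w" by (auto simp: green_family_def)
    define v where "v l = ln (norm (dot X (\<eta> 0))) - (H (w + l *s X) + e)" for l
    have "isCont H w" using contH assms(2,3) by (simp add: continuous_on_eq_continuous_at)
    moreover have "((\<lambda>l. w + l *s X) \<longlongrightarrow> w) (at 0)"
    proof -
      have "continuous_on UNIV (\<lambda>l. w + l *s X)" by (intro continuous_intros)
      then have "isCont (\<lambda>l. w + l *s X) 0" by (simp add: continuous_on_eq_continuous_at)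
      then show ?thesis by (simp add: isCont_def)
    qed
    ultimately have "((\<lambda>l. H (w + l *s X)) \<longlongrightarrow> H w) (at 0)"
      by (rule isCont_tendsto_compose)
    then have "((\<lambda>l. ereal (v l)) \<longlongrightarrow> ereal (ln (norm (dot X (\<eta> 0))) - (H w + e))) (at 0)"
      unfolding v_def by (intro tendsto_intros)
    then have "ereal (ln (norm (dot X (\<eta> 0))) - (H w + e)) = Limsup (at 0) (\<lambda>l. ereal (v l))"
      by (rule lim_imp_Limsup[OF at_neq_bot, symmetric])
    also have "\<dots> \<le> Limsup (at 0) (\<lambda>l. green D (w + l *s X) w - ereal (ln (norm l)))"
    proof (rule Limsup_mono)
      show "\<forall>\<^sub>F l in at 0. ereal (v l) \<le> green D (w + l *s X) w - ereal (ln (norm l))"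
      proof (rule eventually_mono[OF eventually_neq_at_within[of 0]])
        fix l :: complex assume l: "l \<noteq> 0"
        have "u (w + l *s X) = ereal (v l + ln (norm l))"
          using l X by (simp add: u_def v_def dot_smult norm_mult ennreal_ln_ennreal ln_mult_pos)
        moreover have "u (w + l *s X) \<le> green D (w + l *s X) w"
          unfolding green_def using ufam by (rule SUP_upper)
        ultimately show "ereal (v l) \<le> green D (w + l *s X) w - ereal (ln (norm l))"
          by (cases "green D (w + l *s X) w") auto
      qed
    qed
    finally have "ereal_exp (ereal (ln (norm (dot X (\<eta> 0))) - (H w + e))) \<le> azukawa D w X"
      unfolding azukawa_def by (rule ereal_exp_mono)
    then show ?thesis by (simp add: ereal_exp_def diff_diff_eq)
  qed
  have "((\<lambda>e. ennreal (exp (ln (norm (dot X (\<eta> 0))) - H w - e))) \<longlongrightarrow>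
     ennreal (exp (ln (norm (dot X (\<eta> 0))) - H w - 0))) (at_right 0)"
    by (intro tendsto_intros)
  then have "ennreal (exp (ln (norm (dot X (\<eta> 0))) - H w - 0)) \<le> azukawa D w X"
    by (rule tendsto_upperbound) (use main in \<open>auto intro!: eventually_at_rightI[of 0 1]\<close>)
  moreover have "exp (ln (norm (dot X (\<eta> 0))) - H w - 0) = norm (dot X (\<eta> 0)) / norm (poly S 0)"
    using X S0 by (simp add: Hw exp_diff)
  ultimately show ?thesis by simp
qed

section \<open>Certificates from infeasible pairs\<close>

definition vec_cnj :: "complex ^ 'n \<Rightarrow> complex ^ 'n" where
  "vec_cnj y = (\<chi> i. cnj (y $ i))"

lemma inner_eq_Re_dot: "inner v y = Re (dot v (vec_cnj y))"
  by (simp add: inner_complex_vec dot_def vec_cnj_def inner_commute[of v] mult.commute)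

text \<open>Dual to \<open>fejer_kernel_smoothing\<close>: orthogonality to the frequencies from 2
  to \<open>M\<close> removes every negative power of \<open>\<zeta>\<close> on the circle except
  the first, so that multiplication by \<open>\<zeta>\<close> leaves a polynomial.\<close>

lemma fejer_kernel_dual_smoothing:
  fixes d :: "nat \<Rightarrow> complex"
  assumes "1 \<le> M" "norm \<zeta> = 1"
    and orth: "\<And>k. k \<in> {2..M} \<Longrightarrow> (\<Sum>j<N. Z j ^ k * d j) = 0"
  shows "(\<Sum>j<N. of_real (fejer_kernel M (\<zeta> * cnj (Z j))) * d j) =
    of_real (fejer M 1) * cnj \<zeta> * (\<Sum>j<N. Z j * d j) +
    (\<Sum>m\<le>M. of_real (fejer M m) * \<zeta> ^ m * (\<Sum>j<N. cnj (Z j) ^ m * d j))"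
proof -
  let ?c = "\<lambda>m. complex_of_real (fejer M m)"
  have "(\<Sum>j<N. of_real (fejer_kernel M (\<zeta> * cnj (Z j))) * d j) =
     (\<Sum>j<N. d j + (\<Sum>m=1..M. ?c m * \<zeta> ^ m * (cnj (Z j) ^ m * d j)) +
       (\<Sum>m=1..M. ?c m * cnj \<zeta> ^ m * (Z j ^ m * d j)))"
    unfolding fejer_kernel_expand distrib_right[of 1] mult_1_left sum_distrib_right add.assoc sum.distrib[symmetric]
    by (intro arg_cong2[where f = "(+)"] sum.cong refl) (simp add: algebra_simps power_mult_distrib)
  also have "\<dots> = (\<Sum>j<N. d j) + (\<Sum>m=1..M. ?c m * \<zeta> ^ m * (\<Sum>j<N. cnj (Z j) ^ m * d j)) +
      (\<Sum>m=1..M. ?c m * cnj \<zeta> ^ m * (\<Sum>j<N. Z j ^ m * d j))"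
    unfolding sum.distrib sum_distrib_left
    by (subst (1 2) sum.swap) simp
  also have "(\<Sum>m=1..M. ?c m * cnj \<zeta> ^ m * (\<Sum>j<N. Z j ^ m * d j)) = ?c 1 * cnj \<zeta> * (\<Sum>j<N. Z j * d j)"
  proof -
    have "{1..M} = insert 1 {2..M}" using assms(1) by auto
    moreover have "(\<Sum>m=2..M. ?c m * cnj \<zeta> ^ m * (\<Sum>j<N. Z j ^ m * d j)) = 0"
      using orth by (intro sum.neutral) simp
    ultimately show ?thesis by simp
  qed
  also have "(\<Sum>j<N. d j) + (\<Sum>m=1..M. ?c m * \<zeta> ^ m * (\<Sum>j<N. cnj (Z j) ^ m * d j)) =
     (\<Sum>m\<le>M. ?c m * \<zeta> ^ m * (\<Sum>j<N. cnj (Z j) ^ m * d j))"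
  proof -
    have "{..M} = insert 0 {1..M}" by auto
    then show ?thesis by simp
  qed
  finally show ?thesis by (simp add: add.commute)
qed

text \<open>The points \<open>z j\<close> vary independently, so near-maximisers can be chosen
  coordinate by coordinate; errors of \<open>e / (real N + 1)\<close> add up to at most
  \<open>e\<close>.\<close>

lemma sum_Sup_le_of_sum_le:
  fixes g :: "nat \<Rightarrow> 'a \<Rightarrow> real"
  assumes "D \<noteq> {}" "\<And>z. (\<And>j. j < N \<Longrightarrow> z j \<in> D) \<Longrightarrow> (\<Sum>j<N. g j (z j)) \<le> T"
    and bdd: "\<And>j. j < N \<Longrightarrow> bdd_above (g j ` D)"
  shows "(\<Sum>j<N. SUP z\<in>D. g j z) \<le> T"
proof (rule field_le_epsilon)
  fix e :: real assume "0 < e"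
  have "\<exists>z\<in>D. (SUP z\<in>D. g j z) - e / (real N + 1) < g j z" if "j < N" for j
    using less_cSUP_iff[OF assms(1) bdd[OF that], of "(SUP z\<in>D. g j z) - e / (real N + 1)"] \<open>0 < e\<close>
    by simp
  then obtain z where z: "\<And>j. j < N \<Longrightarrow> z j \<in> D \<and> (SUP z\<in>D. g j z) - e / (real N + 1) < g j (z j)"
    by metis
  have "(\<Sum>j<N. SUP z\<in>D. g j z) \<le> (\<Sum>j<N. g j (z j) + e / (real N + 1))"
    using z by (intro sum_mono) (force simp: algebra_simps)
  also have "\<dots> = (\<Sum>j<N. g j (z j)) + real N * (e / (real N + 1))" by (simp add: sum.distrib)
  also have "\<dots> \<le> T + e"
    using z assms(2)[of z] \<open>0 < e\<close> by (intro add_mono) (auto simp: field_simps)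
  finally show "(\<Sum>j<N. SUP z\<in>D. g j z) \<le> T + e" .
qed

text \<open>Separation yields vectors \<open>y j\<close> and the support values
  \<open>\<sigma> j\<close> of \<open>D\<close> seen from \<open>w\<close>, whose sum is at most
  \<open>T\<close>, the value of the functional on the linear term. The certificate is built from
  the same Fejer averages of \<open>\<sigma> j\<close> and of \<open>inner (z - w) (y j)\<close>, so
  its positivity reduces to \<open>inner (z - w) (y j) \<le> \<sigma> j\<close>. In the resulting
  quotient \<open>T\<close> cancels and \<open>fejer M 1 / s\<close> remains.\<close>

lemma infeasible_imp_azukawa_ge:
  fixes D :: "(complex ^ 'n) set"
  assumes "open D" "convex D" "w \<in> D" "1 \<le> M" "0 < s" and inf: "\<not> feasible D M w (s *\<^sub>R X)"
  shows "ennreal (fejer M 1 / s) \<le> azukawa D w X"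
proof -
  define N where "N = 2 * M + 1"
  have N: "N > 0" by (simp add: N_def)
  define Z where "Z = unity_root N"
  have normZ [simp]: "norm (Z j) = 1" for j by (simp add: Z_def)
  define Y where "Y = s *\<^sub>R X"
  \<comment> \<open>The free higher coefficients sweep out the subspace \<open>W\<close>;
    infeasibility says that its translate by the fixed affine part of the disc misses the
    \<open>N\<close>-fold power of \<open>D\<close>.\<close>
  define W :: "(nat \<Rightarrow> complex ^ 'n) set" where "W = {x. \<exists>a. x = (\<lambda>j. \<Sum>k=2..M. Z j ^ k *s a k)}"
  obtain y where y1: "\<And>z. (\<And>j. j < N \<Longrightarrow> z j \<in> D) \<Longrightarrow> (\<Sum>j<N. inner (z j - (w + Z j *s Y)) (y j)) < 0"
    and y2: "\<And>x. x \<in> W \<Longrightarrow> (\<Sum>j<N. inner (x j) (y j)) = 0"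
  proof (rule separate_product_from_subspace[OF assms(1,2), of W N "\<lambda>j. w + Z j *s Y"])
    show "D \<noteq> {}" using assms(3) by auto
    show "(\<lambda>_. 0) \<in> W" unfolding W_def by (intro CollectI exI[of _ "\<lambda>_. 0"]) simp
    show "(\<lambda>j. x j + x' j) \<in> W" if xx: "x \<in> W" "x' \<in> W" for x x'
    proof -
      obtain a a' where "x = (\<lambda>j. \<Sum>k=2..M. Z j ^ k *s a k)" "x' = (\<lambda>j. \<Sum>k=2..M. Z j ^ k *s a' k)"
        using xx by (auto simp: W_def)
      then have "(\<lambda>j. x j + x' j) = (\<lambda>j. \<Sum>k=2..M. Z j ^ k *s (a k + a' k))"
        by (simp add: sum.distrib vector_add_ldistrib)
      then show ?thesis unfolding W_def by (intro CollectI exI[of _ "\<lambda>k. a k + a' k"])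
    qed
    show "(\<lambda>j. r *\<^sub>R x j) \<in> W" if x: "x \<in> W" for x r
    proof -
      obtain a where "x = (\<lambda>j. \<Sum>k=2..M. Z j ^ k *s a k)" using x by (auto simp: W_def)
      then have "(\<lambda>j. r *\<^sub>R x j) = (\<lambda>j. \<Sum>k=2..M. Z j ^ k *s (r *\<^sub>R a k))"
        by (simp add: scaleR_sum_right vec_eq_iff fun_eq_iff)
      then show ?thesis unfolding W_def by (intro CollectI exI[of _ "\<lambda>k. r *\<^sub>R a k"])
    qed
    show "\<exists>j<N. w + Z j *s Y + x j \<notin> D" if x: "x \<in> W" for x
    proof -
      obtain a where "x = (\<lambda>j. \<Sum>k=2..M. Z j ^ k *s a k)" using x by (auto simp: W_def)
      then show ?thesis using inf unfolding feasible_def N_def[symmetric] Z_def[symmetric] Y_def by auto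
    qed
  qed blast
  define T where "T = (\<Sum>j<N. inner (Z j *s Y) (y j))"
  have y1': "(\<Sum>j<N. inner (z j - w) (y j)) < T" if "\<And>j. j < N \<Longrightarrow> z j \<in> D" for z
    using y1[OF that] by (simp add: T_def sum_subtractf inner_diff_left inner_add_left sum.distrib algebra_simps)
  have "T > 0" using y1'[of "\<lambda>_. w"] assms(3) by simp
  \<comment> \<open>All coordinates except \<open>j\<close> are set to \<open>w\<close>, where the
    inner products vanish.\<close>
  have bdd: "bdd_above ((\<lambda>z. inner (z - w) (y j)) ` D)" if "j < N" for j
  proof (rule bdd_aboveI2)
    fix z assume "z \<in> D"
    then have "(\<Sum>i<N. inner ((if i = j then z else w) - w) (y i)) < T" using assms(3) by (intro y1') auto
    also have "(\<Sum>i<N. inner ((if i = j then z else w) - w) (y i)) = (\<Sum>i<N. if i = j then inner (z - w) (y i) else 0)"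
      by (intro sum.cong) auto
    finally show "inner (z - w) (y j) \<le> T" using that by (simp add: sum.delta)
  qed
  define \<sigma> where "\<sigma> j = (SUP z\<in>D. inner (z - w) (y j))" for j
  have \<sigma>: "inner (z - w) (y j) \<le> \<sigma> j" if "j < N" "z \<in> D" for z j
    unfolding \<sigma>_def by (rule cSUP_upper[OF that(2) bdd[OF that(1)]])
  have \<sigma>0: "0 \<le> \<sigma> j" if "j < N" for j using \<sigma>[OF that assms(3)] by simp
  have sum\<sigma>: "(\<Sum>j<N. \<sigma> j) \<le> T"
    unfolding \<sigma>_def using assms(3) y1' bdd by (intro sum_Sup_le_of_sum_le) (auto intro: less_imp_le)
  define y' where "y' j = vec_cnj (y j)" for j
  \<comment> \<open>\<open>W\<close> is stable under multiplication by \<open>\<i>\<close>: the real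
    identity for \<open>v\<close> kills the real part, and the one for \<open>\<i> *s v\<close>
    kills the imaginary part.\<close>
  have orth: "(\<Sum>j<N. Z j ^ k * dot v (y' j)) = 0" if k: "k \<in> {2..M}" for k v
  proof -
    have re: "Re (\<Sum>j<N. Z j ^ k * dot v (y' j)) = 0" for v
    proof -
      have "(\<lambda>j. Z j ^ k *s v) \<in> W"
        unfolding W_def
      proof (intro CollectI exI[of _ "\<lambda>l. if l = k then v else 0"] ext)
        fix j
        have "(\<Sum>l=2..M. Z j ^ l *s (if l = k then v else 0)) = (\<Sum>l=2..M. if l = k then Z j ^ l *s v else 0)"
          by (intro sum.cong) auto
        then show "Z j ^ k *s v = (\<Sum>l=2..M. Z j ^ l *s (if l = k then v else 0))"
          using k by (simp add: sum.delta)
      qed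
      from y2[OF this] show ?thesis by (simp add: inner_eq_Re_dot dot_smult y'_def)
    qed
    have "Re (\<Sum>j<N. Z j ^ k * dot (\<i> *s v) (y' j)) = - Im (\<Sum>j<N. Z j ^ k * dot v (y' j))"
      by (simp add: dot_smult Im_sum sum_negf[symmetric])
    then show ?thesis using re[of v] re[of "\<i> *s v"] by (simp add: complex_eq_iff)
  qed
  define c where "c m = complex_of_real (fejer M m)" for m
  \<comment> \<open>Multiplication by \<open>\<zeta>\<close> shifts the indices:
    \<open>\<eta> 0\<close> belongs to the term in \<open>cnj \<zeta>\<close>, and
    \<open>\<eta> (Suc m)\<close> to the term in \<open>\<zeta> ^ m\<close>.\<close>
  define \<eta> where "\<eta> m = (if m = 0 then (c 1 / of_nat N) *s (\<Sum>j<N. Z j *s y' j)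
      else (c (m - 1) / of_nat N) *s (\<Sum>j<N. cnj (Z j) ^ (m - 1) *s y' j))" for m
  have f1: "0 < fejer M 1" using assms(4) by (simp add: fejer_def)
  have dotX: "fejer M 1 * T / real N / s \<le> norm (dot X (\<eta> 0))"
  proof -
    have "dot Y (\<eta> 0) = c 1 / of_nat N * (\<Sum>j<N. dot (Z j *s Y) (y' j))"
      by (simp add: \<eta>_def dot_smult_right dot_sum_right dot_smult)
    moreover have "Re (\<Sum>j<N. dot (Z j *s Y) (y' j)) = T"
      by (simp add: T_def inner_eq_Re_dot y'_def)
    ultimately have "Re (dot Y (\<eta> 0)) = fejer M 1 * T / real N"
      by (simp add: c_def)
    then have "fejer M 1 * T / real N \<le> norm (dot Y (\<eta> 0))" by (metis complex_Re_le_cmod)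
    also have "\<dots> = norm (dot X (\<eta> 0)) * s" using assms(5) by (simp add: Y_def dot_scaleR norm_mult)
    finally show ?thesis unfolding pos_divide_le_eq[OF assms(5)] .
  qed
  have dpos: "0 < fejer M 1 * T / real N / s" using f1 \<open>T > 0\<close> N assms(5) by simp
  have main: "ennreal (fejer M 1 / s / (1 + e)) \<le> azukawa D w X" if e: "0 < e" for e
  proof -
    \<comment> \<open>The margin of the certificate is taken as the fraction \<open>e\<close> of
      \<open>T / real N\<close>, so that it costs only the factor \<open>1 + e\<close>.\<close>
    define \<delta> where "\<delta> = e * T / real N"
    have "\<delta> > 0" using e \<open>T > 0\<close> N by (simp add: \<delta>_def)
    \<comment> \<open>The analytic completion of the Fejer average of the \<open>\<sigma> j\<close>:
      each bracket has real part \<open>fejer_kernel M (\<zeta> * cnj (Z j))\<close> and takes the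
      value 1 at 0.\<close>
    define S where "S = [:of_real \<delta>:] + (\<Sum>j<N. smult (of_real (\<sigma> j) / of_nat N)
        (1 + (\<Sum>m=1..M. monom (2 * c m * cnj (Z j) ^ m) m)))"
    have pS: "poly S \<zeta> = of_real \<delta> + (\<Sum>j<N. of_real (\<sigma> j) / of_nat N * (1 + 2 * (\<Sum>m=1..M. c m * (\<zeta> * cnj (Z j)) ^ m)))" for \<zeta>
      by (simp add: S_def poly_sum poly_monom power_mult_distrib sum_distrib_left algebra_simps)
    have ReS: "Re (poly S \<zeta>) = \<delta> + (\<Sum>j<N. \<sigma> j / real N * fejer_kernel M (\<zeta> * cnj (Z j)))" for \<zeta>
    proof -
      have summand: "Re (of_real (\<sigma> j) / of_nat N * (1 + 2 * (\<Sum>m=1..M. c m * (\<zeta> * cnj (Z j)) ^ m))) =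
         \<sigma> j / real N * fejer_kernel M (\<zeta> * cnj (Z j))" for j
      proof -
        have 1: "of_real (\<sigma> j) / of_nat N = complex_of_real (\<sigma> j / real N)" by simp
        have 2: "Re (of_real r * x) = r * Re x" for r x by simp
        have 3: "Re (1 + 2 * (\<Sum>m=1..M. c m * (\<zeta> * cnj (Z j)) ^ m)) = fejer_kernel M (\<zeta> * cnj (Z j))"
          by (simp add: fejer_kernel_def c_def)
        show ?thesis unfolding 1 2 3 ..
      qed
      show ?thesis unfolding pS plus_complex.sel Re_sum summand by simp
    qed
    have S0: "norm (poly S 0) \<le> (1 + e) * T / real N"
    proof -
      have "poly S 0 = of_real (\<delta> + (\<Sum>j<N. \<sigma> j) / real N)"
        unfolding pS by (simp add: power_0_left sum_divide_distrib)
      moreover have "0 \<le> (\<Sum>j<N. \<sigma> j) / real N"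
        using \<sigma>0 by (intro divide_nonneg_nonneg sum_nonneg) auto
      ultimately have "norm (poly S 0) = \<delta> + (\<Sum>j<N. \<sigma> j) / real N"
        using \<open>\<delta> > 0\<close> by (simp del: of_real_add of_real_divide)
      also have "\<dots> \<le> \<delta> + T / real N" using sum\<sigma> by (intro add_left_mono divide_right_mono) auto
      finally show ?thesis by (simp add: \<delta>_def add_divide_distrib distrib_right)
    qed
    have "ennreal (norm (dot X (\<eta> 0)) / norm (poly S 0)) \<le> azukawa D w X"
    proof (rule azukawa_ge_certificate[OF assms(1,3) \<open>\<delta> > 0\<close>, where K = "Suc M"])
      show "dot X (\<eta> 0) \<noteq> 0" using dotX dpos by auto
      fix z \<zeta> assume z: "z \<in> D" and \<zeta>: "norm (\<zeta>::complex) = 1"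
      have \<zeta>1: "\<zeta> * cnj \<zeta> = 1" using \<zeta> by (simp add: complex_norm_square[symmetric])
      define d where "d j = dot (z - w) (y' j)" for j
      define g where "g j = fejer_kernel M (\<zeta> * cnj (Z j))" for j
      have g0: "0 \<le> g j" for j
        unfolding g_def fejer_kernel_def using \<zeta> by (intro fejer_kernel_nonneg) (simp add: norm_mult)
      have \<eta>0: "dot (z - w) (\<eta> 0) = c 1 / of_nat N * (\<Sum>j<N. Z j * d j)"
        by (simp add: \<eta>_def dot_smult_right dot_sum_right d_def)
      have \<eta>S: "dot (z - w) (\<eta> (Suc m)) = c m / of_nat N * (\<Sum>j<N. cnj (Z j) ^ m * d j)" for m
        by (simp add: \<eta>_def dot_smult_right dot_sum_right d_def)
      have "(\<Sum>m\<le>Suc M. dot (z - w) (\<eta> m) * \<zeta> ^ m) * cnj \<zeta> =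
        dot (z - w) (\<eta> 0) * cnj \<zeta> + (\<Sum>m\<le>M. dot (z - w) (\<eta> (Suc m)) * \<zeta> ^ m * (\<zeta> * cnj \<zeta>))"
        unfolding sum.atMost_Suc_shift distrib_right sum_distrib_right
        by (intro arg_cong2[where f = "(+)"] sum.cong refl) (simp_all add: algebra_simps)
      also have "\<dots> = (c 1 * cnj \<zeta> * (\<Sum>j<N. Z j * d j) + (\<Sum>m\<le>M. c m * \<zeta> ^ m * (\<Sum>j<N. cnj (Z j) ^ m * d j))) / of_nat N"
        unfolding \<zeta>1 \<eta>0 \<eta>S add_divide_distrib sum_divide_distrib
        by (intro arg_cong2[where f = "(+)"] sum.cong refl) (simp_all add: algebra_simps sum_divide_distrib)
      also have "\<dots> = (\<Sum>j<N. of_real (g j) * d j) / of_nat N"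
        unfolding g_def c_def
        by (subst fejer_kernel_dual_smoothing[OF assms(4) \<zeta>]) (use orth in \<open>auto simp: d_def\<close>)
      finally have sumd: "(\<Sum>m\<le>Suc M. dot (z - w) (\<eta> m) * \<zeta> ^ m) * cnj \<zeta> = (\<Sum>j<N. of_real (g j) * d j) / of_nat N" .
      have alg: "(\<zeta> * a - b) * cnj \<zeta> = a * (\<zeta> * cnj \<zeta>) - b * cnj \<zeta>" for a b
        by (simp add: algebra_simps)
      have eq: "Re ((\<zeta> * poly S \<zeta> - (\<Sum>m\<le>Suc M. dot (z - w) (\<eta> m) * \<zeta> ^ m)) * cnj \<zeta>) =
         Re (poly S \<zeta>) - Re ((\<Sum>j<N. of_real (g j) * d j) / of_nat N)"
        unfolding alg sumd \<zeta>1 by simp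
      have "Re ((\<Sum>j<N. of_real (g j) * d j) / of_nat N) = (\<Sum>j<N. inner (z - w) (y j) / real N * g j)"
        by (simp add: inner_eq_Re_dot d_def y'_def sum_divide_distrib mult.commute)
      also have "\<dots> \<le> (\<Sum>j<N. \<sigma> j / real N * g j)"
        using \<sigma> z g0 by (intro sum_mono mult_right_mono divide_right_mono) auto
      finally show "\<delta> \<le> Re ((\<zeta> * poly S \<zeta> - (\<Sum>m\<le>Suc M. dot (z - w) (\<eta> m) * \<zeta> ^ m)) * cnj \<zeta>)"
        unfolding eq ReS g_def[symmetric] by simp
    qed
    moreover have "fejer M 1 / s / (1 + e) \<le> norm (dot X (\<eta> 0)) / norm (poly S 0)"
    proof -
      have "poly S 0 \<noteq> 0"
      proof
        assume "poly S 0 = 0"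
        then have "Re (poly S 0) = 0" by simp
        moreover have "0 \<le> \<sigma> j / real N * fejer_kernel M (0 * cnj (Z j))" if "j < N" for j
          using \<sigma>0[OF that] unfolding fejer_kernel_def
          by (intro mult_nonneg_nonneg divide_nonneg_nonneg fejer_kernel_nonneg) auto
        then have "0 \<le> (\<Sum>j<N. \<sigma> j / real N * fejer_kernel M (0 * cnj (Z j)))"
          by (intro sum_nonneg) auto
        ultimately show False unfolding ReS using \<open>\<delta> > 0\<close> by linarith
      qed
      have "fejer M 1 / s / (1 + e) = (fejer M 1 * T / real N / s) / ((1 + e) * T / real N)"
      proof -
        have "f / s / k = (f * T / n / s) / (k * T / n)" if "0 < n" for f k n :: real
          using that \<open>T > 0\<close> by (simp add: field_simps)
        then show ?thesis using \<open>T > 0\<close> N by simp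
      qed
      also have "\<dots> \<le> norm (dot X (\<eta> 0)) / norm (poly S 0)"
        using dotX S0 dpos \<open>poly S 0 \<noteq> 0\<close> by (intro frac_le) auto
      finally show ?thesis .
    qed
    ultimately show ?thesis by (meson ennreal_leI order_trans)
  qed
  have "((\<lambda>e. ennreal (fejer M 1 / s / (1 + e))) \<longlongrightarrow> ennreal (fejer M 1 / s / (1 + 0))) (at_right 0)"
    by (intro tendsto_intros) auto
  then have "ennreal (fejer M 1 / s / (1 + 0)) \<le> azukawa D w X"
    by (rule tendsto_upperbound) (use main in \<open>auto intro!: eventually_at_rightI[of 0 1]\<close>)
  then show ?thesis by simp
qed

section \<open>Geometry of the indicatrices\<close>

lemma feasible_convex_combination:
  fixes D :: "(complex ^ 'n) set"
  assumes "convex D" "feasible D M w0 X0" "feasible D M w1 X1" "0 \<le> t" "t \<le> 1"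
  shows "feasible D M ((1 - t) *\<^sub>R w0 + t *\<^sub>R w1) ((1 - t) *\<^sub>R X0 + t *\<^sub>R X1)"
proof -
  let ?Z = "unity_root (2*M+1)"
  obtain a b where a: "\<And>j. j < 2*M+1 \<Longrightarrow> w0 + ?Z j *s X0 + (\<Sum>k=2..M. ?Z j ^ k *s a k) \<in> D"
    and b: "\<And>j. j < 2*M+1 \<Longrightarrow> w1 + ?Z j *s X1 + (\<Sum>k=2..M. ?Z j ^ k *s b k) \<in> D"
    using assms(2,3) unfolding feasible_def by blast
  have "((1 - t) *\<^sub>R w0 + t *\<^sub>R w1) + ?Z j *s ((1 - t) *\<^sub>R X0 + t *\<^sub>R X1) +
      (\<Sum>k=2..M. ?Z j ^ k *s ((1 - t) *\<^sub>R a k + t *\<^sub>R b k)) \<in> D" if "j < 2*M+1" for j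
  proof -
    have re: "(p1 + q1) + (p2 + q2) + (p3 + q3) = (p1 + p2 + p3) + (q1 + q2 + q3)"
      for p1 p2 p3 q1 q2 q3 :: "complex ^ 'n" by (simp add: algebra_simps)
    have sc: "c *s (r *\<^sub>R v) = r *\<^sub>R (c *s v)" for c r and v :: "complex ^ 'n" by (simp add: vec_eq_iff)
    have "((1 - t) *\<^sub>R w0 + t *\<^sub>R w1) + ?Z j *s ((1 - t) *\<^sub>R X0 + t *\<^sub>R X1) +
      (\<Sum>k=2..M. ?Z j ^ k *s ((1 - t) *\<^sub>R a k + t *\<^sub>R b k)) =
      (1 - t) *\<^sub>R (w0 + ?Z j *s X0 + (\<Sum>k=2..M. ?Z j ^ k *s a k)) +
      t *\<^sub>R (w1 + ?Z j *s X1 + (\<Sum>k=2..M. ?Z j ^ k *s b k))"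
      unfolding vector_add_ldistrib sc scaleR_add_right scaleR_sum_right sum.distrib by (rule re)
    also have "\<dots> \<in> D" using a[OF that] b[OF that] assms(4,5) by (intro convexD[OF assms(1)]) auto
    finally show ?thesis .
  qed
  then show ?thesis unfolding feasible_def by (intro exI[of _ "\<lambda>k. (1 - t) *\<^sub>R a k + t *\<^sub>R b k"]) blast
qed

text \<open>Both bounds are used at one level \<open>M\<close>: points of the indicatrices stay
  feasible after enlarging them by \<open>s > 1\<close>, feasibility is convex, and
  \<open>s * fejer M 1 > 1\<close> brings the combination back below 1.\<close>

lemma azukawa_indicatrix_convex_combination:
  fixes D :: "(complex ^ 'n) set"
  assumes "open D" "convex D" "w0 \<in> D" "w1 \<in> D" "0 \<le> t" "t \<le> 1"
    and "X0 \<in> azukawa_indicatrix D w0" "X1 \<in> azukawa_indicatrix D w1"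
  shows "(1 - t) *\<^sub>R X0 + t *\<^sub>R X1 \<in> azukawa_indicatrix D ((1 - t) *\<^sub>R w0 + t *\<^sub>R w1)"
proof -
  have "max (azukawa D w0 X0) (azukawa D w1 X1) < 1"
    using assms(7,8) by (simp add: azukawa_indicatrix_def)
  then obtain r where r: "max (azukawa D w0 X0) (azukawa D w1 X1) < r" "r < 1" using dense by blast
  obtain q where q: "r = ennreal q" "0 \<le> q"
    using r(2) by (cases r) auto
  have "q < 1" using r(2) q by (simp add: ennreal_less_one_iff)
  \<comment> \<open>The maximum with \<open>1/2\<close> keeps \<open>p\<close> positive when
    \<open>q = 0\<close>. The square root in \<open>s\<close> divides the margin evenly between the
    two uses of the Fejer weight.\<close>
  define p where "p = max q (1/2)"
  have p: "0 < p" "p < 1" "q \<le> p" using \<open>q < 1\<close> by (auto simp: p_def)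
  define s where "s = 1 / sqrt p"
  have sp: "0 < sqrt p" "sqrt p < 1" using p by auto
  have "s > 1" using sp by (simp add: s_def)
  have s2: "1 / s * (1 / s) = p" using p by (simp add: s_def)
  obtain M :: nat where M: "1 / s < fejer M 1" "1 \<le> M"
  proof -
    have "(\<lambda>M. fejer M 1) \<longlonglongrightarrow> 1" unfolding fejer_def by real_asymp
    then have "\<forall>\<^sub>F M in sequentially. 1 / s < fejer M 1" using \<open>s > 1\<close> by (intro order_tendstoD) auto
    then have "\<forall>\<^sub>F M in sequentially. 1 / s < fejer M 1 \<and> 1 \<le> M"
      by (intro eventually_conj eventually_ge_at_top)
    then show ?thesis using eventually_happens'[OF sequentially_bot] that by blast
  qed
  have "p < fejer M 1 / s"
    using mult_strict_right_mono[OF M(1), of "1 / s"] \<open>s > 1\<close> unfolding s2 by simp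
  then have qle: "ennreal q \<le> ennreal (fejer M 1 / s)" using p by (intro ennreal_leI) simp
  have feas: "feasible D M w (s *\<^sub>R X)" if "w \<in> D" "azukawa D w X < r" for w X
  proof (rule ccontr)
    assume "\<not> ?thesis"
    with \<open>s > 1\<close> have "ennreal (fejer M 1 / s) \<le> azukawa D w X"
      by (intro infeasible_imp_azukawa_ge[OF assms(1,2) that(1) M(2)]) auto
    also have "\<dots> < ennreal q" using that(2) q(1) by simp
    also have "\<dots> \<le> ennreal (fejer M 1 / s)" by (rule qle)
    finally show False by simp
  qed
  have "feasible D M w0 (s *\<^sub>R X0)" "feasible D M w1 (s *\<^sub>R X1)"
    using feas r(1) assms(3,4) by auto
  from feasible_convex_combination[OF assms(2) this assms(5,6)]
  have "feasible D M ((1 - t) *\<^sub>R w0 + t *\<^sub>R w1) (s *\<^sub>R ((1 - t) *\<^sub>R X0 + t *\<^sub>R X1))"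
    by (simp add: scaleR_add_right mult.commute)
  then have "azukawa D ((1 - t) *\<^sub>R w0 + t *\<^sub>R w1) ((1 - t) *\<^sub>R X0 + t *\<^sub>R X1) \<le> ennreal (1 / (s * fejer M 1))"
    using \<open>s > 1\<close> by (intro feasible_imp_azukawa_le assms M) auto
  also have "\<dots> < 1"
  proof -
    have "1 < s * fejer M 1" using M(1) \<open>s > 1\<close> by (simp add: divide_less_eq mult.commute)
    then show ?thesis by (simp add: ennreal_less_one_iff)
  qed
  finally show ?thesis by (simp add: azukawa_indicatrix_def)
qed

lemma azukawa_indicatrix_contains_ball:
  fixes D :: "(complex ^ 'n) set"
  assumes "open D" "convex D" "w \<in> D"
  obtains r where "0 < r" "ball 0 r \<subseteq> azukawa_indicatrix D w"
proof -
  obtain e where e: "e > 0" "ball w e \<subseteq> D" using assms(1,3) openE by blast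
  have "X \<in> azukawa_indicatrix D w" if "norm X < e / 4" for X
  proof -
    \<comment> \<open>At level 1 there are no free coefficients, so only points of an affine disc
      are tested. The factor 4 compensates \<open>fejer 1 1 = 1/2\<close> and leaves the bound
      \<open>1/2\<close>.\<close>
    have "feasible D 1 w (4 *\<^sub>R X)"
      unfolding feasible_def
    proof (intro exI[of _ "\<lambda>_. 0"] allI impI)
      fix j :: nat
      have "norm (unity_root (2*1+1) j *s (4 *\<^sub>R X)) < e" using that by (simp add: norm_vector_smult)
      then have "w + unity_root (2*1+1) j *s (4 *\<^sub>R X) \<in> D" using e by (auto simp: dist_norm)
      then show "w + unity_root (2*1+1) j *s (4 *\<^sub>R X) + (\<Sum>k=2..1. unity_root (2*1+1) j ^ k *s 0) \<in> D" by simp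
    qed
    then have "azukawa D w X \<le> ennreal (1 / (4 * fejer 1 1))"
      by (intro feasible_imp_azukawa_le assms) auto
    also have "\<dots> < 1" unfolding ennreal_less_one_iff by (simp add: fejer_def)
    finally show ?thesis by (simp add: azukawa_indicatrix_def)
  qed
  then show ?thesis using that[of "e / 4"] e by (auto simp: subset_iff)
qed

subsection \<open>The multiplicative Brunn--Minkowski inequality\<close>

definition minkowski_mix :: "real \<Rightarrow> 'a::real_vector set \<Rightarrow> 'a set \<Rightarrow> 'a set" where
  "minkowski_mix t A B = {(1 - t) *\<^sub>R a + t *\<^sub>R b |a b. a \<in> A \<and> b \<in> B}"

lemma minkowski_mixI: "a \<in> A \<Longrightarrow> b \<in> B \<Longrightarrow> (1 - t) *\<^sub>R a + t *\<^sub>R b \<in> minkowski_mix t A B"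
  by (auto simp: minkowski_mix_def)

lemma minkowski_mix_mono: "A \<subseteq> A' \<Longrightarrow> B \<subseteq> B' \<Longrightarrow> minkowski_mix t A B \<subseteq> minkowski_mix t A' B'"
  by (auto simp: minkowski_mix_def)

lemma minkowski_mix_swap: "minkowski_mix (1 - t) B A = minkowski_mix t A B"
  unfolding minkowski_mix_def by (simp add: add.commute) blast

lemma open_minkowski_mix:
  fixes A B :: "'a::real_normed_vector set"
  assumes "open A" "t < 1"
  shows "open (minkowski_mix t A B)"
proof -
  have "minkowski_mix t A B = (\<Union>b\<in>B. (\<lambda>a. t *\<^sub>R b + a) ` ((\<lambda>a. (1 - t) *\<^sub>R a) ` A))"
    unfolding minkowski_mix_def image_image by (auto simp: add.commute)
  then show ?thesis using assms by (auto intro!: open_UN open_translation open_scaling)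
qed

lemma bounded_minkowski_mix:
  fixes A B :: "'a::real_normed_vector set"
  assumes "bounded A" "bounded B"
  shows "bounded (minkowski_mix t A B)"
proof -
  have "minkowski_mix t A B = (\<lambda>(x, y). x + y) ` (((\<lambda>a. (1 - t) *\<^sub>R a) ` A) \<times> ((\<lambda>b. t *\<^sub>R b) ` B))"
    by (force simp: minkowski_mix_def)
  then show ?thesis using assms by (simp add: bounded_plus bounded_scaling)
qed

section \<open>Boxes and families of boxes\<close>

text \<open>With bounds given as functions on the basis, cutting by a coordinate half-space is a
  function update.\<close>

definition fbox :: "('a::euclidean_space \<Rightarrow> real) \<Rightarrow> ('a \<Rightarrow> real) \<Rightarrow> 'a set" where
  "fbox a b = {x. \<forall>i\<in>Basis. a i < inner x i \<and> inner x i < b i}"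

lemma fbox_eq_box: "fbox a b = box (\<Sum>i\<in>Basis. a i *\<^sub>R i) (\<Sum>i\<in>Basis. b i *\<^sub>R i)"
  by (auto simp: fbox_def mem_box)

lemma box_eq_fbox: "box a b = fbox (inner a) (inner b)"
  by (auto simp: fbox_def mem_box)

lemma fbox_Int_greater:
  "i \<in> Basis \<Longrightarrow> fbox a b \<inter> {x. s < inner x i} = fbox (a(i := max (a i) s)) b"
  by (auto simp: fbox_def)

lemma fbox_Int_less:
  "i \<in> Basis \<Longrightarrow> fbox a b \<inter> {x. inner x i < s} = fbox a (b(i := min (b i) s))"
  by (auto simp: fbox_def)

lemma fbox_nonempty_iff: "fbox a b \<noteq> {} \<longleftrightarrow> (\<forall>i\<in>Basis. a i < b i)"
  unfolding fbox_eq_box by (auto simp: box_ne_empty)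

lemma measure_fbox:
  assumes "fbox a b \<noteq> {}"
  shows "measure lborel (fbox a b) = (\<Prod>i\<in>Basis. b i - a i)"
proof -
  have "\<forall>i\<in>Basis. a i < b i" using assms by (simp add: fbox_nonempty_iff)
  then show ?thesis unfolding fbox_eq_box measure_lborel_box_eq
    by (auto simp: inner_diff_left intro!: prod.cong less_imp_le)
qed

lemma open_bounded_fbox [simp, intro]: "open (fbox a b)" "bounded (fbox a b)"
  by (auto simp: fbox_eq_box)

definition box_family :: "'a::euclidean_space set set \<Rightarrow> bool" where
  "box_family \<A> \<longleftrightarrow> finite \<A> \<and> disjoint \<A> \<and> (\<forall>A\<in>\<A>. A \<noteq> {} \<and> (\<exists>a b. A = fbox a b))"

lemma box_family_Union:
  assumes "box_family \<A>"
  shows "open (\<Union>\<A>)" "bounded (\<Union>\<A>)"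
  using assms by (auto simp: box_family_def intro!: open_Union bounded_Union)

lemma measurable_open_bounded:
  fixes A :: "'a::euclidean_space set"
  assumes "open A" "bounded A"
  shows "A \<in> fmeasurable lborel"
  using emeasure_bounded_finite[OF assms(2)] assms(1)
  by (auto simp: fmeasurable_def infinity_ennreal_def)

lemma measure_open_pos:
  fixes X :: "'a::euclidean_space set"
  assumes "open X" "bounded X" "X \<noteq> {}"
  shows "0 < measure lborel X"
proof -
  have fm: "X \<in> fmeasurable lborel" using assms by (intro measurable_open_bounded)
  have "\<not> negligible X" using assms open_not_negligible by blast
  then have "emeasure lborel X \<noteq> 0"
    using assms(1) by (auto simp: negligible_iff_null_sets null_sets_def)
  then have "measure lborel X \<noteq> 0" using emeasure_eq_measure2[OF fm] by auto
  then show ?thesis using measure_nonneg[of lborel X] by linarith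
qed

lemma box_family_Int:
  assumes "box_family \<A>" and H: "\<And>a b. \<exists>a' b'. fbox a b \<inter> H = fbox a' b'"
  defines "\<A>' \<equiv> (\<lambda>A. A \<inter> H) ` {A\<in>\<A>. A \<inter> H \<noteq> {}}"
  shows "box_family \<A>'" "\<Union>\<A>' = \<Union>\<A> \<inter> H" "card \<A>' \<le> card {A\<in>\<A>. A \<inter> H \<noteq> {}}"
proof -
  show "card \<A>' \<le> card {A\<in>\<A>. A \<inter> H \<noteq> {}}"
    unfolding \<A>'_def using assms(1) by (intro card_image_le) (auto simp: box_family_def)
  show "\<Union>\<A>' = \<Union>\<A> \<inter> H" by (auto simp: \<A>'_def)
  have "disjoint \<A>'"
    using assms(1) unfolding \<A>'_def box_family_def disjoint_def by blast
  moreover have "\<exists>a' b'. A \<inter> H = fbox a' b'" if "A \<in> \<A>" for A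
    using assms(1) that H unfolding box_family_def by metis
  ultimately show "box_family \<A>'"
    using assms(1) unfolding box_family_def \<A>'_def by auto
qed

lemma measure_hyperplane_split:
  fixes A :: "'a::euclidean_space set"
  assumes "open A" "bounded A" "i \<in> Basis"
  shows "measure lborel A = measure lborel (A \<inter> {x. s < inner x i}) + measure lborel (A \<inter> {x. inner x i < s})"
proof -
  let ?P = "A \<inter> {x. s < inner x i}" and ?N = "A \<inter> {x. inner x i < s}" and ?H = "{x. inner i x = s}"
  have fm: "?P \<in> fmeasurable lborel" "?N \<in> fmeasurable lborel" "A \<in> fmeasurable lborel"
    using assms(1,2) by (auto intro!: measurable_open_bounded open_Int open_halfspace_component_gt
      open_halfspace_component_lt bounded_Int)
  have "negligible ?H" using assms(3) by (intro negligible_hyperplane) auto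
  then have H: "?H \<in> null_sets lborel"
    by (auto simp: negligible_iff_null_sets null_sets_completion_iff intro!: borel_closed closed_hyperplane)
  have "measure lborel A = measure lborel (?P \<union> ?N)"
  proof (rule measure_eq_AE)
    have "AE x in lborel. x \<notin> ?H" by (rule AE_not_in[OF H])
    then show "AE x in lborel. (x \<in> A) = (x \<in> ?P \<union> ?N)"
      by eventually_elim (auto simp: inner_commute)
  qed (use fm in auto)
  also have "\<dots> = measure lborel ?P + measure lborel ?N"
    using fm by (intro measure_Union) (auto simp: fmeasurableD2)
  finally show ?thesis .
qed

lemma disjoint_fbox_separated:
  assumes "fbox a b \<noteq> {}" "fbox c d \<noteq> {}" "fbox a b \<inter> fbox c d = {}"
  obtains i where "i \<in> Basis" "b i \<le> c i \<or> d i \<le> a i"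
proof -
  have "\<not> (\<forall>i\<in>Basis. max (a i) (c i) < min (b i) (d i))"
  proof
    assume *: "\<forall>i\<in>Basis. max (a i) (c i) < min (b i) (d i)"
    then have "fbox (\<lambda>i. max (a i) (c i)) (\<lambda>i. min (b i) (d i)) \<noteq> {}" by (simp add: fbox_nonempty_iff)
    moreover have "fbox (\<lambda>i. max (a i) (c i)) (\<lambda>i. min (b i) (d i)) = fbox a b \<inter> fbox c d"
      by (auto simp: fbox_def)
    ultimately show False using assms(3) by simp
  qed
  then obtain i where "i \<in> Basis" "\<not> max (a i) (c i) < min (b i) (d i)" by blast
  moreover have "a i < b i" "c i < d i" using assms(1,2) \<open>i \<in> Basis\<close> by (auto simp: fbox_nonempty_iff)
  ultimately show ?thesis using that by (auto simp: max_def min_def split: if_splits)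
qed

text \<open>Two disjoint boxes are separated by a coordinate hyperplane. The four properties serve
  the induction: a box inside each open side makes both parts nonempty, and a box missing each side
  makes both parts consist of fewer boxes.\<close>

lemma box_family_split:
  assumes "box_family \<A>" "2 \<le> card \<A>"
  obtains i s where "i \<in> Basis"
    "\<exists>A\<in>\<A>. A \<inter> {x. s < inner x i} = {}" "\<exists>A\<in>\<A>. A \<subseteq> {x. s < inner x i}"
    "\<exists>A\<in>\<A>. A \<inter> {x. inner x i < s} = {}" "\<exists>A\<in>\<A>. A \<subseteq> {x. inner x i < s}"
proof -
  have fam: "finite \<A>" "disjoint \<A>" "\<And>A. A \<in> \<A> \<Longrightarrow> A \<noteq> {} \<and> (\<exists>a b. A = fbox a b)"
    using assms(1) by (auto simp: box_family_def)
  have "\<not> card \<A> \<le> Suc 0" using assms(2) by simp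
  then obtain A B where AB: "A \<in> \<A>" "B \<in> \<A>" "A \<noteq> B"
    using card_le_Suc0_iff_eq[OF fam(1)] by blast
  obtain a b where ab: "A = fbox a b" "A \<noteq> {}" using fam(3)[OF AB(1)] by blast
  obtain c d where cd: "B = fbox c d" "B \<noteq> {}" using fam(3)[OF AB(2)] by blast
  have "A \<inter> B = {}" using disjointD[OF fam(2) AB] .
  then obtain i where i: "i \<in> Basis" "b i \<le> c i \<or> d i \<le> a i"
    using disjoint_fbox_separated[of a b c d] ab cd by blast
  note result = that
  have key: thesis if AB': "A' \<in> \<A>" "B' \<in> \<A>" and A': "A' \<subseteq> {x. inner x i < s}" and B': "B' \<subseteq> {x. s < inner x i}" for A' B' s
  proof (rule result[of i s, OF i(1)])
    have "A' \<inter> {x. s < inner x i} = {}" "B' \<inter> {x. inner x i < s} = {}" using A' B' by force+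
    then show "\<exists>A\<in>\<A>. A \<inter> {x. s < inner x i} = {}" "\<exists>A\<in>\<A>. A \<inter> {x. inner x i < s} = {}"
      using AB' by blast+
  qed (use AB' A' B' in blast)+
  from i(2) show thesis
  proof
    assume le: "b i \<le> c i"
    show thesis
      by (rule key[OF AB(1,2), of "b i"]) (use le i(1) in \<open>force simp: ab(1) cd(1) fbox_def\<close>)+
  next
    assume le: "d i \<le> a i"
    show thesis
      by (rule key[OF AB(2,1), of "d i"]) (use le i(1) in \<open>force simp: ab(1) cd(1) fbox_def\<close>)+
  qed
qed

text \<open>The volume above level \<open>s\<close> is Lipschitz in \<open>s\<close>, since a slab
  of a bounded set lies in a box whose other sides have length \<open>2 * R\<close>; the
  intermediate value theorem then applies.\<close>

lemma halfspace_measure_attains: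
  fixes B :: "'a::euclidean_space set"
  assumes "open B" "bounded B" "i \<in> Basis" "0 \<le> y" "y \<le> measure lborel B"
  obtains s where "measure lborel (B \<inter> {x. s < inner x i}) = y"
proof -
  obtain R where R: "0 < R" "\<And>x. x \<in> B \<Longrightarrow> norm x < R"
  proof -
    obtain R where "0 < R" "\<And>x. x \<in> B \<Longrightarrow> norm x \<le> R" using assms(2) by (auto simp: bounded_pos)
    then show ?thesis using that[of "R + 1"] by force
  qed
  have comp: "- R < inner x j" "inner x j < R" if "x \<in> B" "j \<in> Basis" for x j
    using Basis_le_norm[OF that(2), of x] R(2)[OF that(1)] by auto
  define F where "F s = measure lborel (B \<inter> {x. s < inner x i})" for s
  have fm: "B \<inter> {x. s < inner x i} \<in> fmeasurable lborel" for s
    using assms(1,2) by (auto intro!: measurable_open_bounded open_Int open_halfspace_component_gt bounded_Int)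
  define C where "C = (\<Prod>j\<in>Basis - {i}. 2 * R)"
  have C: "0 \<le> C" unfolding C_def using R(1) by (intro prod_nonneg) auto
  have lip: "F s \<le> F s' + (s' - s) * C" and mono: "F s' \<le> F s" if "s \<le> s'" for s s'
  proof -
    show "F s' \<le> F s" unfolding F_def using that by (intro measure_mono_fmeasurable fm fmeasurableD[OF fm]) auto
    define u v where "u = (\<lambda>j. if j = i then s else - R)" and "v = (\<lambda>j. if j = i then s' else R)"
    let ?K = "cbox (\<Sum>j\<in>Basis. u j *\<^sub>R j) (\<Sum>j\<in>Basis. v j *\<^sub>R j)"
    have "F s \<le> measure lborel ((B \<inter> {x. s' < inner x i}) \<union> ?K)"
      unfolding F_def
    proof (rule measure_mono_fmeasurable)
      show "B \<inter> {x. s < inner x i} \<subseteq> B \<inter> {x. s' < inner x i} \<union> ?K"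
      proof
        fix x assume x: "x \<in> B \<inter> {x. s < inner x i}"
        then have "u j \<le> inner x j" "inner x j \<le> v j" if "j \<in> Basis" "\<not> s' < inner x i" for j
          using comp[of x j] that by (auto simp: u_def v_def)
        then have "\<not> s' < inner x i \<Longrightarrow> x \<in> ?K" by (simp add: mem_box)
        then show "x \<in> B \<inter> {x. s' < inner x i} \<union> ?K" using x by blast
      qed
      show "B \<inter> {x. s' < inner x i} \<union> ?K \<in> fmeasurable lborel" using fm by auto
    qed (rule fmeasurableD[OF fm])
    also have "\<dots> \<le> F s' + measure lborel ?K"
      unfolding F_def by (intro measure_Un_le fmeasurableD[OF fm]) auto
    also have "measure lborel ?K = (\<Prod>j\<in>Basis. v j - u j)"
      using that R(1) by (subst measure_lborel_cbox) (auto simp: u_def v_def inner_diff_left intro!: prod.cong)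
    also have "\<dots> = (s' - s) * C"
      unfolding C_def using assms(3) by (subst prod.remove[of _ i]) (auto simp: u_def v_def intro!: prod.cong)
    finally show "F s \<le> F s' + (s' - s) * C" by simp
  qed
  have "C-lipschitz_on UNIV F"
  proof (rule lipschitz_onI)
    fix s s' :: real
    show "dist (F s) (F s') \<le> C * dist s s'"
      using lip[of s s'] lip[of s' s] mono[of s s'] mono[of s' s]
      by (cases "s \<le> s'") (auto simp: dist_real_def abs_if mult.commute)
  qed (rule C)
  then have cont: "continuous_on UNIV F" by (rule lipschitz_on_continuous_on)
  have "B \<inter> {x. R < inner x i} = {}" "B \<inter> {x. - R < inner x i} = B"
    using comp(1)[OF _ assms(3)] comp(2)[OF _ assms(3)] by force+
  then have "F R = 0" "F (- R) = measure lborel B" by (simp_all add: F_def)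
  then have "\<exists>s\<ge>-R. s \<le> R \<and> F s = y"
    using assms(4,5) R(1) continuous_on_subset[OF cont] by (intro IVT2') auto
  then show ?thesis using that by (auto simp: F_def)
qed

text \<open>Pairs of points with the same relative position in both boxes already fill a box whose
  sides are the weighted arithmetic means; the weighted arithmetic-geometric inequality is then
  applied side by side.\<close>

lemma minkowski_mix_fbox_ge:
  assumes "fbox a b \<noteq> {}" "fbox c d \<noteq> {}" and t: "0 < t" "t < 1"
  shows "measure lborel (fbox a b) powr (1 - t) * measure lborel (fbox c d) powr t \<le>
    measure lborel (minkowski_mix t (fbox a b) (fbox c d))"
proof -
  have ab: "a i < b i" and cd: "c i < d i" if "i \<in> Basis" for i
    using assms(1,2) that by (auto simp: fbox_nonempty_iff)
  define l u where "l i = (1 - t) * a i + t * c i" and "u i = (1 - t) * b i + t * d i" for i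
  have lu: "l i < u i" if "i \<in> Basis" for i
    unfolding l_def u_def using ab[OF that] cd[OF that] t by (intro add_strict_mono mult_strict_left_mono) auto
  have sub: "fbox l u \<subseteq> minkowski_mix t (fbox a b) (fbox c d)"
  proof
    fix x assume x: "x \<in> fbox l u"
    define r where "r i = (inner x i - l i) / (u i - l i)" for i
    have r: "0 < r i" "r i < 1" "inner x i = l i + r i * (u i - l i)" if "i \<in> Basis" for i
      using x lu[OF that] that by (auto simp: r_def fbox_def)
    define p q where "p = (\<Sum>i\<in>Basis. (a i + r i * (b i - a i)) *\<^sub>R i)"
      and "q = (\<Sum>i\<in>Basis. (c i + r i * (d i - c i)) *\<^sub>R i)"
    have pq: "inner p i = a i + r i * (b i - a i)" "inner q i = c i + r i * (d i - c i)" if "i \<in> Basis" for i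
      using that by (simp_all add: p_def q_def)
    have mid: "\<alpha> < \<alpha> + \<rho> * (\<beta> - \<alpha>)" "\<alpha> + \<rho> * (\<beta> - \<alpha>) < \<beta>" if "\<alpha> < \<beta>" "0 < \<rho>" "\<rho> < 1" for \<alpha> \<beta> \<rho> :: real
    proof -
      have "\<rho> * (\<beta> - \<alpha>) < 1 * (\<beta> - \<alpha>)" using that by (intro mult_strict_right_mono) auto
      then show "\<alpha> + \<rho> * (\<beta> - \<alpha>) < \<beta>" by simp
    qed (use that in auto)
    have "p \<in> fbox a b" "q \<in> fbox c d"
      using ab cd r mid by (auto simp: fbox_def pq)
    moreover have "x = (1 - t) *\<^sub>R p + t *\<^sub>R q"
    proof (rule euclidean_eqI)
      fix i :: 'a assume i: "i \<in> Basis"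
      show "inner x i = inner ((1 - t) *\<^sub>R p + t *\<^sub>R q) i"
        unfolding r(3)[OF i] inner_add_left inner_scaleR_left pq[OF i] by (simp add: l_def u_def algebra_simps)
    qed
    ultimately show "x \<in> minkowski_mix t (fbox a b) (fbox c d)" using minkowski_mixI by metis
  qed
  have "measure lborel (fbox a b) powr (1 - t) * measure lborel (fbox c d) powr t =
      (\<Prod>i\<in>Basis. (b i - a i) powr (1 - t) * (d i - c i) powr t)"
    unfolding measure_fbox[OF assms(1)] measure_fbox[OF assms(2)]
    using ab cd by (simp add: prod_powr_distrib prod.distrib less_imp_le)
  also have "\<dots> \<le> (\<Prod>i\<in>Basis. u i - l i)"
  proof (rule prod_mono)
    fix i :: 'a assume i: "i \<in> Basis"
    have "(b i - a i) powr (1 - t) * (d i - c i) powr t \<le> (1 - t) * (b i - a i) + t * (d i - c i)"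
      using ab[OF i] cd[OF i] t by (intro Youngs_inequality_0) auto
    then show "0 \<le> (b i - a i) powr (1 - t) * (d i - c i) powr t \<and>
        (b i - a i) powr (1 - t) * (d i - c i) powr t \<le> u i - l i"
      by (simp add: u_def l_def algebra_simps)
  qed
  also have "\<dots> = measure lborel (fbox l u)"
    using lu by (subst measure_fbox) (auto simp: fbox_nonempty_iff)
  also have "\<dots> \<le> measure lborel (minkowski_mix t (fbox a b) (fbox c d))"
    using sub t by (intro measure_mono_fmeasurable)
      (auto intro!: measurable_open_bounded open_minkowski_mix bounded_minkowski_mix)
  finally show ?thesis .
qed

text \<open>Hadwiger--Ohmann induction: cut \<open>\<A>\<close> by a hyperplane separating two of its boxes, and \<open>\<B>\<close> by a
  parallel hyperplane in the same volume ratio.\<close>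
lemma minkowski_mix_box_family_ge:
  fixes \<A> \<B> :: "'a::euclidean_space set set"
  assumes "box_family \<A>" "box_family \<B>" "\<A> \<noteq> {}" "\<B> \<noteq> {}" "0 < t" "t < 1"
  shows "measure lborel (\<Union>\<A>) powr (1 - t) * measure lborel (\<Union>\<B>) powr t \<le>
    measure lborel (minkowski_mix t (\<Union>\<A>) (\<Union>\<B>))"
  using assms
proof (induction "card \<A> + card \<B>" arbitrary: \<A> \<B> t rule: less_induct)
  case less
  \<comment> \<open>Stated for arbitrary families so that it also serves with the families exchanged
    and \<open>t\<close> replaced by \<open>1 - t\<close>, when the second family is the one to be
    cut.\<close>
  have step: "measure lborel (\<Union>\<A>) powr (1 - t) * measure lborel (\<Union>\<B>) powr t \<le>
    measure lborel (minkowski_mix t (\<Union>\<A>) (\<Union>\<B>))"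
    if fam: "box_family \<A>" "box_family \<B>" and ne: "\<A> \<noteq> {}" "\<B> \<noteq> {}" and t: "0 < t" "t < 1" and "2 \<le> card \<A>"
      and IH: "\<And>\<A>' \<B>' :: 'a set set. card \<A>' + card \<B>' < card \<A> + card \<B> \<Longrightarrow> box_family \<A>' \<Longrightarrow> box_family \<B>' \<Longrightarrow>
         \<A>' \<noteq> {} \<Longrightarrow> \<B>' \<noteq> {} \<Longrightarrow>
         measure lborel (\<Union>\<A>') powr (1 - t) * measure lborel (\<Union>\<B>') powr t \<le>
         measure lborel (minkowski_mix t (\<Union>\<A>') (\<Union>\<B>'))"
    for \<A> \<B> :: "'a set set" and t
  proof -
    let ?A = "\<Union>\<A>" and ?B = "\<Union>\<B>"
    obtain i s where i: "i \<in> Basis" and hs: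
      "\<exists>A\<in>\<A>. A \<inter> {x. s < inner x i} = {}" "\<exists>A\<in>\<A>. A \<subseteq> {x. s < inner x i}"
      "\<exists>A\<in>\<A>. A \<inter> {x. inner x i < s} = {}" "\<exists>A\<in>\<A>. A \<subseteq> {x. inner x i < s}"
      by (rule box_family_split[OF fam(1) \<open>2 \<le> card \<A>\<close>])
    note oA = box_family_Union[OF fam(1)] and oB = box_family_Union[OF fam(2)]
    define Ap An where "Ap = ?A \<inter> {x. s < inner x i}" and "An = ?A \<inter> {x. inner x i < s}"
    have oh: "open (X \<inter> {x. r < inner x i})" "open (X \<inter> {x. inner x i < r})"
      "bounded (X \<inter> {x. r < inner x i})" "bounded (X \<inter> {x. inner x i < r})"
      if "open X" "bounded X" for X r
      using that by (auto intro!: open_Int open_halfspace_component_gt open_halfspace_component_lt bounded_Int)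
    have "Ap \<noteq> {}" "An \<noteq> {}"
    proof -
      have ne: "A \<noteq> {}" if "A \<in> \<A>" for A using fam(1) that by (auto simp: box_family_def)
      show "Ap \<noteq> {}" using hs(2) ne unfolding Ap_def by fast
      show "An \<noteq> {}" using hs(4) ne unfolding An_def by fast
    qed
    then have mpos: "0 < measure lborel Ap" "0 < measure lborel An"
      unfolding Ap_def An_def by (intro measure_open_pos oh oA; simp)+
    define \<alpha> where "\<alpha> = measure lborel ?A"
    define \<beta> where "\<beta> = measure lborel ?B"
    define p where "p = measure lborel Ap / \<alpha>"
    have \<alpha>: "\<alpha> = measure lborel Ap + measure lborel An"
      unfolding \<alpha>_def Ap_def An_def by (rule measure_hyperplane_split[OF oA i])
    have "0 < \<alpha>" using \<alpha> mpos by simp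
    have p: "0 < p" "p < 1" "measure lborel Ap = p * \<alpha>" "measure lborel An = (1 - p) * \<alpha>"
      using \<alpha> mpos by (auto simp: p_def field_simps)
    have "?B \<noteq> {}" using ne(2) fam(2) by (auto simp: box_family_def)
    then have "0 < \<beta>" unfolding \<beta>_def by (intro measure_open_pos oB)
    have "p * \<beta> \<le> 1 * \<beta>" using p \<open>0 < \<beta>\<close> by (intro mult_right_mono) auto
    then obtain s' where s': "measure lborel (?B \<inter> {x. s' < inner x i}) = p * \<beta>"
      using halfspace_measure_attains[OF oB i, of "p * \<beta>"] p \<open>0 < \<beta>\<close> by (auto simp: \<beta>_def)
    define Bp Bn where "Bp = ?B \<inter> {x. s' < inner x i}" and "Bn = ?B \<inter> {x. inner x i < s'}"
    have mB: "measure lborel Bp = p * \<beta>" "measure lborel Bn = (1 - p) * \<beta>"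
      using s' measure_hyperplane_split[OF oB i, of s'] by (auto simp: Bp_def Bn_def \<beta>_def algebra_simps)
    then have Bne: "Bp \<noteq> {}" "Bn \<noteq> {}" using p \<open>0 < \<beta>\<close> by auto
    have hg: "\<exists>a' b'. fbox a b \<inter> {x. r < inner x i} = fbox a' b'"
      and hl: "\<exists>a' b'. fbox a b \<inter> {x. inner x i < r} = fbox a' b'" for a b r
      using fbox_Int_greater[OF i] fbox_Int_less[OF i] by blast+
    have card_less: "card {A\<in>\<A>. A \<inter> H \<noteq> {}} < card \<A>" if "\<exists>A\<in>\<A>. A \<inter> H = {}" for H
      using that fam(1) by (intro psubset_card_mono) (auto simp: box_family_def)
    have card_le: "card {A\<in>\<B>. A \<inter> H \<noteq> {}} \<le> card \<B>" for H
      using fam(2) by (intro card_mono) (auto simp: box_family_def)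
    have half: "measure lborel (?A \<inter> H) powr (1 - t) * measure lborel (?B \<inter> H') powr t \<le>
        measure lborel (minkowski_mix t (?A \<inter> H) (?B \<inter> H'))"
      if H: "\<And>a b. \<exists>a' b'. fbox a b \<inter> H = fbox a' b'" and H': "\<And>a b. \<exists>a' b'. fbox a b \<inter> H' = fbox a' b'"
        and "\<exists>A\<in>\<A>. A \<inter> H = {}" and nonempty: "?A \<inter> H \<noteq> {}" "?B \<inter> H' \<noteq> {}" for H H'
    proof -
      define \<A>' where "\<A>' = (\<lambda>A. A \<inter> H) ` {A\<in>\<A>. A \<inter> H \<noteq> {}}"
      define \<B>' where "\<B>' = (\<lambda>A. A \<inter> H') ` {A\<in>\<B>. A \<inter> H' \<noteq> {}}"
      note a = box_family_Int[OF fam(1) H, folded \<A>'_def]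
      note b = box_family_Int[OF fam(2) H', folded \<B>'_def]
      have "card \<A>' + card \<B>' < card \<A> + card \<B>"
        using a(3) b(3) card_less[OF that(3)] card_le[of H'] by linarith
      moreover have "\<A>' \<noteq> {}" "\<B>' \<noteq> {}" using nonempty a(2) b(2) by auto
      ultimately show ?thesis using IH[of \<A>' \<B>'] a(1,2) b(1,2) by simp
    qed
    have hp: "measure lborel Ap powr (1 - t) * measure lborel Bp powr t \<le> measure lborel (minkowski_mix t Ap Bp)"
      unfolding Ap_def Bp_def using \<open>Ap \<noteq> {}\<close> Bne by (intro half hg hs(1)) (auto simp: Ap_def Bp_def)
    have hn: "measure lborel An powr (1 - t) * measure lborel Bn powr t \<le> measure lborel (minkowski_mix t An Bn)"
      unfolding An_def Bn_def using \<open>An \<noteq> {}\<close> Bne by (intro half hl hs(3)) (auto simp: An_def Bn_def)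
    \<comment> \<open>Homogeneity of degree one: the halves carry the proportions \<open>p\<close>
      and \<open>1 - p\<close> in both sets, so their two bounds add up to the full one.\<close>
    have scale: "(r * \<alpha>) powr (1 - t) * (r * \<beta>) powr t = r * (\<alpha> powr (1 - t) * \<beta> powr t)" if "0 < r" for r
    proof -
      have "r powr (1 - t) * r powr t = r" using that by (simp flip: powr_add)
      then show ?thesis using that \<open>0 < \<alpha>\<close> \<open>0 < \<beta>\<close> by (simp add: powr_mult algebra_simps)
    qed
    have "\<alpha> powr (1 - t) * \<beta> powr t = p * (\<alpha> powr (1 - t) * \<beta> powr t) + (1 - p) * (\<alpha> powr (1 - t) * \<beta> powr t)"
      by (simp add: algebra_simps)
    also have "\<dots> \<le> measure lborel (minkowski_mix t Ap Bp) + measure lborel (minkowski_mix t An Bn)"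
      using hp hn scale[of p] scale[of "1 - p"] p mB by simp
    also have "\<dots> = measure lborel (minkowski_mix t Ap Bp \<union> minkowski_mix t An Bn)"
    proof (rule measure_Union[symmetric])
      have fm: "minkowski_mix t Ap Bp \<in> fmeasurable lborel" "minkowski_mix t An Bn \<in> fmeasurable lborel"
        unfolding Ap_def An_def Bp_def Bn_def
        by (intro measurable_open_bounded open_minkowski_mix bounded_minkowski_mix oh oA oB t)+
      then show "minkowski_mix t Ap Bp \<in> sets lborel" "minkowski_mix t An Bn \<in> sets lborel"
        "emeasure lborel (minkowski_mix t Ap Bp) \<noteq> \<infinity>" "emeasure lborel (minkowski_mix t An Bn) \<noteq> \<infinity>"
        by (auto simp: fmeasurableD fmeasurableD2 simp del: sets_lborel)
      \<comment> \<open>The mixtures of the halves lie on opposite sides of the hyperplane at height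
        \<open>(1 - t) * s + t * s'\<close>, so their measures add.\<close>
      have "(1 - t) * s + t * s' < inner x i" if "x \<in> minkowski_mix t Ap Bp" for x
        using that t by (auto simp: minkowski_mix_def Ap_def Bp_def inner_add_left
          intro!: add_strict_mono mult_strict_left_mono)
      moreover have "inner x i < (1 - t) * s + t * s'" if "x \<in> minkowski_mix t An Bn" for x
        using that t by (auto simp: minkowski_mix_def An_def Bn_def inner_add_left
          intro!: add_strict_mono mult_strict_left_mono)
      ultimately show "minkowski_mix t Ap Bp \<inter> minkowski_mix t An Bn = {}" by force
    qed
    also have "\<dots> \<le> measure lborel (minkowski_mix t ?A ?B)"
    proof (rule measure_mono_fmeasurable)
      show "minkowski_mix t Ap Bp \<union> minkowski_mix t An Bn \<subseteq> minkowski_mix t ?A ?B"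
        unfolding Ap_def Bp_def An_def Bn_def by (intro Un_least minkowski_mix_mono) auto
      show "minkowski_mix t ?A ?B \<in> fmeasurable lborel"
        by (intro measurable_open_bounded open_minkowski_mix bounded_minkowski_mix oA oB t)
      show "minkowski_mix t Ap Bp \<union> minkowski_mix t An Bn \<in> sets lborel"
        unfolding Ap_def An_def Bp_def Bn_def sets_lborel
        by (intro borel_open open_Un open_minkowski_mix oh oA oB t)
    qed
    finally show ?thesis by (simp add: \<alpha>_def \<beta>_def)
  qed
  have fin: "finite \<A>" "finite \<B>" using less.prems by (auto simp: box_family_def)
  have "card \<A> \<noteq> 0" "card \<B> \<noteq> 0" using fin less.prems by auto
  then consider "2 \<le> card \<A>" | "2 \<le> card \<B>" | "card \<A> = 1" "card \<B> = 1" by linarith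
  then show ?case
  proof cases
    case 1
    show ?thesis
      by (rule step[OF less.prems 1]) (rule less.hyps[OF _ _ _ _ _ less.prems(5,6)])
  next
    case 2
    have "measure lborel (\<Union>\<B>) powr (1 - (1 - t)) * measure lborel (\<Union>\<A>) powr (1 - t) \<le>
      measure lborel (minkowski_mix (1 - t) (\<Union>\<B>) (\<Union>\<A>))"
    proof (rule step[OF less.prems(2,1,4,3) _ _ 2])
      show "0 < 1 - t" "1 - t < 1" using less.prems(5,6) by auto
      then show "measure lborel (\<Union>\<A>') powr (1 - (1 - t)) * measure lborel (\<Union>\<B>') powr (1 - t) \<le>
          measure lborel (minkowski_mix (1 - t) (\<Union>\<A>') (\<Union>\<B>'))"
        if "card \<A>' + card \<B>' < card \<B> + card \<A>" "box_family \<A>'" "box_family \<B>'" "\<A>' \<noteq> {}" "\<B>' \<noteq> {}"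
        for \<A>' \<B>' :: "'a set set"
        using that by (intro less.hyps) (simp_all add: add.commute)
    qed
    then show ?thesis by (simp add: minkowski_mix_swap mult.commute)
  next
    case 3
    then obtain A B where AB: "\<A> = {A}" "\<B> = {B}" by (metis card_1_singletonE)
    then obtain a b c d where "A = fbox a b" "B = fbox c d" "A \<noteq> {}" "B \<noteq> {}"
      using less.prems(1,2) unfolding box_family_def by auto
    then show ?thesis using minkowski_mix_fbox_ge[of a b c d t] less.prems(5,6) by (simp add: AB)
  qed
qed

section \<open>Passage from boxes to open sets\<close>

text \<open>\<open>U\<close> is covered by countably many boxes inside \<open>U\<close> with
  disjoint interiors. Passing to the interiors loses only the frontiers, a null set, so finitely
  many interiors exhaust the measure up to any deficit.\<close>

lemma open_bounded_inner_box_family: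
  fixes U :: "'a::euclidean_space set"
  assumes "open U" "bounded U" "U \<noteq> {}" "c < measure lborel U"
  obtains \<A> where "box_family \<A>" "\<A> \<noteq> {}" "\<Union>\<A> \<subseteq> U" "c < measure lborel (\<Union>\<A>)"
proof -
  obtain a where "U \<subseteq> box (- a) a" using assms(2) bounded_subset_box_symmetric by blast
  then have sub: "U \<subseteq> cbox (- a) a" and nb: "box (- a) a \<noteq> {}"
    using box_subset_cbox assms(3) by blast+
  \<comment> \<open>Each box of the covering has a tag in \<open>U\<close>, where \<open>g\<close>
    equals \<open>U\<close>; this forces the box into \<open>U\<close>.\<close>
  define g where "g x = (if x \<in> U then U else UNIV)" for x
  have "gauge g" using assms(1) by (auto simp: gauge_def g_def)
  obtain \<D> where \<D>: "countable \<D>" "\<And>K. K \<in> \<D> \<Longrightarrow> interior K \<noteq> {} \<and> (\<exists>c d. K = cbox c d)"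
    "pairwise (\<lambda>A B. interior A \<inter> interior B = {}) \<D>"
    "\<And>K. K \<in> \<D> \<Longrightarrow> \<exists>x \<in> U \<inter> K. K \<subseteq> g x" "U \<subseteq> \<Union>\<D>"
    using covering_lemma[OF sub nb \<open>gauge g\<close>] by metis
  have KU: "K \<subseteq> U" if "K \<in> \<D>" for K using \<D>(4)[OF that] by (auto simp: g_def)
  have "\<D> \<noteq> {}" using \<D>(5) assms(3) by auto
  \<comment> \<open>The enumeration may repeat a box; the families below are images under
    \<open>E\<close>, so repetitions disappear.\<close>
  define E where "E n = interior (from_nat_into \<D> n)" for n
  have inD: "from_nat_into \<D> n \<in> \<D>" for n using \<open>\<D> \<noteq> {}\<close> by (rule from_nat_into)
  have fam: "box_family (E ` {..n})" for n
    unfolding box_family_def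
  proof (intro conjI ballI)
    show "disjoint (E ` {..n})"
    proof (rule disjointI)
      fix X Y assume "X \<in> E ` {..n}" "Y \<in> E ` {..n}" "X \<noteq> Y"
      then obtain k l where kl: "X = E k" "Y = E l" by blast
      with \<open>X \<noteq> Y\<close> have "from_nat_into \<D> k \<noteq> from_nat_into \<D> l" by (auto simp: E_def)
      then show "X \<inter> Y = {}" unfolding kl E_def by (rule pairwiseD[OF \<D>(3) inD inD])
    qed
    fix X assume "X \<in> E ` {..n}"
    then obtain k where k: "X = E k" by blast
    show "X \<noteq> {}" using \<D>(2)[OF inD] k by (auto simp: E_def)
    obtain c d where "from_nat_into \<D> k = cbox c d" using \<D>(2)[OF inD] by blast
    then have "X = box c d" by (simp add: k E_def interior_cbox)
    then show "\<exists>a b. X = fbox a b" unfolding box_eq_fbox by blast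
  qed simp
  have Esub: "(\<Union>(E ` {..n})) \<subseteq> U" for n
    using KU[OF inD] interior_subset by (fastforce simp: E_def)
  define V where "V n = \<Union>(E ` {..n})" for n
  have V: "open (V n)" "bounded (V n)" for n using box_family_Union[OF fam] by (auto simp: V_def)
  have fmU: "U \<in> fmeasurable lborel" by (rule measurable_open_bounded[OF assms(1,2)])
  have "(\<lambda>n. measure lborel (V n)) \<longlonglongrightarrow> measure lborel (\<Union>n. V n)"
  proof (rule Lim_measure_incseq)
    show "range V \<subseteq> sets lborel" using V(1) by auto
    show "incseq V" by (force simp: incseq_def V_def)
    have "emeasure lborel (\<Union>n. V n) \<le> emeasure lborel U"
      using Esub assms(1) by (intro emeasure_mono) (auto simp: V_def)
    then show "emeasure lborel (\<Union>n. V n) \<noteq> \<infinity>" using fmeasurableD2[OF fmU] by (auto simp: top_unique)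
  qed
  moreover have "measure lborel (\<Union>n. V n) = measure lborel U"
  proof (rule measure_eq_AE)
    define F where "F = (\<Union>K\<in>\<D>. frontier K)"
    have "negligible F"
      unfolding F_def using \<D>(1,2) by (intro negligible_countable_Union) (auto dest!: \<D>(2) intro!: negligible_convex_frontier)
    have "F \<in> null_sets lborel"
    proof -
      have "F \<in> sets borel" unfolding F_def using \<D>(1) by (intro sets.countable_UN') auto
      then show ?thesis using \<open>negligible F\<close> by (simp add: negligible_iff_null_sets null_sets_completion_iff)
    qed
    then have "AE x in lborel. x \<notin> F" by (rule AE_not_in)
    then show "AE x in lborel. (x \<in> (\<Union>n. V n)) = (x \<in> U)"
    proof eventually_elim
      case (elim x)
      show ?case
      proof
        assume "x \<in> U"
        then obtain K where K: "K \<in> \<D>" "x \<in> K" using \<D>(5) by blast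
        have "x \<notin> frontier K" using elim K by (auto simp: F_def)
        moreover have "closed K" using \<D>(2)[OF K(1)] by auto
        ultimately have "x \<in> interior K" using K(2) by (auto simp: frontier_def)
        moreover obtain n where "from_nat_into \<D> n = K" using \<D>(1) K(1) by (metis from_nat_into_surj)
        ultimately have "x \<in> E n" by (simp add: E_def)
        then show "x \<in> (\<Union>n. V n)" by (auto simp: V_def)
      next
        assume "x \<in> (\<Union>n. V n)"
        then show "x \<in> U" using Esub by (auto simp: V_def)
      qed
    qed
  qed (use V(1) assms(1) in auto)
  ultimately have "\<forall>\<^sub>F n in sequentially. c < measure lborel (V n)"
    using assms(4) by (intro order_tendstoD(1)) auto
  then obtain n where "c < measure lborel (V n)" by (auto dest: eventually_happens'[OF sequentially_bot])
  then show ?thesis using that[OF fam[of n]] Esub by (auto simp: V_def)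
qed

text \<open>Inner box families capture any fraction \<open>z < 1\<close> of each measure. The
  product of powers is homogeneous of degree one, so \<open>z\<close> factors out and may be sent to
  1.\<close>

lemma brunn_minkowski_open_bounded:
  fixes A B :: "'a::euclidean_space set"
  assumes "open A" "bounded A" "A \<noteq> {}" "open B" "bounded B" "B \<noteq> {}" and t: "0 < t" "t < 1"
  shows "measure lborel A powr (1 - t) * measure lborel B powr t \<le> measure lborel (minkowski_mix t A B)"
proof (rule field_le_mult_one_interval)
  fix z :: real assume z: "0 < z" "z < 1"
  have less: "z * measure lborel X < measure lborel X" if X: "open X" "bounded X" "X \<noteq> {}" for X :: "'a set"
    using measure_open_pos[OF X] z by simp
  obtain \<A> where \<A>: "box_family \<A>" "\<A> \<noteq> {}" "\<Union>\<A> \<subseteq> A" "z * measure lborel A < measure lborel (\<Union>\<A>)"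
    using open_bounded_inner_box_family[OF assms(1-3) less[OF assms(1-3)]] by blast
  obtain \<B> where \<B>: "box_family \<B>" "\<B> \<noteq> {}" "\<Union>\<B> \<subseteq> B" "z * measure lborel B < measure lborel (\<Union>\<B>)"
    using open_bounded_inner_box_family[OF assms(4-6) less[OF assms(4-6)]] by blast
  have "z powr (1 - t) * z powr t = z" using z by (simp flip: powr_add)
  then have "z * (measure lborel A powr (1 - t) * measure lborel B powr t) =
      (z * measure lborel A) powr (1 - t) * (z * measure lborel B) powr t"
    using z by (simp add: powr_mult algebra_simps)
  also have "\<dots> \<le> measure lborel (\<Union>\<A>) powr (1 - t) * measure lborel (\<Union>\<B>) powr t"
    using \<A>(4) \<B>(4) z t by (intro mult_mono powr_mono2) auto
  also have "\<dots> \<le> measure lborel (minkowski_mix t (\<Union>\<A>) (\<Union>\<B>))"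
    by (rule minkowski_mix_box_family_ge) (use \<A> \<B> t in auto)
  also have "\<dots> \<le> measure lborel (minkowski_mix t A B)"
  proof (rule measure_mono_fmeasurable)
    show "minkowski_mix t (\<Union>\<A>) (\<Union>\<B>) \<in> sets lborel"
      unfolding sets_lborel by (intro borel_open open_minkowski_mix box_family_Union(1)[OF \<A>(1)] t)
    show "minkowski_mix t A B \<in> fmeasurable lborel"
      by (intro measurable_open_bounded open_minkowski_mix bounded_minkowski_mix assms)
  qed (intro minkowski_mix_mono \<A> \<B>)
  finally show "z * (measure lborel A powr (1 - t) * measure lborel B powr t) \<le> measure lborel (minkowski_mix t A B)" .
qed

section \<open>Logarithmic form for sets of possibly infinite measure\<close>

lemma ennreal_ln_tendsto:
  assumes lim: "(\<lambda>n. ennreal (x n)) \<longlonglongrightarrow> y" and "y \<noteq> 0" and pos: "\<forall>\<^sub>F n in sequentially. 0 < x n"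
  shows "(\<lambda>n. ereal (ln (x n))) \<longlonglongrightarrow> ennreal_ln y"
proof (cases "y = top")
  case True
  then have "filterlim x at_top sequentially" using lim by (simp add: ennreal_tendsto_top_eq_at_top)
  then have "filterlim (\<lambda>n. ln (x n)) at_top sequentially" by (rule filterlim_compose[OF ln_at_top])
  then show ?thesis using True assms(2) by (simp add: ennreal_ln_def tendsto_PInfty filterlim_at_top_dense)
next
  case False
  then obtain r where r: "y = ennreal r" "0 \<le> r" by (metis ennreal_cases)
  then have "0 < r" using assms(2) by (cases "r = 0") auto
  have "x \<longlonglongrightarrow> r"
    using lim pos r by (subst (asm) r(1), subst (asm) tendsto_ennreal_iff) (auto elim: eventually_mono)
  then have "(\<lambda>n. ln (x n)) \<longlonglongrightarrow> ln r" using \<open>0 < r\<close> by (intro tendsto_intros) auto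
  then show ?thesis using \<open>0 < r\<close> by (simp add: r ennreal_ln_ennreal)
qed

lemma ennreal_ln_gt_MInfty: "x \<noteq> 0 \<Longrightarrow> ennreal_ln x \<noteq> - \<infinity>"
  by (simp add: ennreal_ln_def)

lemma ln_measure_Int_ball_tendsto:
  fixes U :: "'a::euclidean_space set"
  assumes "open U" "U \<noteq> {}"
  shows "(\<lambda>n. ereal (ln (measure lborel (U \<inter> ball 0 (real n))))) \<longlonglongrightarrow> ennreal_ln (emeasure lborel U)"
    and "\<forall>\<^sub>F n in sequentially. 0 < measure lborel (U \<inter> ball 0 (real n))"
    and "\<forall>\<^sub>F n in sequentially. U \<inter> ball 0 (real n) \<noteq> {}"
    and "emeasure lborel U \<noteq> 0"
proof -
  let ?B = "\<lambda>n::nat. U \<inter> ball 0 (real n)"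
  have em: "emeasure lborel (?B n) = ennreal (measure lborel (?B n))" for n
  proof (rule emeasure_eq_ennreal_measure)
    show "emeasure lborel (?B n) \<noteq> top"
      using emeasure_bounded_finite[of "?B n"] by (auto simp: bounded_Int)
  qed
  have un: "(\<Union>n. ?B n) = U"
  proof
    show "U \<subseteq> (\<Union>n. ?B n)"
    proof
      fix x assume "x \<in> U"
      obtain n where "norm x < real n" using reals_Archimedean2 by blast
      then show "x \<in> (\<Union>n. ?B n)" using \<open>x \<in> U\<close> by auto
    qed
  qed auto
  have "(\<lambda>n. emeasure lborel (?B n)) \<longlonglongrightarrow> emeasure lborel (\<Union>n. ?B n)"
    using assms(1) by (intro Lim_emeasure_incseq) (auto simp: incseq_def)
  then have lim: "(\<lambda>n. ennreal (measure lborel (?B n))) \<longlonglongrightarrow> emeasure lborel U"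
    unfolding em un .
  have "\<not> negligible U" using assms open_not_negligible by blast
  then show nz: "emeasure lborel U \<noteq> 0"
    using assms(1) by (auto simp: negligible_iff_null_sets null_sets_def)
  then have "\<forall>\<^sub>F n in sequentially. 0 < ennreal (measure lborel (?B n))"
    by (intro order_tendstoD[OF lim]) (simp add: zero_less_iff_neq_zero)
  then show pos: "\<forall>\<^sub>F n in sequentially. 0 < measure lborel (?B n)"
    by eventually_elim (simp add: ennreal_less_zero_iff)
  then show "\<forall>\<^sub>F n in sequentially. ?B n \<noteq> {}" by eventually_elim auto
  show "(\<lambda>n. ereal (ln (measure lborel (?B n)))) \<longlonglongrightarrow> ennreal_ln (emeasure lborel U)"
    by (rule ennreal_ln_tendsto[OF lim nz pos])
qed

text \<open>Indicatrices can be unbounded with infinite measure, so the sets are exhausted by balls.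
  Nonempty open sets have positive measure; hence neither logarithm is -\<infinity>, and the sum of
  the limits is well behaved.\<close>

lemma ln_brunn_minkowski_open:
  fixes A B C :: "'a::euclidean_space set"
  assumes "open A" "A \<noteq> {}" "open B" "B \<noteq> {}" "open C" "minkowski_mix t A B \<subseteq> C" and t: "0 < t" "t < 1"
  shows "ereal (1 - t) * ennreal_ln (emeasure lborel A) + ereal t * ennreal_ln (emeasure lborel B)
    \<le> ennreal_ln (emeasure lborel C)"
proof (cases "emeasure lborel C = top")
  case True
  then show ?thesis by (simp add: ennreal_ln_def)
next
  case False
  then have C: "C \<in> fmeasurable lborel" using assms(5) by (simp add: fmeasurable_def less_top)
  let ?a = "\<lambda>n::nat. measure lborel (A \<inter> ball 0 (real n))"
  let ?b = "\<lambda>n::nat. measure lborel (B \<inter> ball 0 (real n))"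
  note A = ln_measure_Int_ball_tendsto[OF assms(1,2)] and B = ln_measure_Int_ball_tendsto[OF assms(3,4)]
  have lim: "(\<lambda>n. ereal (1 - t) * ereal (ln (?a n)) + ereal t * ereal (ln (?b n))) \<longlonglongrightarrow>
      ereal (1 - t) * ennreal_ln (emeasure lborel A) + ereal t * ennreal_ln (emeasure lborel B)"
  proof (rule tendsto_add_ereal_nonneg)
    show "ereal (1 - t) * ennreal_ln (emeasure lborel A) \<noteq> - \<infinity>"
      using ennreal_ln_gt_MInfty[OF A(4)] t by (cases "ennreal_ln (emeasure lborel A)") auto
    show "ereal t * ennreal_ln (emeasure lborel B) \<noteq> - \<infinity>"
      using ennreal_ln_gt_MInfty[OF B(4)] t by (cases "ennreal_ln (emeasure lborel B)") auto
  qed (rule tendsto_cmult_ereal[OF _ A(1)] tendsto_cmult_ereal[OF _ B(1)], simp)+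
  have "\<forall>\<^sub>F n in sequentially. ereal (1 - t) * ereal (ln (?a n)) + ereal t * ereal (ln (?b n)) \<le> ennreal_ln (emeasure lborel C)"
    using A(2,3) B(2,3)
  proof eventually_elim
    case (elim n)
    have "?a n powr (1 - t) * ?b n powr t \<le> measure lborel (minkowski_mix t (A \<inter> ball 0 (real n)) (B \<inter> ball 0 (real n)))"
      using assms elim by (intro brunn_minkowski_open_bounded) (auto simp: bounded_Int)
    also have "\<dots> \<le> measure lborel C"
    proof (rule measure_mono_fmeasurable[OF _ _ C])
      show "minkowski_mix t (A \<inter> ball 0 (real n)) (B \<inter> ball 0 (real n)) \<subseteq> C"
        using minkowski_mix_mono[of "A \<inter> ball 0 (real n)" A "B \<inter> ball 0 (real n)" B t] assms(6) by blast
      show "minkowski_mix t (A \<inter> ball 0 (real n)) (B \<inter> ball 0 (real n)) \<in> sets lborel"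
        unfolding sets_lborel using assms(1) t by (intro borel_open open_minkowski_mix) auto
    qed
    finally have le: "?a n powr (1 - t) * ?b n powr t \<le> measure lborel C" .
    have pos: "0 < ?a n powr (1 - t) * ?b n powr t" using elim by simp
    have "(1 - t) * ln (?a n) + t * ln (?b n) = ln (?a n powr (1 - t) * ?b n powr t)"
      using elim by (simp add: ln_mult_pos ln_powr)
    also have "\<dots> \<le> ln (measure lborel C)" using le pos by (intro ln_mono) auto
    also have "ereal (ln (measure lborel C)) = ennreal_ln (emeasure lborel C)"
      using le pos False by (subst emeasure_eq_ennreal_measure) (auto simp: ennreal_ln_ennreal)
    finally show ?case by simp
  qed
  then show ?thesis by (intro tendsto_upperbound[OF lim]) auto
qed

section \<open>Convexity of the logarithmic volume\<close>

text \<open>The frontier of a convex set is negligible. An indicatrix is thus Lebesgue measurable by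
  convexity alone, without any regularity of the metric, and its volume is that of an open
  set.\<close>

lemma emeasure_lebesgue_convex:
  fixes A :: "'a::euclidean_space set"
  assumes "convex A"
  shows "emeasure lebesgue A = emeasure lborel (interior A)"
proof -
  have "negligible (A - interior A)"
    by (rule negligible_subset[OF negligible_convex_frontier[OF assms]])
      (auto simp: frontier_def intro: closure_subset[THEN subsetD])
  then have "A - interior A \<in> null_sets lebesgue" by (simp add: negligible_iff_null_sets)
  then have "emeasure lebesgue (interior A \<union> (A - interior A)) = emeasure lebesgue (interior A)"
    by (intro emeasure_Un_null_set) auto
  moreover have "interior A \<union> (A - interior A) = A" using interior_subset by auto
  ultimately show ?thesis by (simp add: emeasure_completion)
qed

theorem theorem15:
  fixes D :: "(complex ^ 'n) set"
  assumes "open D" and "D \<noteq> {}" and "convex D"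
  shows "ereal_convex_on D (\<lambda>z. - ennreal_ln (emeasure lebesgue (azukawa_indicatrix D z)))"
proof -
  let ?I = "azukawa_indicatrix D"
  \<comment> \<open>Taking equal base points in the combination property gives convexity of a single
    indicatrix.\<close>
  have conv: "convex (?I w)" if "w \<in> D" for w
  proof (rule convexI)
    fix X Y and u v :: real assume "X \<in> ?I w" "Y \<in> ?I w" "0 \<le> u" "0 \<le> v" "u + v = 1"
    then show "u *\<^sub>R X + v *\<^sub>R Y \<in> ?I w"
      using azukawa_indicatrix_convex_combination[OF assms(1,3) that that, of v X Y]
      by (simp add: eq_diff_eq[symmetric] flip: scaleR_add_left)
  qed
  have ne: "interior (?I w) \<noteq> {}" if w: "w \<in> D" for w
  proof -
    obtain r where "0 < r" "ball 0 r \<subseteq> ?I w" by (rule azukawa_indicatrix_contains_ball[OF assms(1,3) w])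
    then have "0 \<in> interior (?I w)" by (intro interiorI[of "ball 0 r"]) auto
    then show ?thesis by blast
  qed
  have meas: "emeasure lebesgue (?I w) = emeasure lborel (interior (?I w))" if "w \<in> D" for w
    by (rule emeasure_lebesgue_convex[OF conv[OF that]])
  have gt: "ennreal_ln (emeasure lebesgue (?I w)) \<noteq> - \<infinity>" if "w \<in> D" for w
    unfolding meas[OF that]
    by (intro ennreal_ln_gt_MInfty ln_measure_Int_ball_tendsto(4) open_interior ne[OF that])
  show ?thesis
    unfolding ereal_convex_on_def
  proof (intro conjI ballI allI impI)
    show "convex D" by (rule assms(3))
    show "- ennreal_ln (emeasure lebesgue (?I w)) < \<infinity>" if "w \<in> D" for w
      using gt[OF that] by (cases "ennreal_ln (emeasure lebesgue (?I w))") auto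
    fix w0 w1 and t :: real assume w: "w0 \<in> D" "w1 \<in> D" and "0 < t \<and> t < 1"
    then have t: "0 < t" "t < 1" by auto
    define w where "w = (1 - t) *\<^sub>R w0 + t *\<^sub>R w1"
    have "w \<in> D" unfolding w_def using w t by (intro convexD[OF assms(3)]) auto
    \<comment> \<open>The volume inequality concerns open sets; the mixture of the interiors is open
      and so lands in the interior of the indicatrix at \<open>w\<close>.\<close>
    have "minkowski_mix t (interior (?I w0)) (interior (?I w1)) \<subseteq> minkowski_mix t (?I w0) (?I w1)"
      by (intro minkowski_mix_mono interior_subset)
    also have "\<dots> \<subseteq> ?I w"
      using azukawa_indicatrix_convex_combination[OF assms(1,3) w, of t] t
      by (auto simp: minkowski_mix_def w_def)
    finally have "minkowski_mix t (interior (?I w0)) (interior (?I w1)) \<subseteq> interior (?I w)"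
      using t by (intro interior_maximal open_minkowski_mix) auto
    then have "ereal (1 - t) * ennreal_ln (emeasure lebesgue (?I w0)) + ereal t * ennreal_ln (emeasure lebesgue (?I w1))
       \<le> ennreal_ln (emeasure lebesgue (?I w))"
      unfolding meas[OF w(1)] meas[OF w(2)] meas[OF \<open>w \<in> D\<close>]
      by (intro ln_brunn_minkowski_open ne w t open_interior)
    \<comment> \<open>With -\<infinity> excluded for the logarithms, negation is compatible with the
      weighted sum; infinite volume becomes the value -\<infinity> of the convex function.\<close>
    then show "- ennreal_ln (emeasure lebesgue (?I ((1 - t) *\<^sub>R w0 + t *\<^sub>R w1)))
        \<le> ereal (1 - t) * - ennreal_ln (emeasure lebesgue (?I w0)) + ereal t * - ennreal_ln (emeasure lebesgue (?I w1))"
      unfolding w_def[symmetric] using gt[OF w(1)] gt[OF w(2)] gt[OF \<open>w \<in> D\<close>] t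
      by (cases "ennreal_ln (emeasure lebesgue (?I w0))"; cases "ennreal_ln (emeasure lebesgue (?I w1))";
          cases "ennreal_ln (emeasure lebesgue (?I w))") auto
  qed
qed

end
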